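(* Let $H$ be a finite connected simple graph. If the graphon parameter $t(H,\cdot)$ is cut distance compatible, i.e. $W_1\preceq W_2$ implies $t(H,W_1)\le t(H,W_2)$ for all graphons $W_1,W_2$ (or, equivalently, if $H$ has the step Sidorenko property), then $H$ has the weak Hölder property.
   Context: $\Omega$ is a standard Borel space with an atomless probability measure $\nu$. A graphon is a symmetric measurable function $W:\Omega^2\to[0,1]$ (modulo null sets); $\mathcal W_0$ is the set of graphons. For a measure preserving bijection $\varphi:\Omega\to\Omega$ put $W^\varphi(x,y)=W(\varphi(x),\varphi(y))$. Graphons $\Gamma_n$ converge weak* to $W$ if $\int_{S\times T}\Gamma_n\to\int_{S\times T}W$ for all measurable $S,T\subset\Omega$. The envelope $\langle W\rangle$ is the set of all graphons $U$ for which there are measure preserving bijections $\pi_1,\pi_2,\ldots$ of $\Omega$ with $W^{\pi_n}\to U$ weak*. Write $U\preceq W$ if $\langle U\rangle\subset\langle W\rangle$. For a finite graph $H$ on vertices $v_1,\dots,v_n$ and a graphon $W$, $t(H,W)=\int_{\Omega^n}\prod_{v_iv_j\in E(H)}W(x_i,x_j)\,\mathrm d\nu^{\otimes n}$. For a finite (measurable) partition $\mathcal P=\{\Omega_1,\dots,\Omega_k\}$ of $\Omega$, $W^{\Join\mathcal P}$ is the graphon that is constant on each $\Omega_i\times\Omega_j$, equal there to the average of $W$ on $\Omega_i\times\Omega_j$. $H$ has the step Sidorenko property if $t(H,W^{\Join\mathcal P})\le t(H,W)$ for every graphon $W$ and every finite partition $\mathcal P$ of $\Omega$. A $\mathcal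 W_0$-decoration of $H$ is a family $w=(W_e)_{e\in E(H)}$ of graphons, and $t(H,w)=\int_{\Omega^n}\prod_{v_iv_j\in E(H)}W_{v_iv_j}(x_i,x_j)\,\mathrm d\nu^{\otimes n}$. $H$ has the weak Hölder property (is weakly Hölder) if $t(H,w)^{e(H)}\le\prod_{e\in E(H)}t(H,W_e)$ for every $\mathcal W_0$-decoration $w$ of $H$, where $e(H)=|E(H)|$. *)

theory Defs
  imports "HOL-Probability.Probability"
begin

section \<open>The ground space\<close>

definition standard_borel :: "'a measure \<Rightarrow> bool" where
  "standard_borel M \<longleftrightarrow>
     (\<exists>X. topspace X = space M \<and> completely_metrizable_space X \<and> second_countable X \<and>
          sets M = sigma_sets (topspace X) {U. openin X U})"

definition atomless :: "'a measure \<Rightarrow> bool" where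
  "atomless M \<longleftrightarrow>
     (\<forall>A\<in>sets M. 0 < emeasure M A \<longrightarrow>
        (\<exists>B\<in>sets M. B \<subseteq> A \<and> 0 < emeasure M B \<and> emeasure M B < emeasure M A))"

text \<open>On a standard Borel space the inverse of a measurable bijection is automatically measurable,
  so measurability of the inverse is not demanded.\<close>

definition measure_preserving_bij :: "'a measure \<Rightarrow> ('a \<Rightarrow> 'a) \<Rightarrow> bool" where
  "measure_preserving_bij M \<phi> \<longleftrightarrow>
     bij_betw \<phi> (space M) (space M) \<and> \<phi> \<in> measurable M M \<and> distr M M \<phi> = M"


section \<open>Graphons and the envelope order\<close>

text \<open>Graphons are handled through representatives that are symmetric and \<open>[0,1]\<close>-valued
  everywhere on \<open>\<Omega>\<^sup>2\<close>; every class modulo null sets has one. No quotient is formed, since all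
  the notions below are invariant under changing a representative on a null set.\<close>

definition graphon :: "'a measure \<Rightarrow> ('a \<Rightarrow> 'a \<Rightarrow> real) \<Rightarrow> bool" where
  "graphon M W \<longleftrightarrow>
     (\<lambda>(x, y). W x y) \<in> borel_measurable (M \<Otimes>\<^sub>M M) \<and>
     (\<forall>x\<in>space M. \<forall>y\<in>space M. W x y = W y x \<and> 0 \<le> W x y \<and> W x y \<le> 1)"

definition rect_integral :: "'a measure \<Rightarrow> ('a \<Rightarrow> 'a \<Rightarrow> real) \<Rightarrow> 'a set \<Rightarrow> 'a set \<Rightarrow> real" where
  "rect_integral M W S T = (LINT z:S \<times> T|M \<Otimes>\<^sub>M M. W (fst z) (snd z))"

definition weak_star_conv ::
  "'a measure \<Rightarrow> (nat \<Rightarrow> 'a \<Rightarrow> 'a \<Rightarrow> real) \<Rightarrow> ('a \<Rightarrow> 'a \<Rightarrow> real) \<Rightarrow> bool" where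
  "weak_star_conv M \<Gamma> W \<longleftrightarrow>
     (\<forall>S\<in>sets M. \<forall>T\<in>sets M.
        (\<lambda>n. rect_integral M (\<Gamma> n) S T) \<longlonglongrightarrow> rect_integral M W S T)"

definition version :: "('a \<Rightarrow> 'a \<Rightarrow> real) \<Rightarrow> ('a \<Rightarrow> 'a) \<Rightarrow> 'a \<Rightarrow> 'a \<Rightarrow> real" where
  "version W \<phi> = (\<lambda>x y. W (\<phi> x) (\<phi> y))"

definition envelope :: "'a measure \<Rightarrow> ('a \<Rightarrow> 'a \<Rightarrow> real) \<Rightarrow> ('a \<Rightarrow> 'a \<Rightarrow> real) set" where
  "envelope M W =
     {U. graphon M U \<and>
         (\<exists>\<pi>. (\<forall>n. measure_preserving_bij M (\<pi> n)) \<and> weak_star_conv M (\<lambda>n. version W (\<pi> n)) U)}"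

definition env_le :: "'a measure \<Rightarrow> ('a \<Rightarrow> 'a \<Rightarrow> real) \<Rightarrow> ('a \<Rightarrow> 'a \<Rightarrow> real) \<Rightarrow> bool" where
  "env_le M U W \<longleftrightarrow> envelope M U \<subseteq> envelope M W"

definition cut_distance_compatible ::
  "'a measure \<Rightarrow> (('a \<Rightarrow> 'a \<Rightarrow> real) \<Rightarrow> real) \<Rightarrow> bool" where
  "cut_distance_compatible M \<theta> \<longleftrightarrow>
     (\<forall>W\<^sub>1 W\<^sub>2. graphon M W\<^sub>1 \<longrightarrow> graphon M W\<^sub>2 \<longrightarrow> env_le M W\<^sub>1 W\<^sub>2 \<longrightarrow> \<theta> W\<^sub>1 \<le> \<theta> W\<^sub>2)"


section \<open>Stepping\<close>

definition finite_measurable_partition :: "'a measure \<Rightarrow> 'a set set \<Rightarrow> bool" where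
  "finite_measurable_partition M P \<longleftrightarrow> finite P \<and> P \<subseteq> sets M \<and> partition_on (space M) P"

text \<open>Null parts are allowed; on them the average is \<open>0 / 0 = 0\<close>, which only affects a null set
  of \<open>\<Omega>\<^sup>2\<close>.\<close>

definition stepping ::
  "'a measure \<Rightarrow> 'a set set \<Rightarrow> ('a \<Rightarrow> 'a \<Rightarrow> real) \<Rightarrow> 'a \<Rightarrow> 'a \<Rightarrow> real" where
  "stepping M P W x y =
     (\<Sum>A\<in>P. \<Sum>B\<in>P. indicator A x * indicator B y *
        (rect_integral M W A B / (measure M A * measure M B)))"

lemma stepping_eq:
  assumes P: "finite_measurable_partition M P" and A: "A \<in> P" "x \<in> A" and B: "B \<in> P" "y \<in> B"
  shows "stepping M P W x y = rect_integral M W A B / (measure M A * measure M B)"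
proof -
  have fin: "finite P" and dis: "disjoint P"
    using P by (auto simp: finite_measurable_partition_def partition_on_def)
  have 1: "indicator C x = (if C = A then 1 else 0 :: real)" if "C \<in> P" for C
    using dis A that by (auto simp: disjoint_def indicator_def)
  have 2: "indicator C y = (if C = B then 1 else 0 :: real)" if "C \<in> P" for C
    using dis B that by (auto simp: disjoint_def indicator_def)
  have "stepping M P W x y = (\<Sum>C\<in>P. \<Sum>D\<in>P. if C = A then if D = B then
          rect_integral M W C D / (measure M C * measure M D) else 0 else 0)"
    unfolding stepping_def by (intro sum.cong refl) (simp add: 1 2)
  also have "\<dots> = (\<Sum>C\<in>P. if C = A then \<Sum>D\<in>P. if D = B then
          rect_integral M W C D / (measure M C * measure M D) else 0 else 0)"
    by (intro sum.cong refl) simp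
  also have "\<dots> = rect_integral M W A B / (measure M A * measure M B)"
    using fin A B by simp
  finally show ?thesis .
qed


section \<open>Graphs and homomorphism densities\<close>

text \<open>A graph is given by its vertex set and its edge set; edges are two-element sets of
  vertices.\<close>

definition finite_simple_graph :: "'v set \<Rightarrow> 'v set set \<Rightarrow> bool" where
  "finite_simple_graph V E \<longleftrightarrow> finite V \<and> (\<forall>e\<in>E. e \<subseteq> V \<and> card e = 2)"

definition connected_graph :: "'v set \<Rightarrow> 'v set set \<Rightarrow> bool" where
  "connected_graph V E \<longleftrightarrow>
     V \<noteq> {} \<and> (\<forall>u\<in>V. \<forall>v\<in>V. (u, v) \<in> {(a, b). {a, b} \<in> E}\<^sup>*)"

text \<open>The value \<open>W(x\<^sub>u, x\<^sub>v)\<close> for an edge \<open>e = {u, v}\<close>. It does not depend on the order of the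
  endpoints because \<open>W\<close> is symmetric.\<close>

definition edge_val :: "('a \<Rightarrow> 'a \<Rightarrow> real) \<Rightarrow> ('v \<Rightarrow> 'a) \<Rightarrow> 'v set \<Rightarrow> real" where
  "edge_val W x e = (THE r. \<exists>u v. e = {u, v} \<and> r = W (x u) (x v))"

lemma edge_val_eq:
  assumes "W (x u) (x v) = W (x v) (x u)"
  shows "edge_val W x {u, v} = W (x u) (x v)"
  unfolding edge_val_def
proof (rule the_equality)
  show "\<exists>u' v'. {u, v} = {u', v'} \<and> W (x u) (x v) = W (x u') (x v')"
    by blast
next
  fix r
  assume "\<exists>u' v'. {u, v} = {u', v'} \<and> r = W (x u') (x v')"
  then show "r = W (x u) (x v)"
    using assms by (auto simp: doubleton_eq_iff)
qed

definition decorated_density ::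
  "'a measure \<Rightarrow> 'v set \<Rightarrow> 'v set set \<Rightarrow> ('v set \<Rightarrow> 'a \<Rightarrow> 'a \<Rightarrow> real) \<Rightarrow> real" where
  "decorated_density M V E w = (LINT x|PiM V (\<lambda>_. M). (\<Prod>e\<in>E. edge_val (w e) x e))"

definition hom_density ::
  "'a measure \<Rightarrow> 'v set \<Rightarrow> 'v set set \<Rightarrow> ('a \<Rightarrow> 'a \<Rightarrow> real) \<Rightarrow> real" where
  "hom_density M V E W = (LINT x|PiM V (\<lambda>_. M). (\<Prod>e\<in>E. edge_val W x e))"

definition step_sidorenko :: "'a measure \<Rightarrow> 'v set \<Rightarrow> 'v set set \<Rightarrow> bool" where
  "step_sidorenko M V E \<longleftrightarrow>
     (\<forall>W P. graphon M W \<longrightarrow> finite_measurable_partition M P \<longrightarrow>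
        hom_density M V E (stepping M P W) \<le> hom_density M V E W)"

definition weakly_hoelder :: "'a measure \<Rightarrow> 'v set \<Rightarrow> 'v set set \<Rightarrow> bool" where
  "weakly_hoelder M V E \<longleftrightarrow>
     (\<forall>w. (\<forall>e\<in>E. graphon M (w e)) \<longrightarrow>
        decorated_density M V E w ^ card E \<le> (\<Prod>e\<in>E. hom_density M V E (w e)))"

end

theory Submission
  imports Defs
begin

text \<open>A standard Borel space is coded by a Borel set of reals, so the quantile transform identifies
  an atomless one, up to a null set, with the unit interval. Transporting grid permutations of the
  interval gives measure preserving bijections that mix the space within each part of a partition,
  so every stepping of a finite-valued graphon \<open>W\<close> is a weak* limit of versions of \<open>W\<close>; a diagonal argument
  puts its whole envelope below that of \<open>W\<close>. Conversely, a weak* limit is controlled by its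
  steppings, because these converge along the sequence and refine to the limit in \<open>L\<^sup>1\<close>.

  For the weak Hoelder property, put scaled copies \<open>c\<^sub>e * W\<^sub>e\<close> on the diagonal blocks of a graphon and
  step by merging the blocks. As \<open>H\<close> is connected, the step Sidorenko property bounds
  \<open>t(H, w) * (\<Prod>e. c\<^sub>e)\<close> by a constant times \<open>\<Sum>e. c\<^sub>e ^ e(H) * t(H, W\<^sub>e)\<close>. Balancing the \<open>c\<^sub>e\<close> gives the weak
  Hoelder inequality up to a constant depending only on \<open>H\<close>, and tensor powers remove the constant.\<close>

section \<open>Borel coding of standard Borel spaces\<close>

text \<open>Two obstacles shape the analytic half. The identification with the unit interval holds
  only up to a null set, while \<open>measure_preserving_bij\<close> demands bijections of the whole
  space; grid swaps are involutions, so using one where it can be transported and the identity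
  elsewhere gives an exact bijection. And t(H, .) is continuous in \<open>L\<^sup>1\<close> but not
  for weak* convergence; so the envelope argument is made for finite-valued graphons, whose
  rectangle integrals are bilinear in measures of sets, and \<open>L\<^sup>1\<close> density does
  the rest.

  In the combinatorial half, let m = e(H). Zero off-diagonal blocks keep mixed products out of the
  upper bound, while merging lets every edge choose its own summand, which is how t(H, w) appears.
  The average carries 1/m^2 because all m^2 pairs of blocks are equally heavy and only the diagonal
  ones contribute. The resulting constant ((m^2)^m * m)^m depends neither on the vertex weights nor
  on the matrices, so it stays the same when the data are tensored, and comparing powers with
  exponent 2^n forces it down to 1.\<close>

definition ternary :: "(nat \<Rightarrow> bool) \<Rightarrow> real" where
  "ternary y = (\<Sum>i. of_bool (y i) * (1/3) ^ Suc i)"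

lemma summable_ternary: "summable (\<lambda>i. of_bool (y i) * (1/3) ^ Suc i :: real)"
  by (rule summable_comparison_test'[where N = 0 and g = "\<lambda>i. (1/3) ^ Suc i"])
     (auto simp: of_bool_def intro!: summable_mult summable_geometric)

lemma ternary_Suc: "ternary y = (of_bool (y 0) + ternary (\<lambda>i. y (Suc i))) / 3"
proof -
  have "ternary y = (\<Sum>i. of_bool (y (Suc i)) * (1/3) ^ Suc (Suc i)) + of_bool (y 0) * (1/3) ^ Suc 0"
    unfolding ternary_def using suminf_split_initial_segment[OF summable_ternary, of y 1] by simp
  also have "(\<Sum>i. of_bool (y (Suc i)) * (1/3) ^ Suc (Suc i)) =
      (\<Sum>i. (1/3) * (of_bool (y (Suc i)) * (1/3::real) ^ Suc i))"
    by (intro arg_cong[where f = suminf] ext) simp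
  also have "\<dots> = (1/3) * ternary (\<lambda>i. y (Suc i))"
    unfolding ternary_def by (rule suminf_mult[OF summable_ternary])
  finally show ?thesis by simp
qed

lemma ternary_bounds: "0 \<le> ternary y" "ternary y \<le> 1/2"
proof -
  show "0 \<le> ternary y"
    unfolding ternary_def by (intro suminf_nonneg summable_ternary) auto
  have "ternary y \<le> (\<Sum>i. (1/3) ^ Suc i)"
    unfolding ternary_def
    by (intro suminf_le summable_ternary)
      (auto simp: of_bool_def intro!: summable_mult summable_geometric)
  also have "\<dots> = (1/3) * (\<Sum>i. (1/3) ^ i)"
    by (simp only: power_Suc) (intro suminf_mult summable_geometric, simp)
  also have "\<dots> = 1/2" by (simp add: suminf_geometric)
  finally show "ternary y \<le> 1/2" .
qed

text \<open>Digits 0 and 1 in base 3 leave a gap: a tail is at most 1/2, so a code with first digit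
  0 is at most 1/6. Hence digits can be read back, which fails for binary expansions at dyadic
  points.\<close>

lemma ternary_ge_iff: "1/3 \<le> ternary y \<longleftrightarrow> y 0"
  using ternary_bounds[of "\<lambda>i. y (Suc i)"] by (subst ternary_Suc) (auto simp: of_bool_def)

text \<open>Greedy digit extraction, total on the reals: on a code it drops the first
  \<open>n\<close> digits, and elsewhere it is just some Borel function. This makes decoding, and
  the set of codes, Borel.\<close>

primrec ternary_rem :: "nat \<Rightarrow> real \<Rightarrow> real" where
  "ternary_rem 0 t = t"
| "ternary_rem (Suc n) t = 3 * ternary_rem n t - of_bool (1/3 \<le> ternary_rem n t)"

definition ternary_digit :: "real \<Rightarrow> nat \<Rightarrow> bool" where
  "ternary_digit t n \<longleftrightarrow> 1/3 \<le> ternary_rem n t"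

lemma ternary_rem_ternary: "ternary_rem n (ternary y) = ternary (\<lambda>i. y (i + n))"
proof (induction n)
  case (Suc n)
  have *: "1/3 \<le> ternary (\<lambda>i. y (i + n)) \<longleftrightarrow> y n"
    by (subst ternary_ge_iff) simp
  show ?case
    unfolding ternary_rem.simps Suc * using ternary_Suc[of "\<lambda>i. y (i + n)"] by simp
qed simp

lemma ternary_digit_ternary: "ternary_digit (ternary y) = y"
  by (rule ext) (simp add: ternary_digit_def ternary_rem_ternary ternary_ge_iff[simplified])

lemma measurable_ternary_rem [measurable]: "ternary_rem n \<in> borel_measurable borel"
  by (induction n) simp_all

lemma measurable_ternary_digit [measurable]: "Measurable.pred borel (\<lambda>t. ternary_digit t n)"
  unfolding ternary_digit_def by measurable

text \<open>The conditions describe the neighbourhood filters of points within the countable base \<open>U\<close>;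
  completeness turns a filter with small sets and enough closed sets into a point.\<close>

lemma (in Metric_space) base_indicator_iff:
  fixes U :: "nat \<Rightarrow> 'a set" and y :: "nat \<Rightarrow> bool"
  assumes complete: mcomplete
    and opn: "\<And>i. openin mtopology (U i)"
    and base: "\<And>V x. openin mtopology V \<Longrightarrow> x \<in> V \<Longrightarrow> \<exists>i. x \<in> U i \<and> U i \<subseteq> V"
  shows "(\<exists>x\<in>M. \<forall>i. y i \<longleftrightarrow> x \<in> U i) \<longleftrightarrow>
    (\<forall>n. \<exists>i. y i \<and> (\<exists>a. U i \<subseteq> mcball a (1 / Suc n))) \<and>
    (\<forall>i j. y i \<and> y j \<longrightarrow> (\<exists>k. y k \<and> U k \<noteq> {} \<and> mtopology closure_of (U k) \<subseteq> U i \<inter> U j)) \<and>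
    (\<forall>i j. y i \<and> U i \<subseteq> U j \<longrightarrow> y j)"
    (is "?L \<longleftrightarrow> ?A \<and> ?B \<and> ?C")
proof
  assume ?L
  then obtain x where x: "x \<in> M" and y: "\<And>i. y i \<longleftrightarrow> x \<in> U i" by blast
  have ?A
  proof
    fix n
    obtain i where "x \<in> U i" "U i \<subseteq> mball x (1 / Suc n)"
      using base[of "mball x (1 / Suc n)" x] x by auto
    then show "\<exists>i. y i \<and> (\<exists>a. U i \<subseteq> mcball a (1 / Suc n))"
      using y mball_subset_mcball by blast
  qed
  moreover have ?B
  proof (intro allI impI)
    fix i j assume "y i \<and> y j"
    then have "openin mtopology (U i \<inter> U j)" "x \<in> U i \<inter> U j"
      using y opn by auto
    then obtain r where r: "r > 0" "mcball x r \<subseteq> U i \<inter> U j"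
      by (meson openin_mtopology_mcball)
    obtain k where k: "x \<in> U k" "U k \<subseteq> mball x r"
      using base[of "mball x r" x] x r by auto
    have "mtopology closure_of (U k) \<subseteq> mcball x r"
      by (rule closure_of_minimal) (use k mball_subset_mcball in auto)
    then show "\<exists>k. y k \<and> U k \<noteq> {} \<and> mtopology closure_of (U k) \<subseteq> U i \<inter> U j"
      using k y r by blast
  qed
  moreover have ?C using y by blast
  ultimately show "?A \<and> ?B \<and> ?C" by blast
next
  assume R: "?A \<and> ?B \<and> ?C"
  define \<C> where "\<C> = {mtopology closure_of (U k) |k. y k}"
  have sub: "U k \<subseteq> mtopology closure_of (U k)" for k
    by (rule closure_of_subset[OF openin_subset[OF opn]])
  have small: "\<exists>C a. C \<in> \<C> \<and> C \<subseteq> mcball a e" if "e > 0" for e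
  proof -
    obtain n where n: "1 / Suc n < e" using \<open>e > 0\<close> nat_approx_posE by blast
    obtain i a where i: "y i" "U i \<subseteq> mcball a (1 / Suc n)" using R by meson
    have "mtopology closure_of (U i) \<subseteq> mcball a (1 / Suc n)"
      by (rule closure_of_minimal) (use i in auto)
    also have "\<dots> \<subseteq> mcball a e" using n by (intro mcball_subset_concentric) simp
    finally show ?thesis using i unfolding \<C>_def by blast
  qed
  \<comment> \<open>The second condition directs the chosen sets downwards, so any finite
    intersection of the closures contains a nonempty chosen set.\<close>
  have fip: "\<exists>k. y k \<and> U k \<noteq> {} \<and> U k \<subseteq> \<Inter>\<F>" if "finite \<F>" "\<F> \<subseteq> \<C>" for \<F>
    using that
  proof (induction \<F>)
    case empty
    then show ?case using R by (metis Inter_empty top_greatest)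
  next
    case (insert C \<F>)
    then obtain k l where kl: "y k" "U k \<subseteq> \<Inter>\<F>" "y l" "C = mtopology closure_of (U l)"
      unfolding \<C>_def by auto
    then obtain m where "y m" "U m \<noteq> {}" "mtopology closure_of (U m) \<subseteq> U k \<inter> U l"
      using R by blast
    then show ?case using kl sub[of m] sub[of l] by (intro exI[of _ m]) auto
  qed
  have "\<forall>C\<in>\<C>. closedin mtopology C" unfolding \<C>_def by auto
  moreover have "\<forall>e>0. \<exists>C a. C \<in> \<C> \<and> C \<subseteq> mcball a e" using small by blast
  moreover have "\<forall>\<F>. finite \<F> \<and> \<F> \<subseteq> \<C> \<longrightarrow> \<Inter>\<F> \<noteq> {}" using fip by (metis subset_empty)
  ultimately have "\<exists>x. x \<in> M \<and> \<Inter>\<C> = {x}"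
    by (intro complete[unfolded mcomplete_fip_sing, THEN spec, THEN mp] conjI)
  then obtain x where x: "x \<in> M" "\<Inter>\<C> = {x}" by blast
  have "y i \<longleftrightarrow> x \<in> U i" for i
  proof
    assume "y i"
    then obtain k where "y k" "mtopology closure_of (U k) \<subseteq> U i" using R by blast
    then show "x \<in> U i" using x unfolding \<C>_def by blast
  next
    assume "x \<in> U i"
    then obtain r where r: "r > 0" "mball x r \<subseteq> U i"
      using opn openin_mtopology by blast
    obtain n where n: "1 / Suc n < r / 2" using nat_approx_posE[of "r/2"] r by auto
    obtain j a where j: "y j" "U j \<subseteq> mcball a (1 / Suc n)" using R by meson
    have "mtopology closure_of (U j) \<subseteq> mcball a (1 / Suc n)"
      by (rule closure_of_minimal) (use j in auto)
    then have "x \<in> mcball a (1 / Suc n)" using x j unfolding \<C>_def by blast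
    \<comment> \<open>Both \<open>x\<close> and \<open>U j\<close> lie within 1 / Suc n of
      \<open>a\<close>, and 2 / Suc n < r. The third condition then passes from \<open>y j\<close>
      to \<open>y i\<close>.\<close>
    have "U j \<subseteq> mball x r"
    proof
      fix z assume "z \<in> U j"
      then have z: "z \<in> mcball a (1 / Suc n)" using j by blast
      then have "d x z \<le> d x a + d a z" using x by (intro triangle) auto
      also have "d x a = d a x" by (rule commute)
      also have "d a x + d a z < r"
        using z \<open>x \<in> mcball a (1 / Suc n)\<close> n by auto
      finally show "z \<in> mball x r" using z x by auto
    qed
    then show "y i" using r R j by (meson order_trans)
  qed
  then show ?L using x by blast
qed

text \<open>A point is coded by the sequence of base sets that contain it, read as a ternary number.
  The image is Borel because being such a sequence is a countable Boolean condition on the digits;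
  therefore the inverse extends to a Borel map on the whole line.\<close>

lemma standard_borel_embedding:
  assumes "standard_borel M" "space M \<noteq> {}"
  obtains f :: "'a \<Rightarrow> real" and g where
    "f \<in> borel_measurable M" "g \<in> measurable borel M" "f ` space M \<in> sets borel"
    "\<And>x. x \<in> space M \<Longrightarrow> g (f x) = x"
proof -
  obtain X where X: "topspace X = space M" "completely_metrizable_space X" "second_countable X"
    "sets M = sigma_sets (topspace X) {U. openin X U}"
    using assms unfolding standard_borel_def by blast
  obtain S d where S: "Metric_space S d" "Metric_space.mcomplete S d"
    "X = Metric_space.mtopology S d"
    using X(2) unfolding completely_metrizable_space_def by blast
  interpret Metric_space S d by (rule S)
  have SM: "S = space M" using X(1) S(3) by simp
  obtain \<B> where \<B>: "countable \<B>" "\<And>V. V \<in> \<B> \<Longrightarrow> openin X V"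
    "\<And>U x. openin X U \<Longrightarrow> x \<in> U \<Longrightarrow> \<exists>V\<in>\<B>. x \<in> V \<and> V \<subseteq> U"
    using X(3) unfolding second_countable_def by auto
  obtain x0 where x0: "x0 \<in> space M" using assms by blast
  have "\<B> \<noteq> {}" using \<B>(3)[OF openin_topspace, of x0] x0 X(1) by auto
  then obtain U :: "nat \<Rightarrow> 'a set" where U: "range U = \<B>"
    using uncountable_def \<B>(1) by blast
  have opn: "openin X (U i)" for i using U \<B>(2) by blast
  have base: "\<exists>i. x \<in> U i \<and> U i \<subseteq> V" if "openin X V" "x \<in> V" for V x
    using \<B>(3)[OF that] U by blast
  have U_sets [measurable]: "U i \<in> sets M" for i
    using opn X(4) by auto
  have gen: "sets M = sigma_sets (space M) (range U)"
  proof
    show "sigma_sets (space M) (range U) \<subseteq> sets M"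
      by (intro sets.sigma_sets_subset) auto
    have "{V. openin X V} \<subseteq> sigma_sets (space M) (range U)"
    proof
      fix V assume "V \<in> {V. openin X V}"
      then have "V = (\<Union>i\<in>{i. U i \<subseteq> V}. U i)" using base by blast
      also have "\<dots> \<in> sigma_sets (space M) (range U)"
        by (intro sigma_sets_UNION countable_image) (auto intro: sigma_sets.Basic)
      finally show "V \<in> sigma_sets (space M) (range U)" .
    qed
    then show "sets M \<subseteq> sigma_sets (space M) (range U)"
      unfolding X(4) X(1) by (rule sigma_sets_mono)
  qed
  \<comment> \<open>Assertions about the sets \<open>U i\<close> alone are constants here. Only the
    digits \<open>y\<close> vary, and they are quantified over natural numbers, so measurability in
    the digits can be read off.\<close>
  have char: "(\<exists>x\<in>space M. \<forall>i. y i \<longleftrightarrow> x \<in> U i) \<longleftrightarrow>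
    (\<forall>n. \<exists>i. y i \<and> (\<exists>a. U i \<subseteq> mcball a (1 / Suc n))) \<and>
    (\<forall>i j. y i \<and> y j \<longrightarrow> (\<exists>k. y k \<and> U k \<noteq> {} \<and> mtopology closure_of (U k) \<subseteq> U i \<inter> U j)) \<and>
    (\<forall>i j. y i \<and> U i \<subseteq> U j \<longrightarrow> y j)" for y
    unfolding SM[symmetric]
    by (rule base_indicator_iff[OF S(2)]) (use opn base S(3) in auto)
  define c where "c x = (\<lambda>i. x \<in> U i)" for x
  \<comment> \<open>The first conjunct selects the numbers that are codes; digit extraction alone
    accepts every real.\<close>
  define R where "R = {t. ternary (ternary_digit t) = t \<and>
    (\<exists>x\<in>space M. \<forall>i. ternary_digit t i \<longleftrightarrow> x \<in> U i)}"
  define f where "f x = ternary (c x)" for x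
  \<comment> \<open>The default \<open>x0\<close> off the image keeps the values of \<open>g\<close>
    inside \<open>space M\<close>.\<close>
  define g where "g t = (if t \<in> R then SOME x. x \<in> space M \<and> (\<forall>i. ternary_digit t i \<longleftrightarrow> x \<in> U i) else x0)" for t
  have img: "f ` space M = R"
  proof
    show "f ` space M \<subseteq> R"
      unfolding f_def R_def by (auto simp: ternary_digit_ternary c_def)
    show "R \<subseteq> f ` space M"
    proof
      fix t assume "t \<in> R"
      then obtain x where "x \<in> space M" "ternary_digit t = c x" "ternary (ternary_digit t) = t"
        unfolding R_def c_def by (auto simp: fun_eq_iff)
      then show "t \<in> f ` space M" unfolding f_def by (intro image_eqI[of _ _ x]) auto
    qed
  qed
  have g: "g t \<in> space M \<and> (\<forall>i. ternary_digit t i \<longleftrightarrow> g t \<in> U i)" if "t \<in> R" for t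
  proof -
    have "\<exists>x. x \<in> space M \<and> (\<forall>i. ternary_digit t i \<longleftrightarrow> x \<in> U i)"
      using that unfolding R_def by auto
    from someI_ex[OF this] show ?thesis unfolding g_def if_P[OF that] .
  qed
  have g_else: "g t = x0" if "t \<notin> R" for t
    unfolding g_def if_not_P[OF that] ..
  have sep: "x = z" if "x \<in> space M" "z \<in> space M" "\<And>i. x \<in> U i \<longleftrightarrow> z \<in> U i" for x z
  proof (rule ccontr)
    assume "x \<noteq> z"
    then have "0 < d x z" using that SM by simp
    then have "x \<in> mball x (d x z)" using that SM by (intro centre_in_mball_iff[THEN iffD2]) auto
    moreover have "openin X (mball x (d x z))" unfolding S(3) by (rule openin_mball)
    ultimately obtain i where "x \<in> U i" "U i \<subseteq> mball x (d x z)"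
      using base by blast
    then have "z \<in> mball x (d x z)" using that(3)[of i] by blast
    then show False by simp
  qed
  have meas_f: "f \<in> borel_measurable M"
    unfolding f_def ternary_def c_def by measurable
  have [measurable]: "Measurable.pred borel (\<lambda>t. \<exists>x\<in>space M. \<forall>i. ternary_digit t i \<longleftrightarrow> x \<in> U i)"
    unfolding char by measurable
  have R_meas [measurable]: "R \<in> sets borel"
    unfolding R_def ternary_def by measurable
  have meas_g: "g \<in> measurable borel M"
  proof (rule measurable_sigma_sets[OF gen])
    show "range U \<subseteq> Pow (space M)" using U_sets sets.sets_into_space by blast
    show "g \<in> space borel \<rightarrow> space M" using g x0 g_else by (metis Pi_I)
    fix A assume "A \<in> range U"
    then obtain i where i: "A = U i" by blast
    have "g -` A \<inter> space borel = {t. if t \<in> R then ternary_digit t i else x0 \<in> U i}"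
      unfolding i using g g_else by (auto split: if_splits)
    also have "\<dots> \<in> sets borel" by measurable
    finally show "g -` A \<inter> space borel \<in> sets borel" .
  qed
  have inv: "g (f x) = x" if "x \<in> space M" for x
  proof -
    have fx: "f x \<in> R" using img that by blast
    have "ternary_digit (f x) = (\<lambda>i. x \<in> U i)"
      unfolding f_def ternary_digit_ternary c_def ..
    then show ?thesis
      by (intro sep) (use g[OF fx] that in simp_all)
  qed
  show ?thesis
    by (rule that[OF meas_f meas_g]) (use R_meas img inv in auto)
qed

section \<open>Mixing measure preserving bijections\<close>

text \<open>Dynkin's theorem for the class of sets on which convergence holds. For a countable
  disjoint union, limit and sum are exchanged by Tannery's theorem, with the uniform bound
  \<open>measure M S\<close> supplying the summable majorant. The set functions are assumed only
  countably additive, so that rectangle integrals with one side fixed qualify.\<close>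

lemma tendsto_on_sigma_sets:
  fixes m :: "nat \<Rightarrow> 'a set \<Rightarrow> real" and l :: "'a set \<Rightarrow> real"
  assumes "finite_measure M" and "Int_stable D" and "D \<subseteq> Pow (space M)"
    and gen: "sets M = sigma_sets (space M) D"
    and add: "\<And>n A. disjoint_family A \<Longrightarrow> range A \<subseteq> sets M \<Longrightarrow> (\<lambda>i. m n (A i)) sums m n (\<Union>i. A i)"
    and addl: "\<And>A. disjoint_family A \<Longrightarrow> range A \<subseteq> sets M \<Longrightarrow> (\<lambda>i. l (A i)) sums l (\<Union>i. A i)"
    and bound: "\<And>n S. S \<in> sets M \<Longrightarrow> \<bar>m n S\<bar> \<le> measure M S"
    and conv: "\<And>S. S \<in> D \<Longrightarrow> (\<lambda>n. m n S) \<longlonglongrightarrow> l S" "(\<lambda>n. m n (space M)) \<longlonglongrightarrow> l (space M)"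
    and "S \<in> sets M"
  shows "(\<lambda>n. m n S) \<longlonglongrightarrow> l S"
proof -
  interpret finite_measure M by fact
  have neg: "f {} = 0 \<and> (\<forall>A\<in>sets M. f (space M - A) = f (space M) - f A)"
    if f: "\<And>A. disjoint_family A \<Longrightarrow> range A \<subseteq> sets M \<Longrightarrow> (\<lambda>i. f (A i)) sums f (\<Union>i. A i)"
    for f :: "'a set \<Rightarrow> real"
  proof -
    \<comment> \<open>A constant series converges only if its terms are 0.\<close>
    have "(\<lambda>i::nat. f {}) sums f (\<Union>i::nat. {})"
      by (rule f) (auto simp: disjoint_family_on_def)
    then have f0: "f {} = 0" by (auto dest!: sums_summable simp: summable_const_iff)
    have "f (space M - A) = f (space M) - f A" if A: "A \<in> sets M" for A
    proof -
      have "(\<lambda>i. f (binaryset A (space M - A) i)) sums f (\<Union>i. binaryset A (space M - A) i)"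
        by (rule f) (use A in \<open>auto simp: disjoint_family_on_def binaryset_def\<close>)
      moreover have "(\<lambda>i. f (binaryset A (space M - A) i)) sums (f A + f (space M - A))"
        by (rule binaryset_sums) (rule f0)
      moreover have "(\<Union>i. binaryset A (space M - A) i) = space M"
        using sets.sets_into_space[OF A] by (auto simp: UN_binaryset_eq)
      ultimately show ?thesis using sums_unique2 by fastforce
    qed
    with f0 show ?thesis by blast
  qed
  have S: "S \<in> sigma_sets (space M) D" using assms by simp
  from \<open>Int_stable D\<close> \<open>D \<subseteq> Pow (space M)\<close> S show ?thesis
  proof (induction rule: sigma_sets_induct_disjoint)
    case (basic A)
    then show ?case by (rule conv)
  next
    case empty
    then show ?case using neg[of "m _"] neg[of l] add addl by simp
  next
    case (compl A)
    have "A \<in> sets M" using compl gen by simp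
    then have "m n (space M - A) = m n (space M) - m n A" "l (space M - A) = l (space M) - l A" for n
      using neg[of "m n"] neg[of l] add addl by auto
    then show ?case using tendsto_diff[OF conv(2) compl(2)] by simp
  next
    case (union A)
    have A: "range A \<subseteq> sets M" using union gen by simp
    have "(\<lambda>n. \<Sum>i. m n (A i)) \<longlonglongrightarrow> (\<Sum>i. l (A i))"
    proof (rule tannerys_theorem[THEN conjunct2, THEN conjunct2])
      show "(\<lambda>n. m n (A i)) \<longlonglongrightarrow> l (A i)" for i by (rule union)
      show "eventually (\<lambda>(i, n). norm (m n (A i)) \<le> measure M (A i)) (at_top \<times>\<^sub>F sequentially)"
        using bound A by (intro always_eventually) auto
      show "summable (\<lambda>i. measure M (A i))"
        using finite_measure_UNION[OF A union(1)] by (rule sums_summable)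
    qed simp
    moreover have "(\<Sum>i. m n (A i)) = m n (\<Union>i. A i)" "(\<Sum>i. l (A i)) = l (\<Union>i. A i)" for n
      using add[OF union(1) A] addl[OF union(1) A] by (simp_all add: sums_iff)
    ultimately show ?case by simp
  qed
qed

section \<open>Grid permutations of the unit interval\<close>

definition unit_leb :: "real measure" where
  "unit_leb = uniform_measure lborel {0..<1}"

lemma sets_unit_leb [simp, measurable_cong]: "sets unit_leb = sets borel"
  and space_unit_leb [simp]: "space unit_leb = UNIV"
  by (simp_all add: unit_leb_def)

lemma measure_unit_leb: "B \<in> sets borel \<Longrightarrow> measure unit_leb B = measure lborel ({0..<1} \<inter> B)"
  by (simp add: unit_leb_def measure_def divide_ennreal_def)

lemma prob_space_unit_leb: "prob_space unit_leb"
  unfolding unit_leb_def by (intro prob_space_uniform_measure) auto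

definition grid_cell :: "nat \<Rightarrow> nat \<Rightarrow> nat \<Rightarrow> real set" where
  "grid_cell N i j = {real (i * N + j) / real (N * N) ..< real (i * N + j + 1) / real (N * N)}"

text \<open>Cut the unit interval into \<open>N\<^sup>2\<close> cells, numbered \<open>i * N + j\<close>, and exchange \<open>i\<close> and \<open>j\<close>: the
  position of a point in the coarse grid of size \<open>N\<close> becomes independent of that of its image.\<close>

definition grid_swap :: "nat \<Rightarrow> real \<Rightarrow> real" where
  "grid_swap N t = (let c = nat \<lfloor>real (N * N) * t\<rfloor> in
     if t \<in> {0..<1} then t + (real (c mod N * N + c div N) - real c) / real (N * N) else t)"

lemma grid_cell_index:
  assumes "N > 0" "t \<in> grid_cell N i j"
  shows "nat \<lfloor>real (N * N) * t\<rfloor> = i * N + j"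
proof -
  have "real (i * N + j) \<le> real (N * N) * t" "real (N * N) * t < real (i * N + j) + 1"
    using assms by (auto simp: grid_cell_def field_simps)
  then have "\<lfloor>real (N * N) * t\<rfloor> = int (i * N + j)" by (intro floor_unique) auto
  then show ?thesis by (simp only: nat_int)
qed

lemma grid_cell_subset:
  assumes "i < N" "j < N"
  shows "grid_cell N i j \<subseteq> {0..<1}"
proof
  fix t assume t: "t \<in> grid_cell N i j"
  have "(i + 1) * N \<le> N * N" using assms by (intro mult_right_mono) auto
  then have "i * N + j + 1 \<le> N * N" using assms by simp
  then have "real (i * N + j + 1) / real (N * N) \<le> 1"
    using assms by (simp add: divide_le_eq_1 del: of_nat_add of_nat_mult of_nat_Suc)
  moreover have "0 \<le> real (i * N + j) / real (N * N)" by (intro divide_nonneg_nonneg) simp_all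
  moreover have "real (i * N + j) / real (N * N) \<le> t" "t < real (i * N + j + 1) / real (N * N)"
    using t unfolding grid_cell_def by simp_all
  ultimately have "0 \<le> t" "t < 1" by linarith+
  then show "t \<in> {0..<1}" by simp
qed

lemma grid_cell_inj:
  assumes "t \<in> grid_cell N i j" "t \<in> grid_cell N i' j'" "j < N" "j' < N"
  shows "i = i' \<and> j = j'"
proof -
  have e: "i * N + j = i' * N + j'"
    using grid_cell_index[of N t] assms by (metis gr_zeroI not_less_zero)
  have "i = (i * N + j) div N" "j = (i * N + j) mod N" using assms by auto
  then show ?thesis using e assms by auto
qed

lemma disjoint_grid_cells: "disjoint_family_on (\<lambda>(i, j). grid_cell N i j) ({..<N} \<times> {..<N})"
  unfolding disjoint_family_on_def
proof (intro ballI impI equals0I)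
  fix p q t
  assume "p \<in> {..<N} \<times> {..<N}" "q \<in> {..<N} \<times> {..<N}" "p \<noteq> q"
    "t \<in> (case p of (i, j) \<Rightarrow> grid_cell N i j) \<inter> (case q of (i, j) \<Rightarrow> grid_cell N i j)"
  then show False
    using grid_cell_inj[of t N "fst p" "snd p" "fst q" "snd q"] by (auto simp: case_prod_beta prod_eq_iff)
qed

lemma grid_cell_cover:
  assumes "N > 0" "t \<in> {0..<1}"
  obtains i j where "i < N" "j < N" "t \<in> grid_cell N i j"
proof -
  define c where "c = nat \<lfloor>real (N * N) * t\<rfloor>"
  have NN: "real (N * N) > 0" using assms by simp
  have "0 \<le> real (N * N) * t" using assms by simp
  then have c: "real c \<le> real (N * N) * t" "real (N * N) * t < real c + 1"
    unfolding c_def by linarith+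
  have "real (N * N) * t < real (N * N)" using NN assms by simp
  then have "real c < real (N * N)" using c by linarith
  then have "c < N * N" by (simp only: of_nat_less_iff)
  then have "c div N < N" by (simp add: less_mult_imp_div_less)
  moreover have "c mod N < N" using assms by simp
  moreover have "t \<in> grid_cell N (c div N) (c mod N)"
    unfolding grid_cell_def using c NN by (simp add: field_simps)
  ultimately show ?thesis using that by blast
qed

lemma grid_swap_cell:
  assumes "i < N" "j < N" "t \<in> grid_cell N i j"
  shows "grid_swap N t = (real (j * N + i) - real (i * N + j)) / real (N * N) + t"
    and "grid_swap N t \<in> grid_cell N j i"
proof -
  have "nat \<lfloor>real (N * N) * t\<rfloor> = i * N + j" using grid_cell_index assms by simp
  then show *: "grid_swap N t = (real (j * N + i) - real (i * N + j)) / real (N * N) + t"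
    unfolding grid_swap_def Let_def using grid_cell_subset[of i N j] assms by auto
  show "grid_swap N t \<in> grid_cell N j i"
    unfolding * using assms unfolding grid_cell_def
    by (auto simp: add_divide_distrib diff_divide_distrib simp del: of_nat_mult)
qed

lemma grid_swap_in:
  assumes "N > 0" "t \<in> {0..<1}"
  shows "grid_swap N t \<in> {0..<1}" "grid_swap N (grid_swap N t) = t"
proof -
  obtain i j where ij: "i < N" "j < N" "t \<in> grid_cell N i j"
    using grid_cell_cover assms by blast
  then show "grid_swap N t \<in> {0..<1}"
    using grid_swap_cell(2) grid_cell_subset by blast
  show "grid_swap N (grid_swap N t) = t"
    unfolding grid_swap_cell(1)[OF ij(2,1) grid_swap_cell(2)[OF ij]]
    unfolding grid_swap_cell(1)[OF ij]
    by (simp add: diff_divide_distrib del: of_nat_add of_nat_mult)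
qed

lemma measurable_grid_swap [measurable]: "grid_swap N \<in> borel_measurable borel"
  unfolding grid_swap_def Let_def by measurable

lemma measurable_grid_cell [measurable]: "grid_cell N i j \<in> sets borel"
  unfolding grid_cell_def by simp

lemma measure_grid_cells:
  assumes "K \<subseteq> {..<N} \<times> {..<N}"
  shows "measure unit_leb (\<Union>(i, j)\<in>K. grid_cell N i j) = card K / (real N * real N)"
proof -
  interpret prob_space unit_leb by (rule prob_space_unit_leb)
  have fin: "finite K" using assms by (rule finite_subset) simp
  have one: "measure unit_leb (grid_cell N i j) = 1 / (real N * real N)" if "(i, j) \<in> K" for i j
  proof -
    have "measure unit_leb (grid_cell N i j) = measure lborel (grid_cell N i j)"
    proof (subst measure_unit_leb)
      have "{0..<1} \<inter> grid_cell N i j = grid_cell N i j"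
        using grid_cell_subset[of i N j] assms that by blast
      then show "measure lborel ({0..<1} \<inter> grid_cell N i j) = measure lborel (grid_cell N i j)" by simp
    qed (simp add: grid_cell_def)
    also have "\<dots> = 1 / (real N * real N)"
      unfolding grid_cell_def
      by (subst measure_lborel_Ico) (auto simp: divide_simps add_divide_distrib[symmetric])
    finally show ?thesis .
  qed
  have "measure unit_leb (\<Union>p\<in>K. case p of (i, j) \<Rightarrow> grid_cell N i j) =
      (\<Sum>p\<in>K. measure unit_leb (case p of (i, j) \<Rightarrow> grid_cell N i j))"
    using fin
  proof (rule finite_measure_finite_Union)
    show "disjoint_family_on (\<lambda>p. case p of (i, j) \<Rightarrow> grid_cell N i j) K"
      by (rule disjoint_family_on_mono[OF assms disjoint_grid_cells])
  qed auto
  also have "\<dots> = (\<Sum>p\<in>K. 1 / (real N * real N))"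
    by (intro sum.cong) (auto simp: one)
  finally show ?thesis by simp
qed

text \<open>On each cell the swap is a translation onto the transposed cell, and translations
  preserve Lebesgue measure. Summing over the cells in transposed order gives the claim.\<close>

lemma measure_grid_swap_vimage:
  assumes N: "N > 0" and B: "B \<in> sets borel"
  shows "measure unit_leb (grid_swap N -` B) = measure unit_leb B"
proof -
  interpret prob_space unit_leb by (rule prob_space_unit_leb)
  let ?K = "{..<N} \<times> {..<N}"
  have dis: "disjoint_family_on (\<lambda>p. S \<inter> (case p of (i, j) \<Rightarrow> grid_cell N i j)) ?K" for S
    using disjoint_grid_cells[of N] unfolding disjoint_family_on_def by blast
  have split: "measure unit_leb S = (\<Sum>i<N. \<Sum>j<N. measure unit_leb (S \<inter> grid_cell N i j))"
    if [measurable]: "S \<in> sets borel" for S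
  proof -
    have cov: "{0..<1} \<inter> S = {0..<1} \<inter> (\<Union>(i, j)\<in>?K. S \<inter> grid_cell N i j)"
    proof (intro equalityI subsetI)
      fix t assume t: "t \<in> {0..<1} \<inter> S"
      then obtain i j where "i < N" "j < N" "t \<in> grid_cell N i j"
        using grid_cell_cover[OF N, of t] by blast
      then show "t \<in> {0..<1} \<inter> (\<Union>(i, j)\<in>?K. S \<inter> grid_cell N i j)" using t by blast
    qed auto
    have "measure unit_leb S = measure lborel ({0..<1} \<inter> S)"
      by (rule measure_unit_leb) (rule that)
    also have "\<dots> = measure unit_leb (\<Union>(i, j)\<in>?K. S \<inter> grid_cell N i j)"
      unfolding cov by (rule measure_unit_leb[symmetric]) (simp add: case_prod_beta)
    also have "(\<Union>(i, j)\<in>?K. S \<inter> grid_cell N i j) = (\<Union>p\<in>?K. S \<inter> (case p of (i, j) \<Rightarrow> grid_cell N i j))"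
      by auto
    also have "measure unit_leb \<dots> = (\<Sum>p\<in>?K. measure unit_leb (S \<inter> (case p of (i, j) \<Rightarrow> grid_cell N i j)))"
      by (rule finite_measure_finite_Union) (use dis in auto)
    also have "\<dots> = (\<Sum>i<N. \<Sum>j<N. measure unit_leb (S \<inter> grid_cell N i j))"
      by (simp add: sum.cartesian_product case_prod_beta)
    finally show ?thesis .
  qed
  have vB [measurable]: "grid_swap N -` B \<in> sets borel"
    using measurable_sets_borel[OF measurable_grid_swap B] .
  have "measure unit_leb (grid_swap N -` B \<inter> grid_cell N i j) = measure unit_leb (B \<inter> grid_cell N j i)"
    if "i < N" "j < N" for i j
  proof -
    define s where "s = (real (j * N + i) - real (i * N + j)) / real (N * N)"
    have "s + t \<in> grid_cell N j i \<longleftrightarrow> t \<in> grid_cell N i j" for t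
      unfolding grid_cell_def s_def
      by (auto simp: add_divide_distrib diff_divide_distrib simp del: of_nat_mult)
    then have eq: "grid_swap N -` B \<inter> grid_cell N i j = (+) s -` (B \<inter> grid_cell N j i)"
      using grid_swap_cell(1)[OF that] by (auto simp: s_def)
    have "measure lborel ((+) s -` (B \<inter> grid_cell N j i)) = measure (distr lborel borel ((+) s)) (B \<inter> grid_cell N j i)"
      using B by (subst measure_distr) auto
    also have "\<dots> = measure lborel (B \<inter> grid_cell N j i)" by (simp add: lborel_distr_plus)
    finally have "measure lborel (grid_swap N -` B \<inter> grid_cell N i j) = measure lborel (B \<inter> grid_cell N j i)"
      unfolding eq .
    moreover have "{0..<1} \<inter> (grid_swap N -` B \<inter> grid_cell N i j) = grid_swap N -` B \<inter> grid_cell N i j"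
      "{0..<1} \<inter> (B \<inter> grid_cell N j i) = B \<inter> grid_cell N j i"
      using grid_cell_subset that by blast+
    ultimately show ?thesis using B by (simp add: measure_unit_leb)
  qed
  then have "measure unit_leb (grid_swap N -` B) = (\<Sum>i<N. \<Sum>j<N. measure unit_leb (B \<inter> grid_cell N j i))"
    unfolding split[OF vB] by (intro sum.cong) auto
  also have "\<dots> = measure unit_leb B" unfolding split[OF B] by (rule sum.swap)
  finally show ?thesis .
qed

lemma measure_unit_leb_atMost: "measure unit_leb {..a} = max 0 (min 1 a)"
proof -
  consider "a < 0" | "0 \<le> a" "a < 1" | "1 \<le> a" by linarith
  then show ?thesis
  proof cases
    case 1
    then have "{0..<1} \<inter> {..a} = {}" by auto
    then show ?thesis using 1 by (simp add: measure_unit_leb)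
  next
    case 2
    then have "{0..<1} \<inter> {..a} = {0..a}" by auto
    then show ?thesis using 2 by (simp add: measure_unit_leb)
  next
    case 3
    then have "{0..<1} \<inter> {..a} = {0..<1}" by auto
    then show ?thesis using 3 by (simp add: measure_unit_leb)
  qed
qed

text \<open>Membership of a point in \<open>{..a}\<close> decides the first index of its cell, and
  membership of its image in \<open>{..b}\<close> decides the second, apart from one boundary index
  each. Within [0,1) the set therefore lies between a union of \<open>c a n * c b n\<close> cells
  and one of at most \<open>Suc (c a n) * Suc (c b n)\<close> cells, and every cell has measure 1 /
  (Suc n)^2.\<close>

lemma grid_swap_atMost:
  fixes a b :: real
  shows "(\<lambda>n. measure unit_leb ({..a} \<inter> grid_swap (Suc n) -` {..b})) \<longlonglongrightarrow>
    measure unit_leb {..a} * measure unit_leb {..b}"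
proof -
  interpret prob_space unit_leb by (rule prob_space_unit_leb)
  \<comment> \<open>\<open>p a\<close> is the measure of \<open>{..a}\<close>, and
    \<open>c a n\<close> counts the coarse intervals of length 1 / Suc n that fit into
    [0, p a].\<close>
  define p :: "real \<Rightarrow> real" where "p a = max 0 (min 1 a)" for a
  define c where "c a n = nat \<lfloor>real (Suc n) * p a\<rfloor>" for a n
  have p: "0 \<le> p a" "p a \<le> 1" for a unfolding p_def by auto
  have c1: "real (c a n) \<le> real (Suc n) * p a" and c2: "real (Suc n) * p a < real (c a n) + 1" for a n
    using p[of a] unfolding c_def by (auto simp del: of_nat_Suc)
  have cN: "c a n \<le> Suc n" for a n
  proof -
    have "real (Suc n) * p a \<le> real (Suc n)" using p[of a] by (simp add: mult_left_le del: of_nat_Suc)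
    then have "real (c a n) \<le> real (Suc n)" using c1[of a n] c2[of n a] by linarith
    then show ?thesis by linarith
  qed
  have lower: "t \<le> a" if "t \<in> grid_cell (Suc n) i j" "i < c a n" "j < Suc n" for t a i j n
  proof -
    have "real (Suc i) \<le> real (Suc n) * p a" using c1[of a n] c2[of n a] that by linarith
    have "i * Suc n + j + 1 \<le> Suc i * Suc n" using that by simp
    then have "real (i * Suc n + j + 1) \<le> real (Suc i) * real (Suc n)"
      by (simp only: of_nat_mult[symmetric] of_nat_le_iff)
    also have "\<dots> \<le> real (Suc n) * p a * real (Suc n)"
      using \<open>real (Suc i) \<le> _\<close> by (intro mult_right_mono) auto
    finally have "real (i * Suc n + j + 1) / real (Suc n * Suc n) \<le> p a"
      unfolding of_nat_mult by (simp add: divide_le_eq mult_ac del: of_nat_Suc of_nat_add of_nat_mult)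
    then have "t < p a" using that unfolding grid_cell_def by auto
    moreover have "0 \<le> t" using that(1) unfolding grid_cell_def
      by (auto intro: order_trans[rotated])
    ultimately show ?thesis unfolding p_def by linarith
  qed
  have upper: "i < Suc (c a n)" if "t \<in> grid_cell (Suc n) i j" "t \<in> {0..<1}" "t \<le> a" for t a i j n
  proof -
    have "t \<le> p a" using that unfolding p_def by auto
    moreover have "real (i * Suc n + j) / real (Suc n * Suc n) \<le> t" using that unfolding grid_cell_def by auto
    ultimately have "real (i * Suc n + j) / real (Suc n * Suc n) \<le> p a" by linarith
    then have "real (i * Suc n + j) \<le> p a * real (Suc n * Suc n)"
      by (simp add: divide_le_eq del: of_nat_Suc of_nat_mult of_nat_add mult_Suc_right)
    moreover have "real (i * Suc n) \<le> real (i * Suc n + j)" by (simp only: of_nat_le_iff)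
    ultimately have "real i * real (Suc n) \<le> (real (Suc n) * p a) * real (Suc n)"
      by (simp only: of_nat_mult mult_ac)
    then have "real i \<le> real (Suc n) * p a" by (rule mult_right_le_imp_le) simp
    then show ?thesis using c1[of a n] c2[of n a] by linarith
  qed
  let ?m = "\<lambda>n. measure unit_leb ({..a} \<inter> grid_swap (Suc n) -` {..b})"
  have meas [measurable]: "grid_swap N -` {..b} \<in> sets borel" for N
    using measurable_sets_borel[OF measurable_grid_swap] by simp
  have lo: "(real (c a n) / real (Suc n)) * (real (c b n) / real (Suc n)) \<le> ?m n" for n
  proof -
    let ?K = "{..<c a n} \<times> {..<c b n}"
    have K: "?K \<subseteq> {..<Suc n} \<times> {..<Suc n}" using cN[of a n] cN[of b n] by fastforce
    have "(\<Union>(i, j)\<in>?K. grid_cell (Suc n) i j) \<subseteq> {..a} \<inter> grid_swap (Suc n) -` {..b}"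
    proof
      fix t assume "t \<in> (\<Union>(i, j)\<in>?K. grid_cell (Suc n) i j)"
      then obtain i j where *: "i < c a n" "j < c b n" "t \<in> grid_cell (Suc n) i j" by auto
      then have "i < Suc n" "j < Suc n" using cN[of a n] cN[of b n] by linarith+
      then show "t \<in> {..a} \<inter> grid_swap (Suc n) -` {..b}"
        using * lower[of t n i j a] lower[of "grid_swap (Suc n) t" n j i b] grid_swap_cell(2)[of i "Suc n" j t]
        by auto
    qed
    then have "measure unit_leb (\<Union>(i, j)\<in>?K. grid_cell (Suc n) i j) \<le> ?m n"
      by (rule finite_measure_mono) auto
    then show ?thesis unfolding measure_grid_cells[OF K] by simp
  qed
  have up: "?m n \<le> (real (Suc (c a n)) / real (Suc n)) * (real (Suc (c b n)) / real (Suc n))" for n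
  proof -
    let ?K = "({..<Suc n} \<inter> {..<Suc (c a n)}) \<times> ({..<Suc n} \<inter> {..<Suc (c b n)})"
    have K: "?K \<subseteq> {..<Suc n} \<times> {..<Suc n}" by auto
    have "{0..<1} \<inter> ({..a} \<inter> grid_swap (Suc n) -` {..b}) \<subseteq> (\<Union>(i, j)\<in>?K. grid_cell (Suc n) i j)"
    proof
      fix t assume t: "t \<in> {0..<1} \<inter> ({..a} \<inter> grid_swap (Suc n) -` {..b})"
      then obtain i j where ij: "i < Suc n" "j < Suc n" "t \<in> grid_cell (Suc n) i j"
        using grid_cell_cover[of "Suc n" t] by blast
      have "i < Suc (c a n)" using upper ij t by auto
      moreover have "j < Suc (c b n)"
        using upper[OF grid_swap_cell(2)[OF ij]] grid_swap_in(1)[of "Suc n" t] t by auto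
      ultimately show "t \<in> (\<Union>(i, j)\<in>?K. grid_cell (Suc n) i j)" using ij by auto
    qed
    then have "measure unit_leb ({0..<1} \<inter> ({..a} \<inter> grid_swap (Suc n) -` {..b})) \<le>
        measure unit_leb (\<Union>(i, j)\<in>?K. grid_cell (Suc n) i j)"
      by (rule finite_measure_mono) auto
    also have "\<dots> = real (card ?K) / (real (Suc n) * real (Suc n))"
      by (rule measure_grid_cells[OF K])
    also have "\<dots> \<le> real (Suc (c a n) * Suc (c b n)) / (real (Suc n) * real (Suc n))"
    proof (intro divide_right_mono, unfold of_nat_le_iff)
      have "card ?K = card ({..<Suc n} \<inter> {..<Suc (c a n)}) * card ({..<Suc n} \<inter> {..<Suc (c b n)})"
        by (rule card_cartesian_product)
      also have "\<dots> \<le> card {..<Suc (c a n)} * card {..<Suc (c b n)}"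
        by (intro mult_mono card_mono) auto
      finally show "card ?K \<le> Suc (c a n) * Suc (c b n)" by (simp only: card_lessThan)
    qed simp
    finally have "measure unit_leb ({0..<1} \<inter> ({..a} \<inter> grid_swap (Suc n) -` {..b})) \<le>
      real (Suc (c a n) * Suc (c b n)) / (real (Suc n) * real (Suc n))" .
    moreover have "measure unit_leb ({0..<1} \<inter> ({..a} \<inter> grid_swap (Suc n) -` {..b})) = ?m n"
      by (simp add: measure_unit_leb Int_assoc[symmetric])
    ultimately show ?thesis unfolding of_nat_mult times_divide_times_eq by simp
  qed
  have lim: "(\<lambda>n. real (c a n) / real (Suc n)) \<longlonglongrightarrow> p a" "(\<lambda>n. real (Suc (c a n)) / real (Suc n)) \<longlonglongrightarrow> p a" for a
  proof -
    have inv: "(\<lambda>n. 1 / real (Suc n)) \<longlonglongrightarrow> 0" by (rule LIMSEQ_Suc[OF lim_1_over_n])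
    have e: "\<bar>real (c a n) / real (Suc n) - p a\<bar> \<le> 1 / real (Suc n)" for n
    proof -
      have "real (c a n) / real (Suc n) - p a = (real (c a n) - real (Suc n) * p a) / real (Suc n)"
        by (simp add: diff_divide_distrib del: of_nat_Suc)
      also have "\<bar>\<dots>\<bar> = \<bar>real (c a n) - real (Suc n) * p a\<bar> / real (Suc n)" by simp
      also have "\<dots> \<le> 1 / real (Suc n)"
        using c1[of a n] c2[of n a] by (intro divide_right_mono) (linarith, simp)
      finally show ?thesis .
    qed
    show 1: "(\<lambda>n. real (c a n) / real (Suc n)) \<longlonglongrightarrow> p a"
      by (rule LIM_zero_cancel, rule Lim_null_comparison[OF _ inv]) (use e in simp)
    have "(\<lambda>n. real (Suc (c a n)) / real (Suc n)) = (\<lambda>n. real (c a n) / real (Suc n) + 1 / real (Suc n))"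
      by (simp add: add_divide_distrib add.commute)
    then show "(\<lambda>n. real (Suc (c a n)) / real (Suc n)) \<longlonglongrightarrow> p a"
      using tendsto_add[OF 1 inv] by simp
  qed
  have "?m \<longlonglongrightarrow> p a * p b"
    by (rule tendsto_sandwich[OF _ _ tendsto_mult[OF lim(1) lim(1)] tendsto_mult[OF lim(2) lim(2)]])
      (use lo up in \<open>auto intro!: always_eventually\<close>)
  then show ?thesis unfolding measure_unit_leb_atMost p_def .
qed

text \<open>Half-lines generate the Borel sets, so the limit is extended in two passes, one set at a
  time. In the second pass the required bound by the measure of the varying set comes from the swap
  being measure preserving.\<close>

lemma grid_swap_mixing:
  assumes A: "A \<in> sets borel" and B: "B \<in> sets borel"
  shows "(\<lambda>n. measure unit_leb (A \<inter> grid_swap (Suc n) -` B)) \<longlonglongrightarrow>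
    measure unit_leb A * measure unit_leb B"
proof -
  interpret prob_space unit_leb by (rule prob_space_unit_leb)
  let ?D = "range (\<lambda>a::real. {..a})"
  have D: "Int_stable ?D" "?D \<subseteq> Pow (space unit_leb)" "sets unit_leb = sigma_sets (space unit_leb) ?D"
    by (auto simp: Int_stable_def borel_eq_atMost[where 'a = real])
  have V [measurable]: "grid_swap N -` S \<in> sets borel" if "S \<in> sets borel" for S N
    using measurable_sets_borel[OF measurable_grid_swap that] .
  have 1: "(\<lambda>n. measure unit_leb (A \<inter> grid_swap (Suc n) -` {..b})) \<longlonglongrightarrow>
      measure unit_leb A * measure unit_leb {..b}" if A: "A \<in> sets borel" for b A
  proof (rule tendsto_on_sigma_sets[where M = unit_leb and D = ?D and
      m = "\<lambda>n A. measure unit_leb (A \<inter> grid_swap (Suc n) -` {..b})" and l = "\<lambda>A. measure unit_leb A * measure unit_leb {..b}"])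
    fix S assume "S \<in> ?D"
    then show "(\<lambda>n. measure unit_leb (S \<inter> grid_swap (Suc n) -` {..b})) \<longlonglongrightarrow> measure unit_leb S * measure unit_leb {..b}"
      using grid_swap_atMost by auto
  next
    fix n :: nat and S :: "nat \<Rightarrow> real set" assume S: "disjoint_family S" "range S \<subseteq> sets unit_leb"
    have "(\<lambda>i. measure unit_leb (S i \<inter> grid_swap (Suc n) -` {..b})) sums
        measure unit_leb (\<Union>i. S i \<inter> grid_swap (Suc n) -` {..b})"
      using S by (intro finite_measure_UNION) (auto simp: disjoint_family_on_def)
    then show "(\<lambda>i. measure unit_leb (S i \<inter> grid_swap (Suc n) -` {..b})) sums
        measure unit_leb ((\<Union>i. S i) \<inter> grid_swap (Suc n) -` {..b})"
      by simp
  next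
    fix S :: "nat \<Rightarrow> real set" assume S: "disjoint_family S" "range S \<subseteq> sets unit_leb"
    then show "(\<lambda>i. measure unit_leb (S i) * measure unit_leb {..b}) sums (measure unit_leb (\<Union>i. S i) * measure unit_leb {..b})"
      by (intro sums_mult2 finite_measure_UNION)
  next
    show "\<bar>measure unit_leb (S \<inter> grid_swap (Suc n) -` {..b})\<bar> \<le> measure unit_leb S" if "S \<in> sets unit_leb" for n S
      using that by (simp add: finite_measure_mono)
  next
    have "measure unit_leb (grid_swap (Suc n) -` {..b}) = measure unit_leb {..b}" for n
      by (rule measure_grid_swap_vimage) auto
    then show "(\<lambda>n. measure unit_leb (space unit_leb \<inter> grid_swap (Suc n) -` {..b})) \<longlonglongrightarrow>
        measure unit_leb (space unit_leb) * measure unit_leb {..b}"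
      using prob_space by simp
  qed (use D A finite_measure_axioms in auto)
  show ?thesis
  proof (rule tendsto_on_sigma_sets[where M = unit_leb and D = ?D and
      m = "\<lambda>n B. measure unit_leb (A \<inter> grid_swap (Suc n) -` B)" and l = "\<lambda>B. measure unit_leb A * measure unit_leb B"])
    fix S assume "S \<in> ?D"
    then show "(\<lambda>n. measure unit_leb (A \<inter> grid_swap (Suc n) -` S)) \<longlonglongrightarrow> measure unit_leb A * measure unit_leb S"
      using 1[OF A] by auto
  next
    fix n :: nat and S :: "nat \<Rightarrow> real set" assume S: "disjoint_family S" "range S \<subseteq> sets unit_leb"
    have "(\<lambda>i. measure unit_leb (A \<inter> grid_swap (Suc n) -` S i)) sums
        measure unit_leb (\<Union>i. A \<inter> grid_swap (Suc n) -` S i)"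
      using S A by (intro finite_measure_UNION) (auto simp: disjoint_family_on_def intro!: sets.Int V)
    moreover have "(\<Union>i. A \<inter> grid_swap (Suc n) -` S i) = A \<inter> grid_swap (Suc n) -` (\<Union>i. S i)" by auto
    ultimately show "(\<lambda>i. measure unit_leb (A \<inter> grid_swap (Suc n) -` S i)) sums
        measure unit_leb (A \<inter> grid_swap (Suc n) -` (\<Union>i. S i))"
      by simp
  next
    fix S :: "nat \<Rightarrow> real set" assume S: "disjoint_family S" "range S \<subseteq> sets unit_leb"
    then show "(\<lambda>i. measure unit_leb A * measure unit_leb (S i)) sums (measure unit_leb A * measure unit_leb (\<Union>i. S i))"
      by (intro sums_mult finite_measure_UNION)
  next
    fix S :: "real set" and n assume S: "S \<in> sets unit_leb"
    have "measure unit_leb (A \<inter> grid_swap (Suc n) -` S) \<le> measure unit_leb (grid_swap (Suc n) -` S)"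
      using S A by (intro finite_measure_mono) auto
    also have "\<dots> = measure unit_leb S" using S by (intro measure_grid_swap_vimage) auto
    finally show "\<bar>measure unit_leb (A \<inter> grid_swap (Suc n) -` S)\<bar> \<le> measure unit_leb S" by simp
  next
    show "(\<lambda>n. measure unit_leb (A \<inter> grid_swap (Suc n) -` space unit_leb)) \<longlonglongrightarrow>
        measure unit_leb A * measure unit_leb (space unit_leb)"
      using prob_space by simp
  qed (use D B finite_measure_axioms in auto)
qed

section \<open>The quantile transform of an atomless standard Borel space\<close>

lemma cdf_quantile:
  assumes "real_distribution D" and atom: "\<And>x. measure D {x} = 0" and "0 < w" "w < 1"
  shows "cdf D (Inf {x. w \<le> cdf D x}) = w"
proof -
  interpret cdf_distribution D using assms by (simp add: cdf_distribution_def)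
  let ?q = "Inf {x. w \<le> cdf D x}"
  have "w \<le> cdf D ?q" using pseudoinverse[OF assms(3,4), of ?q] by simp
  \<comment> \<open>Left of \<open>?q\<close> the distribution function is at most \<open>w\<close>,
    and without an atom at \<open>?q\<close> it is continuous there, so it cannot jump past
    \<open>w\<close>.\<close>
  moreover have "cdf D ?q \<le> w"
  proof (rule tendsto_upperbound)
    show "(cdf D \<longlongrightarrow> cdf D ?q) (at_left ?q)"
      using isCont_cdf[of ?q] atom by (simp add: isCont_def filterlim_at_split)
    show "eventually (\<lambda>x. cdf D x \<le> w) (at_left ?q)"
      unfolding eventually_at_filter
    proof (rule always_eventually, safe)
      fix x assume "x < ?q"
      then show "cdf D x \<le> w" using pseudoinverse[OF assms(3,4), of x] by auto
    qed
  qed simp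
  ultimately show ?thesis by simp
qed

text \<open>The fibre has at most one point, so its only nonempty subset is itself; if it had
  positive measure, atomlessness would split it.\<close>

lemma atomless_inj_vimage:
  assumes "prob_space M" "atomless M" and f: "f \<in> borel_measurable M" "inj_on f (space M)"
  shows "measure M (f -` {t :: real} \<inter> space M) = 0"
proof (rule ccontr)
  interpret prob_space M by fact
  let ?A = "f -` {t} \<inter> space M"
  assume "measure M ?A \<noteq> 0"
  then have pos: "0 < emeasure M ?A"
    by (simp add: emeasure_eq_measure zero_less_measure_iff)
  have "?A \<in> sets M" using f by measurable
  then obtain B where B: "B \<subseteq> ?A" "0 < emeasure M B" "emeasure M B < emeasure M ?A"
    using assms(2) pos unfolding atomless_def by blast
  then have "B \<noteq> {}" by auto
  then have "B = ?A" using B(1) f(2) by (auto simp: inj_on_def)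
  then show False using B by simp
qed

text \<open>Condition on \<open>A\<close>, push forward along the Borel code and apply the quantile
  transform: \<open>u\<close> is the distribution function of the code and \<open>\<psi>\<close>
  decodes quantiles. On \<open>T\<close> the map \<open>u\<close> undoes \<open>\<psi>\<close>, and
  taking \<open>S = A\<close> shows that \<open>T\<close> has measure 1. The last clause lets the
  points that are recovered from their parameter be cut out measurably.\<close>

lemma standard_borel_uniformization:
  assumes "prob_space M" "standard_borel M" "atomless M" and A: "A \<in> sets M" "measure M A > 0"
  shows "\<exists>(u :: 'a \<Rightarrow> real) \<psi> T.
    u \<in> borel_measurable M \<and> \<psi> \<in> measurable borel M \<and> T \<in> sets borel \<and> T \<subseteq> {0..<1} \<and>
    (\<forall>t\<in>T. \<psi> t \<in> A \<and> u (\<psi> t) = t) \<and>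
    (\<forall>S\<in>sets M. measure unit_leb (T \<inter> \<psi> -` S) = measure M (A \<inter> S) / measure M A) \<and>
    {x \<in> space M. \<psi> (u x) = x} \<in> sets M"
proof -
  interpret prob_space M by fact
  obtain f :: "'a \<Rightarrow> real" and g where f [measurable]: "f \<in> borel_measurable M"
    and g [measurable]: "g \<in> measurable borel M" and R [measurable]: "f ` space M \<in> sets borel"
    and gf: "\<And>x. x \<in> space M \<Longrightarrow> g (f x) = x"
    using standard_borel_embedding[OF assms(2)] not_empty by metis
  note [measurable] = A(1)
  have inj: "inj_on f (space M)" using gf by (rule inj_on_inverseI)
  define N where "N = uniform_measure M A"
  have [measurable_cong]: "sets N = sets M" by (simp add: N_def)
  have mN: "measure N S = measure M (A \<inter> S) / measure M A" if "S \<in> sets M" for S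
    unfolding N_def using that A by (intro measure_uniform_measure) (auto simp: emeasure_eq_measure)
  have pN: "prob_space N"
    unfolding N_def using A by (intro prob_space_uniform_measure) (auto simp: emeasure_eq_measure)
  define D where "D = distr N borel f"
  have rD: "real_distribution D"
    unfolding D_def using prob_space.prob_space_distr[OF pN, of f borel]
    by (simp add: real_distribution_def real_distribution_axioms_def)
  have mD: "measure D Y = measure M (A \<inter> (f -` Y \<inter> space M)) / measure M A" if "Y \<in> sets borel" for Y
  proof -
    have "measure D Y = measure N (f -` Y \<inter> space N)"
      unfolding D_def using that by (intro measure_distr) auto
    also have "space N = space M" by (simp add: N_def)
    also have "measure N (f -` Y \<inter> space M) = measure M (A \<inter> (f -` Y \<inter> space M)) / measure M A"
      by (rule mN) (use that in measurable)
    finally show ?thesis .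
  qed
  have "measure D {t} = 0" for t
  proof -
    have "measure M (A \<inter> (f -` {t} \<inter> space M)) \<le> measure M (f -` {t} \<inter> space M)"
      by (intro finite_measure_mono) auto
    also have "\<dots> = 0" using atomless_inj_vimage[OF assms(1,3) f inj] .
    finally show ?thesis by (simp add: mD measure_le_0_iff)
  qed
  note cdfq = cdf_quantile[OF rD this]
  interpret D: cdf_distribution D using rD by (simp add: cdf_distribution_def)
  \<comment> \<open>Quantiles are meaningful on the open interval only; the value 0 elsewhere is a
    default, which \<open>T\<close> avoids.\<close>
  define G where "G t = (if t \<in> {0<..<1} then Inf {x. t \<le> cdf D x} else 0)" for t
  have [measurable]: "G \<in> borel_measurable borel"
    unfolding G_def using D.measurable_CI
    by (subst measurable_If_restrict_space_iff) (simp_all del: greaterThanLessThan_iff)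
  define T where "T = {t \<in> {0<..<1}. G t \<in> f ` space M \<and> g (G t) \<in> A}"
  define u where "u x = cdf D (f x)" for x
  define \<psi> where "\<psi> t = g (G t)" for t
  have u [measurable]: "u \<in> borel_measurable M" unfolding u_def by measurable
  have psi [measurable]: "\<psi> \<in> measurable borel M" unfolding \<psi>_def by measurable
  have T [measurable]: "T \<in> sets borel" unfolding T_def by measurable
  have TA: "\<psi> t \<in> A \<and> u (\<psi> t) = t" if "t \<in> T" for t
  proof -
    have t: "t \<in> {0<..<1}" "G t \<in> f ` space M" "g (G t) \<in> A"
      using that unfolding T_def by blast+
    then obtain x where x: "x \<in> space M" "G t = f x" by blast
    note x = x t(1,3)
    then show ?thesis
      unfolding \<psi>_def u_def using gf cdfq[of t] by (auto simp: G_def)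
  qed
  have mT: "measure unit_leb (T \<inter> \<psi> -` S) = measure M (A \<inter> S) / measure M A" if S [measurable]: "S \<in> sets M" for S
  proof -
    define Y where "Y = f ` space M \<inter> g -` (A \<inter> S)"
    have "g -` (A \<inter> S) \<in> sets borel"
      using measurable_sets[OF g, of "A \<inter> S"] by simp
    then have Y [measurable]: "Y \<in> sets borel" unfolding Y_def by simp
    have "T \<inter> \<psi> -` S = {t \<in> {0<..<1}. Inf {x. t \<le> cdf D x} \<in> Y}"
      unfolding T_def \<psi>_def Y_def G_def by auto
    moreover have "{0..<1} \<inter> {t \<in> {0<..<1}. Inf {x. t \<le> cdf D x} \<in> Y} = {t \<in> {0<..<1::real}. Inf {x. t \<le> cdf D x} \<in> Y}"
      by auto
    moreover have "T \<inter> \<psi> -` S \<in> sets borel" using measurable_sets[OF psi S] by auto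
    ultimately have "measure unit_leb (T \<inter> \<psi> -` S) = measure lborel {t \<in> {0<..<1}. Inf {x. t \<le> cdf D x} \<in> Y}"
      using measure_unit_leb[of "T \<inter> \<psi> -` S"] by simp
    \<comment> \<open>The quantile function carries Lebesgue measure on the open unit interval to
      \<open>D\<close>.\<close>
    also have "\<dots> = measure (distr (restrict_space lborel {0<..<1::real}) borel (\<lambda>t. Inf {x. t \<le> cdf D x})) Y"
      using D.measurable_CI measurable_cong_sets[OF sets_restrict_space_cong[OF sets_lborel] refl]
      by (subst measure_distr) (auto simp: space_restrict_space measure_restrict_space intro!: arg_cong2[where f = measure])
    also have "\<dots> = measure D Y" unfolding D.distr_I_eq_M ..
    also have "\<dots> = measure M (A \<inter> (f -` Y \<inter> space M)) / measure M A" by (rule mD) simp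
    also have "A \<inter> (f -` Y \<inter> space M) = A \<inter> S"
      unfolding Y_def using gf sets.sets_into_space[OF A(1)] by (auto dest!: inj_onD[OF inj])
    finally show ?thesis .
  qed
  \<comment> \<open>Equality of points is tested after the injection into the reals, where equality
    of two Borel functions defines a measurable set.\<close>
  have "{x \<in> space M. \<psi> (u x) = x} = {x \<in> space M. f (\<psi> (u x)) = f x}"
    using inj measurable_space[OF psi] by (auto simp: inj_on_def)
  also have "\<dots> \<in> sets M" by measurable
  finally have diag: "{x \<in> space M. \<psi> (u x) = x} \<in> sets M" .
  show ?thesis
    by (intro exI[of _ u] exI[of _ \<psi>] exI[of _ T] conjI ballI u psi T TA mT diag) (auto simp: T_def)
qed

lemma exists_uniform_variable:
  assumes "prob_space M" "standard_borel M" "atomless M"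
  obtains u :: "'a \<Rightarrow> real" where "u \<in> borel_measurable M"
    "\<And>B. B \<in> sets borel \<Longrightarrow> measure M (u -` B \<inter> space M) = measure unit_leb B"
proof -
  interpret prob_space M by fact
  have pos: "0 < measure M (space M)" by (simp add: prob_space)
  obtain u :: "'a \<Rightarrow> real" and \<psi> T where u [measurable]: "u \<in> borel_measurable M"
    and psi: "\<psi> \<in> measurable borel M" and T [measurable]: "T \<in> sets borel"
    and T': "\<forall>t\<in>T. \<psi> t \<in> space M \<and> u (\<psi> t) = t"
    and mT: "\<forall>S\<in>sets M. measure unit_leb (T \<inter> \<psi> -` S) = measure M (space M \<inter> S) / measure M (space M)"
    using standard_borel_uniformization[OF assms sets.top pos] by blast
  interpret L: prob_space unit_leb by (rule prob_space_unit_leb)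
  have T1: "measure unit_leb T = 1"
  proof -
    have "T \<inter> \<psi> -` space M = T" using T' by blast
    then show ?thesis using mT[rule_format, of "space M"] prob_space by simp
  qed
  have "measure M (u -` B \<inter> space M) = measure unit_leb B" if B [measurable]: "B \<in> sets borel" for B
  proof -
    have "measure M (u -` B \<inter> space M) = measure unit_leb (T \<inter> \<psi> -` (u -` B \<inter> space M))"
      using mT[rule_format, of "u -` B \<inter> space M"] prob_space by (simp add: Int_absorb1)
    also have "T \<inter> \<psi> -` (u -` B \<inter> space M) = T \<inter> B" using T' by fastforce
    also have "measure unit_leb (T \<inter> B) = measure unit_leb B"
      by (rule L.finite_measure_eq_AE) (use L.AE_prob_1[OF T1] in auto)
    finally show ?thesis .
  qed
  then show ?thesis by (rule that[OF u])
qed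

text \<open>Consecutive intervals whose lengths are the prescribed masses are pulled back along a
  uniform variable.\<close>

lemma exists_finite_valued_map:
  fixes p :: "'i \<Rightarrow> real"
  assumes "prob_space M" "standard_borel M" "atomless M"
    and I: "finite I" and p: "\<And>i. i \<in> I \<Longrightarrow> 0 \<le> p i" "sum p I = 1"
  shows "\<exists>\<kappa>. \<kappa> \<in> measurable M (count_space I) \<and> (\<forall>i\<in>I. measure M (\<kappa> -` {i} \<inter> space M) = p i)"
proof -
  obtain u where u [measurable]: "u \<in> borel_measurable M"
    and mu: "\<And>B. B \<in> sets borel \<Longrightarrow> measure M (u -` B \<inter> space M) = measure unit_leb B"
    using exists_uniform_variable[OF assms(1-3)] by blast
  obtain h where h: "bij_betw h {..<card I} I"
    using ex_bij_betw_nat_finite[OF I] atLeast0LessThan by metis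
  define k where "k = card I"
  have "I \<noteq> {}" using p(2) by auto
  then have k: "k > 0" unfolding k_def using I by (simp add: card_gt_0_iff)
  have hI: "h i \<in> I" if "i < k" for i using h that unfolding k_def bij_betw_def by auto
  define s where "s j = (\<Sum>i<j. p (h i))" for j
  have s_le: "s i \<le> s j" if "i \<le> j" "j \<le> k" for i j
    unfolding s_def using that hI p(1) by (intro sum_mono2) auto
  have s0: "s 0 = 0" by (simp add: s_def)
  have sk: "s k = 1"
    unfolding s_def k_def using p(2) sum.reindex_bij_betw[OF h, of p] by simp
  \<comment> \<open>For \<open>t\<close> in [0,1) this is the index of the interval containing
    \<open>t\<close>. The last break point, 1, is left out of the count, so that
    \<open>c t < k\<close> holds for every real \<open>t\<close>.\<close>
  define c where "c t = card {j \<in> {..<k - 1}. s (Suc j) \<le> t}" for t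
  have ck: "c t < k" for t
  proof -
    have "c t \<le> card {..<k - 1}" unfolding c_def by (intro card_mono) auto
    then show ?thesis using k by simp
  qed
  have [measurable]: "c \<in> measurable borel (count_space UNIV)"
    unfolding c_def by measurable
  have cj: "c t = j" if "s j \<le> t" "t < s (Suc j)" "j < k" for t j
  proof -
    have "{i \<in> {..<k - 1}. s (Suc i) \<le> t} = {..<j}"
    proof (intro equalityI subsetI)
      fix i assume i: "i \<in> {i \<in> {..<k - 1}. s (Suc i) \<le> t}"
      then have "\<not> s (Suc j) \<le> s (Suc i)" using that by auto
      then show "i \<in> {..<j}" using s_le[of "Suc j" "Suc i"] i by force
    next
      fix i assume "i \<in> {..<j}"
      then show "i \<in> {i \<in> {..<k - 1}. s (Suc i) \<le> t}"
        using s_le[of "Suc i" j] that by auto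
    qed
    then show ?thesis unfolding c_def by simp
  qed
  have cset: "{0..<1} \<inter> c -` {j} = {s j..<s (Suc j)}" if "j < k" for j
  proof (intro equalityI subsetI)
    fix t assume t: "t \<in> {0..<1} \<inter> c -` {j}"
    then have "\<exists>i<k. (\<forall>l\<le>i. \<not> t < s l) \<and> t < s (Suc i)"
      by (intro ex_least_nat_less) (auto simp: s0 sk)
    then obtain i where i: "i < k" "s i \<le> t" "t < s (Suc i)" by (auto simp: not_less)
    then show "t \<in> {s j..<s (Suc j)}" using cj[of i t] t by auto
  next
    fix t assume t: "t \<in> {s j..<s (Suc j)}"
    then show "t \<in> {0..<1} \<inter> c -` {j}"
      using cj[of j t] that s_le[of 0 j] s_le[of "Suc j" k] s0 sk by auto
  qed
  show ?thesis
  proof (intro exI[of _ "\<lambda>x. h (c (u x))"] conjI ballI)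
    show "(\<lambda>x. h (c (u x))) \<in> measurable M (count_space I)"
    proof -
      have cu: "(\<lambda>x. c (u x)) \<in> measurable M (count_space UNIV)" by measurable
      have "(\<lambda>x. h (c (u x))) \<in> measurable M (count_space UNIV)"
        by (rule measurable_compose[OF cu]) simp
      from measurable_sets[OF this] show ?thesis
        using ck hI by (subst measurable_count_space_eq2[OF I]) auto
    qed
    fix i assume "i \<in> I"
    then obtain j where j: "j < k" "i = h j" using h unfolding k_def bij_betw_def by auto
    have "(h (c (u x)) = i) = (c (u x) = j)" for x
      using bij_betw_imp_inj_on[OF h] ck j unfolding k_def inj_on_def by auto
    then have "(\<lambda>x. h (c (u x))) -` {i} \<inter> space M = u -` (c -` {j}) \<inter> space M" by auto
    also have "measure M \<dots> = measure unit_leb (c -` {j})"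
      by (rule mu) (use measurable_sets[of c borel "count_space UNIV" "{j}"] in simp)
    also have "\<dots> = measure lborel {s j..<s (Suc j)}"
      using measurable_sets[of c borel "count_space UNIV" "{j}"]
      by (simp add: measure_unit_leb cset j)
    also have "\<dots> = p i" using s_le[of j "Suc j"] j by (simp add: s_def)
    finally show "measure M ((\<lambda>x. h (c (u x))) -` {i} \<inter> space M) = p i" .
  qed
qed

section \<open>Bijections that mix inside the parts of a partition\<close>

lemma measure_partition_sum:
  assumes "finite_measure M" "finite_measurable_partition M P" "S \<in> sets M"
  shows "measure M S = (\<Sum>A\<in>P. measure M (A \<inter> S))"
proof -
  interpret finite_measure M by fact
  have P: "finite P" "P \<subseteq> sets M" "disjoint P" "\<Union>P = space M"
    using assms(2) by (auto simp: finite_measurable_partition_def partition_on_def)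
  have "(\<Union>A\<in>P. A \<inter> S) = S" using P(4) sets.sets_into_space[OF assms(3)] by blast
  moreover have "measure M (\<Union>A\<in>P. A \<inter> S) = (\<Sum>A\<in>P. measure M (A \<inter> S))"
    using P assms(3) by (intro finite_measure_finite_Union) (auto simp: disjoint_family_on_def disjoint_def)
  ultimately show ?thesis by simp
qed

text \<open>The grid swap is conjugated by \<open>u\<close> and \<open>\<psi>\<close>. These are
  mutually inverse only almost everywhere, so the swap acts on \<open>D n\<close>, where a point and
  its image are both recovered exactly, and the identity acts on the rest of \<open>A\<close>. Since
  the swap is an involution, \<open>D n\<close> is mapped to itself, and the glued map is an
  involution of \<open>A\<close>.\<close>

lemma mixing_on_part:
  assumes "prob_space M" "standard_borel M" "atomless M" and A: "A \<in> sets M"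
  shows "\<exists>\<pi> :: nat \<Rightarrow> 'a \<Rightarrow> 'a. (\<forall>n. \<pi> n \<in> measurable M M \<and> (\<forall>x\<in>A. \<pi> n x \<in> A \<and> \<pi> n (\<pi> n x) = x) \<and>
      (\<forall>S\<in>sets M. measure M (A \<inter> \<pi> n -` S) = measure M (A \<inter> S))) \<and>
    (\<forall>S\<in>sets M. \<forall>T\<in>sets M. (\<lambda>n. measure M (A \<inter> S \<inter> \<pi> n -` T)) \<longlonglongrightarrow>
      measure M (A \<inter> S) * measure M (A \<inter> T) / measure M A)"
proof (cases "measure M A = 0")
  case True
  interpret prob_space M by fact
  \<comment> \<open>On a null part all the measures vanish, and the limit is 0 / 0 = 0, so the
    identity works.\<close>
  have "measure M (A \<inter> S) = 0" for S
    using True measure_mono_fmeasurable[of "A \<inter> S" A M]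
    by (cases "A \<inter> S \<in> sets M") (auto simp: measure_notin_sets fmeasurable_eq_sets A
        intro!: antisym)
  then show ?thesis
    by (intro exI[of _ "\<lambda>_ x. x"]) (auto simp: Int_assoc)
next
  case False
  interpret prob_space M by fact
  interpret L: prob_space unit_leb by (rule prob_space_unit_leb)
  have pos: "measure M A > 0" using False by (simp add: zero_less_measure_iff)
  obtain u :: "'a \<Rightarrow> real" and \<psi> U where u [measurable]: "u \<in> borel_measurable M"
    and psi [measurable]: "\<psi> \<in> measurable borel M" and U [measurable]: "U \<in> sets borel" and U01: "U \<subseteq> {0..<1}"
    and U': "\<forall>t\<in>U. \<psi> t \<in> A \<and> u (\<psi> t) = t"
    and mU: "\<forall>S\<in>sets M. measure unit_leb (U \<inter> \<psi> -` S) = measure M (A \<inter> S) / measure M A"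
    and diag [measurable]: "{x \<in> space M. \<psi> (u x) = x} \<in> sets M"
    using standard_borel_uniformization[OF assms(1-4) pos] by blast
  note [measurable] = A
  have vpsi [measurable]: "\<psi> -` S \<in> sets borel" if "S \<in> sets M" for S
    using measurable_sets[OF psi that] by simp
  \<comment> \<open>The parameters of the points of \<open>A \<inter> S\<close>; all measures inside
    \<open>A\<close> are computed on the unit interval through these sets.\<close>
  define hat where "hat S = U \<inter> \<psi> -` S" for S
  have hat [measurable]: "hat S \<in> sets borel" if [measurable]: "S \<in> sets M" for S
    unfolding hat_def by measurable
  have vs [measurable]: "grid_swap N -` B \<in> sets borel" if "B \<in> sets borel" for B N
    using measurable_sets_borel[OF measurable_grid_swap that] .
  have mhat: "measure M (A \<inter> S) = measure M A * measure unit_leb (hat S)" if "S \<in> sets M" for S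
    using mU that pos unfolding hat_def by (simp add: field_simps)
  have AM: "A \<subseteq> space M" using sets.sets_into_space[OF A] .
  have "hat (space M) = U" unfolding hat_def using U' AM by blast
  with mhat[of "space M"] have U1: "measure unit_leb U = 1"
    using pos AM by (simp add: Int_absorb2)
  have AEU: "AE t in unit_leb. t \<in> U" by (rule L.AE_prob_1[OF U1])
  \<comment> \<open>Parameters that stay in \<open>U\<close> under the swap. They have full measure,
    and the set is mapped to itself because the swap is an involution on [0,1).\<close>
  define R where "R n = {t \<in> U. grid_swap (Suc n) t \<in> U}" for n
  define D where "D n = {x \<in> A. u x \<in> R n \<and> \<psi> (u x) = x}" for n
  define \<pi> where "\<pi> n x = (if x \<in> D n then \<psi> (grid_swap (Suc n) (u x)) else x)" for n x
  have R [measurable]: "R n \<in> sets borel" for n unfolding R_def by measurable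
  have "D n = {x \<in> space M. x \<in> A \<and> u x \<in> R n} \<inter> {x \<in> space M. \<psi> (u x) = x}" for n
    unfolding D_def using AM by blast
  then have D [measurable]: "D n \<in> sets M" for n by simp
  have pi_meas [measurable]: "\<pi> n \<in> measurable M M" for n
    unfolding \<pi>_def by measurable
  have swap: "grid_swap (Suc n) t \<in> R n" "grid_swap (Suc n) (grid_swap (Suc n) t) = t" if "t \<in> R n" for t n
    using that U01 grid_swap_in(2)[of "Suc n" t] unfolding R_def by auto
  have psiD: "\<psi> t \<in> D n \<and> \<pi> n (\<psi> t) = \<psi> (grid_swap (Suc n) t)" if "t \<in> R n" for t n
    using that U' unfolding D_def \<pi>_def R_def by auto
  have inD: "\<pi> n x \<in> D n \<and> \<pi> n (\<pi> n x) = x" if "x \<in> D n" for n x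
  proof -
    have t: "u x \<in> R n" "\<psi> (u x) = x" using that unfolding D_def by auto
    have "\<pi> n x = \<psi> (grid_swap (Suc n) (u x))" using psiD[OF t(1)] t(2) by simp
    then show ?thesis using psiD[OF swap(1)[OF t(1)]] swap(2)[OF t(1)] t(2) by simp
  qed
  have invol: "\<pi> n x \<in> A \<and> \<pi> n (\<pi> n x) = x" if "x \<in> A" for n x
  proof (cases "x \<in> D n")
    case True
    then show ?thesis using inD[of x n] unfolding D_def by blast
  next
    case False
    then show ?thesis using that by (simp add: \<pi>_def)
  qed
  have AER: "AE t in unit_leb. t \<in> R n" for n
  proof -
    have "measure unit_leb (grid_swap (Suc n) -` U) = 1"
      using measure_grid_swap_vimage[of "Suc n" U] U1 by simp
    from L.AE_prob_1[OF this] AEU show ?thesis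
      by eventually_elim (auto simp: R_def)
  qed
  \<comment> \<open>Almost every parameter lies in \<open>R n\<close>, and there
    \<open>\<pi> n\<close> is the swap read in the parameter.\<close>
  have main: "measure M (A \<inter> S \<inter> \<pi> n -` T) = measure M A * measure unit_leb (hat S \<inter> grid_swap (Suc n) -` hat T)"
    if [measurable]: "S \<in> sets M" "T \<in> sets M" for S T n
  proof -
    have [measurable]: "\<pi> n -` T \<inter> space M \<in> sets M" using measurable_sets[OF pi_meas] by simp
    have "A \<inter> S \<inter> \<pi> n -` T = A \<inter> (S \<inter> (\<pi> n -` T \<inter> space M))" using AM by blast
    then have "measure M (A \<inter> S \<inter> \<pi> n -` T) = measure M A * measure unit_leb (hat (S \<inter> (\<pi> n -` T \<inter> space M)))"
      using mhat[of "S \<inter> (\<pi> n -` T \<inter> space M)"] by simp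
    also have "measure unit_leb (hat (S \<inter> (\<pi> n -` T \<inter> space M))) = measure unit_leb (hat S \<inter> grid_swap (Suc n) -` hat T)"
    proof (rule L.finite_measure_eq_AE)
      show "AE t in unit_leb. t \<in> hat (S \<inter> (\<pi> n -` T \<inter> space M)) \<longleftrightarrow> t \<in> hat S \<inter> grid_swap (Suc n) -` hat T"
        using AER[of n]
      proof eventually_elim
        case (elim t)
        then have "t \<in> U" "grid_swap (Suc n) t \<in> U" unfolding R_def by auto
        moreover have "\<psi> t \<in> space M" using \<open>t \<in> U\<close> U' AM by blast
        ultimately show ?case
          using psiD[OF elim] unfolding hat_def by simp
      qed
    qed simp_all
    finally show ?thesis .
  qed
  have pres: "measure M (A \<inter> \<pi> n -` S) = measure M (A \<inter> S)" if [measurable]: "S \<in> sets M" for S n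
  proof -
    have "measure M (A \<inter> \<pi> n -` S) = measure M (A \<inter> space M \<inter> \<pi> n -` S)" using AM by (simp add: Int_absorb2)
    also have "\<dots> = measure M A * measure unit_leb (U \<inter> grid_swap (Suc n) -` hat S)"
      using main[of "space M" S n] \<open>hat (space M) = U\<close> by simp
    also have "measure unit_leb (U \<inter> grid_swap (Suc n) -` hat S) = measure unit_leb (grid_swap (Suc n) -` hat S)"
      by (rule L.finite_measure_eq_AE) (use AEU in auto)
    also have "\<dots> = measure unit_leb (hat S)" by (rule measure_grid_swap_vimage) auto
    finally show ?thesis using mhat[of S] by simp
  qed
  have mix: "(\<lambda>n. measure M (A \<inter> S \<inter> \<pi> n -` T)) \<longlonglongrightarrow> measure M (A \<inter> S) * measure M (A \<inter> T) / measure M A"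
    if S: "S \<in> sets M" and T: "T \<in> sets M" for S T
  proof -
    have "(\<lambda>n. measure M A * measure unit_leb (hat S \<inter> grid_swap (Suc n) -` hat T)) \<longlonglongrightarrow>
        measure M A * (measure unit_leb (hat S) * measure unit_leb (hat T))"
      by (intro tendsto_mult_left grid_swap_mixing hat S T)
    moreover have "measure M A * (measure unit_leb (hat S) * measure unit_leb (hat T)) =
        measure M (A \<inter> S) * measure M (A \<inter> T) / measure M A"
      unfolding mhat[OF S] mhat[OF T] using pos by simp
    ultimately show ?thesis unfolding main[OF S T] by simp
  qed
  show ?thesis
    by (intro exI[of _ \<pi>] conjI allI ballI pi_meas pres mix) (use invol in blast)+
qed

text \<open>The limit expresses conditional independence given the part: no mass leaves a part, and
  inside it a point and its image become independent. The map is glued from the involutions of the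
  parts and is therefore its own inverse.\<close>

lemma exists_mixing_bijections:
  assumes "prob_space M" "standard_borel M" "atomless M" and fmp: "finite_measurable_partition M P"
  shows "\<exists>\<pi> :: nat \<Rightarrow> 'a \<Rightarrow> 'a. (\<forall>n. measure_preserving_bij M (\<pi> n)) \<and>
    (\<forall>S\<in>sets M. \<forall>T\<in>sets M. (\<lambda>n. measure M (S \<inter> \<pi> n -` T)) \<longlonglongrightarrow>
      (\<Sum>A\<in>P. measure M (A \<inter> S) * measure M (A \<inter> T) / measure M A))"
proof -
  interpret prob_space M by fact
  have P: "finite P" "P \<subseteq> sets M" "disjoint P" "\<Union>P = space M"
    using fmp by (auto simp: finite_measurable_partition_def partition_on_def)
  have "\<forall>A\<in>P. \<exists>\<pi> :: nat \<Rightarrow> 'a \<Rightarrow> 'a. (\<forall>n. \<pi> n \<in> measurable M M \<and> (\<forall>x\<in>A. \<pi> n x \<in> A \<and> \<pi> n (\<pi> n x) = x) \<and>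
      (\<forall>S\<in>sets M. measure M (A \<inter> \<pi> n -` S) = measure M (A \<inter> S))) \<and>
    (\<forall>S\<in>sets M. \<forall>T\<in>sets M. (\<lambda>n. measure M (A \<inter> S \<inter> \<pi> n -` T)) \<longlonglongrightarrow>
      measure M (A \<inter> S) * measure M (A \<inter> T) / measure M A)"
    using mixing_on_part[OF assms(1-3)] P(2) by blast
  from bchoice[OF this] obtain \<rho> :: "'a set \<Rightarrow> nat \<Rightarrow> 'a \<Rightarrow> 'a" where
    rho: "\<forall>A\<in>P. (\<forall>n. \<rho> A n \<in> measurable M M \<and> (\<forall>x\<in>A. \<rho> A n x \<in> A \<and> \<rho> A n (\<rho> A n x) = x) \<and>
      (\<forall>S\<in>sets M. measure M (A \<inter> \<rho> A n -` S) = measure M (A \<inter> S))) \<and>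
    (\<forall>S\<in>sets M. \<forall>T\<in>sets M. (\<lambda>n. measure M (A \<inter> S \<inter> \<rho> A n -` T)) \<longlonglongrightarrow>
      measure M (A \<inter> S) * measure M (A \<inter> T) / measure M A)" by blast
  define c where "c x = (THE A. A \<in> P \<and> x \<in> A)" for x
  have c: "c x = A" if "A \<in> P" "x \<in> A" for x A
    unfolding c_def
  proof (rule the_equality)
    fix B assume "B \<in> P \<and> x \<in> B"
    then show "B = A" using disjointD[OF P(3), of A B] that by blast
  qed (use that in blast)
  define \<pi> where "\<pi> n x = \<rho> (c x) n x" for n x
  have pi_eq: "\<pi> n x = \<rho> A n x" if "A \<in> P" "x \<in> A" for A n x
    unfolding \<pi>_def using c[OF that] by simp
  have piA: "\<pi> n x \<in> A \<and> \<pi> n (\<pi> n x) = x" if "A \<in> P" "x \<in> A" for A n x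
  proof -
    have "\<rho> A n x \<in> A" "\<rho> A n (\<rho> A n x) = x" using rho that by blast+
    then show ?thesis using pi_eq[OF that(1)] that by simp
  qed
  have sub: "A \<inter> (S \<inter> \<pi> n -` T) = A \<inter> S \<inter> \<rho> A n -` T" if "A \<in> P" for A S T n
    using pi_eq[OF that] by auto
  have bij: "bij_betw (\<pi> n) (space M) (space M)" for n
    by (rule bij_betw_byWitness[where f' = "\<pi> n"]) (use piA P(4) in blast)+
  have vim: "\<rho> A n -` S \<inter> space M \<in> sets M" if "A \<in> P" "S \<in> sets M" for A S n
    using rho that by (intro measurable_sets[of _ M M]) auto
  have meas [measurable]: "\<pi> n \<in> measurable M M" for n
  proof (rule measurableI)
    show "\<pi> n x \<in> space M" if "x \<in> space M" for x using bij_betwE[OF bij] that by blast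
    fix S assume S: "S \<in> sets M"
    have "\<pi> n -` S \<inter> space M = (\<Union>A\<in>P. A \<inter> (\<rho> A n -` S \<inter> space M))"
    proof (intro equalityI subsetI)
      fix x assume x: "x \<in> \<pi> n -` S \<inter> space M"
      then obtain A where "A \<in> P" "x \<in> A" using P(4) by blast
      then show "x \<in> (\<Union>A\<in>P. A \<inter> (\<rho> A n -` S \<inter> space M))" using pi_eq[of A x n] x by auto
    next
      fix x assume "x \<in> (\<Union>A\<in>P. A \<inter> (\<rho> A n -` S \<inter> space M))"
      then obtain A where "A \<in> P" "x \<in> A" "\<rho> A n x \<in> S" "x \<in> space M" by blast
      then show "x \<in> \<pi> n -` S \<inter> space M" using pi_eq[of A x n] by simp
    qed
    also have "\<dots> \<in> sets M" by (intro sets.finite_UN sets.Int[OF _ vim]) (use P S in auto)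
    finally show "\<pi> n -` S \<inter> space M \<in> sets M" .
  qed
  have SP: "S \<inter> \<pi> n -` T \<in> sets M" if "S \<in> sets M" "T \<in> sets M" for S T n
  proof -
    have "S \<inter> \<pi> n -` T = S \<inter> (\<pi> n -` T \<inter> space M)" using sets.sets_into_space[OF that(1)] by blast
    then show ?thesis using measurable_sets[OF meas that(2)] that by simp
  qed
  have split: "measure M (S \<inter> \<pi> n -` T) = (\<Sum>A\<in>P. measure M (A \<inter> S \<inter> \<rho> A n -` T))"
    if "S \<in> sets M" "T \<in> sets M" for S T n
    unfolding measure_partition_sum[OF finite_measure_axioms fmp SP[OF that]]
    by (intro sum.cong refl) (simp only: sub)
  have "distr M M (\<pi> n) = M" for n
  proof (rule measure_eqI)
    fix S assume "S \<in> sets (distr M M (\<pi> n))"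
    then have S: "S \<in> sets M" by simp
    have "measure M (\<pi> n -` S \<inter> space M) = measure M (space M \<inter> \<pi> n -` S)" by (simp add: Int_commute)
    also have "\<dots> = (\<Sum>A\<in>P. measure M (A \<inter> \<rho> A n -` S))"
      using P(4) unfolding split[OF sets.top S] by (intro sum.cong refl arg_cong[where f = "measure M"]) blast
    also have "\<dots> = (\<Sum>A\<in>P. measure M (A \<inter> S))" using rho S by (intro sum.cong) auto
    also have "\<dots> = measure M S" by (rule measure_partition_sum[OF finite_measure_axioms fmp S, symmetric])
    finally show "emeasure (distr M M (\<pi> n)) S = emeasure M S"
      using S by (simp add: emeasure_distr emeasure_eq_measure)
  qed simp
  then have mp: "measure_preserving_bij M (\<pi> n)" for n
    using bij meas by (simp add: measure_preserving_bij_def)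
  have "(\<lambda>n. measure M (S \<inter> \<pi> n -` T)) \<longlonglongrightarrow> (\<Sum>A\<in>P. measure M (A \<inter> S) * measure M (A \<inter> T) / measure M A)"
    if "S \<in> sets M" "T \<in> sets M" for S T
    unfolding split[OF that] using rho that by (intro tendsto_sum) auto
  then show ?thesis using mp by blast
qed

section \<open>Densities and the \<open>L\<^sup>1\<close> distance\<close>

lemma graph_edgeE:
  assumes "finite_simple_graph V E" "e \<in> E"
  obtains u v where "u \<in> V" "v \<in> V" "u \<noteq> v" "e = {u, v}"
  using assms unfolding finite_simple_graph_def card_2_iff by (metis insert_subset)

lemma finite_edges: "finite_simple_graph V E \<Longrightarrow> finite E"
  unfolding finite_simple_graph_def by (meson PowI finite_Pow_iff finite_subset subsetI)

lemma edge_val_cong: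
  assumes "\<And>v. v \<in> e \<Longrightarrow> x v = y v"
  shows "edge_val W x e = edge_val W y e"
proof -
  have "(\<exists>u v. e = {u, v} \<and> r = W (x u) (x v)) \<longleftrightarrow> (\<exists>u v. e = {u, v} \<and> r = W (y u) (y v))" for r
    using assms by (metis insertCI)
  then show ?thesis unfolding edge_val_def by simp
qed

lemma edge_val_map: "edge_val (\<lambda>s t. a (k s) (k t)) x e = edge_val a (\<lambda>v. k (x v)) e"
  unfolding edge_val_def ..

lemma graphon_edge_val:
  assumes "graphon M W" "x u \<in> space M" "x v \<in> space M"
  shows "edge_val W x {u, v} = W (x u) (x v)"
  using assms by (intro edge_val_eq) (auto simp: graphon_def)

lemma edge_val_bounds:
  assumes "finite_simple_graph V E" "e \<in> E" "graphon M W" "x \<in> space (PiM V (\<lambda>_. M))"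
  shows "0 \<le> edge_val W x e" "edge_val W x e \<le> 1"
proof -
  obtain u v where "u \<in> V" "v \<in> V" "u \<noteq> v" "e = {u, v}" using graph_edgeE[OF assms(1,2)] .
  moreover from this have "x u \<in> space M" "x v \<in> space M" using assms(4) by (auto simp: space_PiM)
  ultimately show "0 \<le> edge_val W x e" "edge_val W x e \<le> 1"
    using assms(3) graphon_edge_val[of M W x u v] by (auto simp: graphon_def)
qed

lemma graphon_measurable2:
  assumes "graphon M W" "f \<in> measurable N M" "g \<in> measurable N M"
  shows "(\<lambda>z. W (f z) (g z)) \<in> borel_measurable N"
proof -
  have "(\<lambda>z. (f z, g z)) \<in> measurable N (M \<Otimes>\<^sub>M M)" using assms by measurable
  then show ?thesis using measurable_compose assms(1) by (fastforce simp: graphon_def)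
qed

lemma measurable_edge_val:
  assumes "finite_simple_graph V E" "e \<in> E" "graphon M W"
  shows "(\<lambda>x. edge_val W x e) \<in> borel_measurable (PiM V (\<lambda>_. M))"
proof -
  obtain u v where uv: "u \<in> V" "v \<in> V" "u \<noteq> v" "e = {u, v}" using graph_edgeE[OF assms(1,2)] .
  have "(\<lambda>x. W (x u) (x v)) \<in> borel_measurable (PiM V (\<lambda>_. M))"
    by (rule graphon_measurable2[OF assms(3)]) (use uv in measurable)
  also have "(\<lambda>x. W (x u) (x v)) \<in> borel_measurable (PiM V (\<lambda>_. M)) \<longleftrightarrow> ?thesis"
    unfolding uv(4) using uv assms(3)
    by (intro measurable_cong graphon_edge_val[symmetric]) (auto simp: space_PiM)
  finally show ?thesis .
qed

lemma prob_space_PiM_const: "prob_space M \<Longrightarrow> prob_space (PiM V (\<lambda>_. M))"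
  by (intro prob_space_PiM)

lemma hom_density_decorated: "hom_density M V E W = decorated_density M V E (\<lambda>_. W)"
  unfolding hom_density_def decorated_density_def ..

lemma prod_edge_val_bounds:
  assumes "finite_simple_graph V E" "\<And>e. e \<in> E \<Longrightarrow> graphon M (w e)" "x \<in> space (PiM V (\<lambda>_. M))"
  shows "0 \<le> (\<Prod>e\<in>E. edge_val (w e) x e)" "(\<Prod>e\<in>E. edge_val (w e) x e) \<le> 1"
  using edge_val_bounds[OF assms(1) _ assms(2) assms(3)] by (auto intro!: prod_nonneg prod_le_1)

lemma integrable_prod_edge_val:
  assumes "prob_space M" "finite_simple_graph V E" "\<And>e. e \<in> E \<Longrightarrow> graphon M (w e)"
  shows "integrable (PiM V (\<lambda>_. M)) (\<lambda>x. \<Prod>e\<in>E. edge_val (w e) x e)"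
proof -
  interpret prob_space "PiM V (\<lambda>_. M)" using assms(1) by (rule prob_space_PiM_const)
  show ?thesis
    using prod_edge_val_bounds[OF assms(2,3)] measurable_edge_val[OF assms(2) _ assms(3)]
    by (intro integrable_const_bound[where B = 1]) (auto intro!: borel_measurable_prod)
qed

text \<open>An integrand that depends on one edge sees only two coordinates; this marginal turns its
  integral over all vertex positions into one over pairs.\<close>

lemma pair_marginal_PiM:
  assumes "prob_space M" "finite V" "u \<in> V" "v \<in> V" "u \<noteq> v"
  shows "distr (PiM V (\<lambda>_. M)) (M \<Otimes>\<^sub>M M) (\<lambda>x. (x u, x v)) = M \<Otimes>\<^sub>M M"
proof (rule pair_measure_eqI[symmetric])
  interpret prob_space M by fact
  show "sigma_finite_measure M" by (rule sigma_finite_measure_axioms)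
  show "sigma_finite_measure M" by (rule sigma_finite_measure_axioms)
  interpret finite_product_prob_space "\<lambda>_. M" V by standard fact
  have m: "(\<lambda>x. (x u, x v)) \<in> measurable (PiM V (\<lambda>_. M)) (M \<Otimes>\<^sub>M M)"
    using assms by measurable
  fix A B assume AB: "A \<in> sets M" "B \<in> sets M"
  let ?X = "\<lambda>w. if w = u then A else if w = v then B else space M"
  have "(\<lambda>x. (x u, x v)) -` (A \<times> B) \<inter> space (PiM V (\<lambda>_. M)) = PiE V ?X"
    using assms sets.sets_into_space AB by (auto simp: space_PiM PiE_iff split: if_splits) blast+
  then have "emeasure (distr (PiM V (\<lambda>_. M)) (M \<Otimes>\<^sub>M M) (\<lambda>x. (x u, x v))) (A \<times> B) = emeasure (PiM V (\<lambda>_. M)) (PiE V ?X)"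
    using AB by (simp add: emeasure_distr[OF m])
  also have "\<dots> = (\<Prod>w\<in>V. emeasure M (?X w))" using AB by (intro measure_times) auto
  also have "\<dots> = emeasure M (?X u) * (emeasure M (?X v) * (\<Prod>w\<in>V - {u} - {v}. emeasure M (?X w)))"
    using assms by (subst prod.remove[of V u], simp, simp, subst prod.remove[of "V - {u}" v]) auto
  also have "(\<Prod>w\<in>V - {u} - {v}. emeasure M (?X w)) = 1"
    by (intro prod.neutral) (auto simp: prob_space.emeasure_space_1[OF assms(1)])
  finally show "emeasure M A * emeasure M B = emeasure (distr (PiM V (\<lambda>_. M)) (M \<Otimes>\<^sub>M M) (\<lambda>x. (x u, x v))) (A \<times> B)"
    using assms by simp
qed simp

definition graphon_dist :: "'a measure \<Rightarrow> ('a \<Rightarrow> 'a \<Rightarrow> real) \<Rightarrow> ('a \<Rightarrow> 'a \<Rightarrow> real) \<Rightarrow> real" where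
  "graphon_dist M U W = (LINT z|(M \<Otimes>\<^sub>M M). \<bar>U (fst z) (snd z) - W (fst z) (snd z)\<bar>)"

lemma prob_space_pair_self: "prob_space M \<Longrightarrow> prob_space (M \<Otimes>\<^sub>M M)"
  by (rule prob_space_pair)

lemma graphon_measurable_pair:
  assumes "graphon M W" shows "(\<lambda>z. W (fst z) (snd z)) \<in> borel_measurable (M \<Otimes>\<^sub>M M)"
  by (rule graphon_measurable2[OF assms]) measurable

lemma graphon_pair_bounds:
  assumes "graphon M W" "z \<in> space (M \<Otimes>\<^sub>M M)"
  shows "0 \<le> W (fst z) (snd z)" "W (fst z) (snd z) \<le> 1"
  using assms by (auto simp: graphon_def space_pair_measure)

lemma integrable_graphon:
  assumes "prob_space M" "graphon M W"
  shows "integrable (M \<Otimes>\<^sub>M M) (\<lambda>z. W (fst z) (snd z))"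
proof -
  interpret prob_space "M \<Otimes>\<^sub>M M" using assms(1) by (rule prob_space_pair_self)
  show ?thesis
    using graphon_pair_bounds[OF assms(2)] graphon_measurable_pair[OF assms(2)]
    by (intro integrable_const_bound[where B = 1]) auto
qed

text \<open>For factors in [0,1] the difference of two products is at most the sum of the
  differences of the factors. Each summand involves a single edge, so its integral is an
  \<open>L\<^sup>1\<close> distance by the pair marginal.\<close>

lemma decorated_density_diff:
  assumes M: "prob_space M" and G: "finite_simple_graph V E"
    and w: "\<And>e. e \<in> E \<Longrightarrow> graphon M (w e)" and w': "\<And>e. e \<in> E \<Longrightarrow> graphon M (w' e)"
  shows "\<bar>decorated_density M V E w - decorated_density M V E w'\<bar> \<le> (\<Sum>e\<in>E. graphon_dist M (w e) (w' e))"
proof -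
  let ?N = "PiM V (\<lambda>_. M)"
  interpret prob_space ?N using M by (rule prob_space_PiM_const)
  have dist: "integrable ?N (\<lambda>x. \<bar>edge_val (w e) x e - edge_val (w' e) x e\<bar>) \<and>
      (LINT x|?N. \<bar>edge_val (w e) x e - edge_val (w' e) x e\<bar>) = graphon_dist M (w e) (w' e)" if e: "e \<in> E" for e
  proof -
    obtain u v where uv: "u \<in> V" "v \<in> V" "u \<noteq> v" "e = {u, v}" using graph_edgeE[OF G e] .
    have m: "(\<lambda>x. (x u, x v)) \<in> measurable ?N (M \<Otimes>\<^sub>M M)" using uv by measurable
    have ev: "edge_val W x e = W (x u) (x v)" if "graphon M W" "x \<in> space ?N" for W x
      using that uv by (auto simp: space_PiM intro!: graphon_edge_val)
    have "finite V" using G by (simp add: finite_simple_graph_def)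
    then have "graphon_dist M (w e) (w' e) =
      (LINT z|(distr ?N (M \<Otimes>\<^sub>M M) (\<lambda>x. (x u, x v))). \<bar>w e (fst z) (snd z) - w' e (fst z) (snd z)\<bar>)"
      unfolding graphon_dist_def using pair_marginal_PiM[OF M _ uv(1-3)] by simp
    also have "\<dots> = (LINT x|?N. \<bar>w e (x u) (x v) - w' e (x u) (x v)\<bar>)"
      using graphon_measurable_pair[OF w[OF e]] graphon_measurable_pair[OF w'[OF e]]
      by (subst integral_distr[OF m]) auto
    also have "\<dots> = (LINT x|?N. \<bar>edge_val (w e) x e - edge_val (w' e) x e\<bar>)"
      by (intro Bochner_Integration.integral_cong refl) (simp add: ev w[OF e] w'[OF e])
    finally show ?thesis
      using edge_val_bounds[OF G e w[OF e]] edge_val_bounds[OF G e w'[OF e]]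
        measurable_edge_val[OF G e w[OF e]] measurable_edge_val[OF G e w'[OF e]]
      by (auto intro!: integrable_const_bound[where B = 1] AE_I2 simp: abs_le_iff) (smt (verit))+
  qed
  have "\<bar>decorated_density M V E w - decorated_density M V E w'\<bar> =
      \<bar>LINT x|?N. (\<Prod>e\<in>E. edge_val (w e) x e) - (\<Prod>e\<in>E. edge_val (w' e) x e)\<bar>"
    unfolding decorated_density_def using integrable_prod_edge_val[OF M G] w w'
    by (subst Bochner_Integration.integral_diff) auto
  also have "\<dots> \<le> (LINT x|?N. \<bar>(\<Prod>e\<in>E. edge_val (w e) x e) - (\<Prod>e\<in>E. edge_val (w' e) x e)\<bar>)"
    by (rule integral_abs_bound)
  also have "\<dots> \<le> (LINT x|?N. (\<Sum>e\<in>E. \<bar>edge_val (w e) x e - edge_val (w' e) x e\<bar>))"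
  proof (rule integral_mono)
    fix x assume x: "x \<in> space ?N"
    show "\<bar>(\<Prod>e\<in>E. edge_val (w e) x e) - (\<Prod>e\<in>E. edge_val (w' e) x e)\<bar> \<le> (\<Sum>e\<in>E. \<bar>edge_val (w e) x e - edge_val (w' e) x e\<bar>)"
      using norm_prod_diff[of E "\<lambda>e. edge_val (w e) x e" "\<lambda>e. edge_val (w' e) x e"]
        edge_val_bounds[OF G _ w x] edge_val_bounds[OF G _ w' x] by simp
  qed (use dist integrable_prod_edge_val[OF M G] w w' in \<open>auto intro!: Bochner_Integration.integrable_sum\<close>)
  also have "\<dots> = (\<Sum>e\<in>E. graphon_dist M (w e) (w' e))"
    using dist by (subst Bochner_Integration.integral_sum) auto
  finally show ?thesis .
qed

lemma hom_density_diff: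
  assumes "prob_space M" "finite_simple_graph V E" "graphon M W" "graphon M W'"
  shows "\<bar>hom_density M V E W - hom_density M V E W'\<bar> \<le> card E * graphon_dist M W W'"
  using decorated_density_diff[of M V E "\<lambda>_. W" "\<lambda>_. W'"] assms by (simp add: hom_density_decorated)

section \<open>Rectangle integrals and steppings\<close>

lemma finite_measurable_partitionD:
  assumes "finite_measurable_partition M P"
  shows "finite P" "P \<subseteq> sets M" "disjoint P" "\<Union>P = space M"
  using assms by (auto simp: finite_measurable_partition_def partition_on_def)

lemma integral_partition_pair:
  assumes "finite_measurable_partition M P" and h: "integrable (M \<Otimes>\<^sub>M M) h"
  shows "(LINT z|(M \<Otimes>\<^sub>M M). h z :: real) = (\<Sum>A\<in>P. \<Sum>B\<in>P. LINT z:A \<times> B|M \<Otimes>\<^sub>M M. h z)"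
proof -
  note P = finite_measurable_partitionD[OF assms(1)]
  have si: "set_integrable (M \<Otimes>\<^sub>M M) (A \<times> B) h" if "A \<in> P" "B \<in> P" for A B
    using h P(2) that unfolding set_integrable_def by (intro integrable_mult_indicator) auto
  have "(LINT z|(M \<Otimes>\<^sub>M M). h z) = (LINT z:space (M \<Otimes>\<^sub>M M)|M \<Otimes>\<^sub>M M. h z)"
    by (rule set_integral_space[OF h, symmetric])
  also have "space (M \<Otimes>\<^sub>M M) = (\<Union>p\<in>P \<times> P. fst p \<times> snd p)"
    unfolding space_pair_measure P(4)[symmetric] by auto
  also have "(LINT z:(\<Union>p\<in>P \<times> P. fst p \<times> snd p)|M \<Otimes>\<^sub>M M. h z) = (\<Sum>p\<in>P \<times> P. LINT z:fst p \<times> snd p|M \<Otimes>\<^sub>M M. h z)"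
  proof (rule set_integral_finite_Union)
    show "disjoint_family_on (\<lambda>p. fst p \<times> snd p) (P \<times> P)"
      using P(3) by (auto simp: disjoint_family_on_def disjoint_def)
  qed (use P si in \<open>auto intro!: pair_measureI\<close>)
  also have "\<dots> = (\<Sum>A\<in>P. \<Sum>B\<in>P. LINT z:A \<times> B|M \<Otimes>\<^sub>M M. h z)"
    by (simp add: sum.cartesian_product case_prod_beta)
  finally show ?thesis .
qed

lemma measure_rect:
  assumes "prob_space M" "A \<in> sets M" "B \<in> sets M"
  shows "measure (M \<Otimes>\<^sub>M M) (A \<times> B) = measure M A * measure M B"
proof -
  interpret prob_space M by fact
  show ?thesis using assms by (simp add: measure_def emeasure_pair_measure_Times enn2real_mult)
qed

lemma rect_integral_bounds:
  assumes "prob_space M" "graphon M W" "A \<in> sets M" "B \<in> sets M"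
  shows "0 \<le> rect_integral M W A B" "rect_integral M W A B \<le> measure M A * measure M B"
proof -
  interpret prob_space "M \<Otimes>\<^sub>M M" using assms(1) by (rule prob_space_pair_self)
  have si: "set_integrable (M \<Otimes>\<^sub>M M) (A \<times> B) (\<lambda>z. W (fst z) (snd z))"
    using integrable_graphon[OF assms(1,2)] assms(3,4) unfolding set_integrable_def
    by (intro integrable_mult_indicator) auto
  have "0 \<le> (\<integral>z. indicat_real (A \<times> B) z * W (fst z) (snd z) \<partial>(M \<Otimes>\<^sub>M M))"
    using graphon_pair_bounds[OF assms(2)] by (intro integral_nonneg_AE) auto
  then show "0 \<le> rect_integral M W A B"
    unfolding rect_integral_def set_lebesgue_integral_def by simp
  have "rect_integral M W A B \<le> (\<integral>z. indicat_real (A \<times> B) z \<partial>(M \<Otimes>\<^sub>M M))"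
    unfolding rect_integral_def set_lebesgue_integral_def
  proof (rule integral_mono)
    show "integrable (M \<Otimes>\<^sub>M M) (\<lambda>z. indicat_real (A \<times> B) z *\<^sub>R W (fst z) (snd z))"
      using si unfolding set_integrable_def .
    show "integrable (M \<Otimes>\<^sub>M M) (indicat_real (A \<times> B))"
      using assms(3,4) by (intro integrable_real_indicator) (auto simp: less_top[symmetric])
  qed (use graphon_pair_bounds[OF assms(2)] in \<open>auto simp: indicator_def\<close>)
  also have "\<dots> = measure (M \<Otimes>\<^sub>M M) (A \<times> B)" using assms(3,4) by simp
  also have "\<dots> = measure M A * measure M B" by (rule measure_rect) fact+
  finally show "rect_integral M W A B \<le> measure M A * measure M B" .
qed

lemma rect_integral_sym:
  assumes "prob_space M" "graphon M W" "A \<in> sets M" "B \<in> sets M"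
  shows "rect_integral M W A B = rect_integral M W B A"
proof -
  interpret prob_space M by fact
  interpret pair_sigma_finite M M ..
  have m: "(\<lambda>(x, y). (y, x)) \<in> measurable (M \<Otimes>\<^sub>M M) (M \<Otimes>\<^sub>M M)" by measurable
  have "rect_integral M W A B = (LINT z|(distr (M \<Otimes>\<^sub>M M) (M \<Otimes>\<^sub>M M) (\<lambda>(x, y). (y, x))). indicator (A \<times> B) z *\<^sub>R W (fst z) (snd z))"
    unfolding rect_integral_def set_lebesgue_integral_def distr_pair_swap[symmetric] ..
  also have "\<dots> = (LINT z|(M \<Otimes>\<^sub>M M). indicator (A \<times> B) (case z of (x, y) \<Rightarrow> (y, x)) *\<^sub>R
       W (fst (case z of (x, y) \<Rightarrow> (y, x))) (snd (case z of (x, y) \<Rightarrow> (y, x))))"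
    using graphon_measurable_pair[OF assms(2)] assms(3,4)
    by (intro integral_distr[OF m] borel_measurable_scaleR borel_measurable_indicator) auto
  also have "\<dots> = rect_integral M W B A"
    unfolding rect_integral_def set_lebesgue_integral_def
    using assms(2) by (intro Bochner_Integration.integral_cong refl)
      (auto simp: graphon_def space_pair_measure indicator_def)
  finally show ?thesis .
qed

lemma graphon_stepping:
  assumes M: "prob_space M" and P: "finite_measurable_partition M P" and W: "graphon M W"
  shows "graphon M (stepping M P W)"
  unfolding graphon_def
proof (intro conjI ballI)
  note P' = finite_measurable_partitionD[OF P]
  have [measurable]: "A \<in> sets M" if "A \<in> P" for A using that P' by blast
  show "(\<lambda>(x, y). stepping M P W x y) \<in> borel_measurable (M \<Otimes>\<^sub>M M)"
    unfolding stepping_def case_prod_beta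
    by (intro borel_measurable_sum borel_measurable_times borel_measurable_const)
      (auto intro!: borel_measurable_indicator' measurable_sets)
  fix x y assume "x \<in> space M" "y \<in> space M"
  then obtain A B where AB: "A \<in> P" "x \<in> A" "B \<in> P" "y \<in> B" using P'(4) by blast
  have s: "A \<in> sets M" "B \<in> sets M" using AB P' by auto
  have *: "stepping M P W x y = rect_integral M W A B / (measure M A * measure M B)"
    "stepping M P W y x = rect_integral M W B A / (measure M B * measure M A)"
    by (rule stepping_eq[OF P]; fact)+
  show "stepping M P W x y = stepping M P W y x"
    unfolding * using rect_integral_sym[OF M W s] by (simp add: mult.commute)
  \<comment> \<open>\<open>p = 0\<close> is the case of a null part, where the average is 0 by
    convention.\<close>
  have q: "0 \<le> r / p \<and> r / p \<le> 1" if "0 \<le> r" "r \<le> p" for r p :: real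
    using that by (cases "p = 0") (auto simp: divide_le_eq_1)
  show "0 \<le> stepping M P W x y" "stepping M P W x y \<le> 1"
    unfolding * using q[OF rect_integral_bounds[OF M W s]] by blast+
qed

section \<open>Approximation by step graphons\<close>

lemma set_integrable_rect:
  assumes "integrable (M \<Otimes>\<^sub>M M) (h :: _ \<Rightarrow> real)" "A \<in> sets M" "B \<in> sets M"
  shows "set_integrable (M \<Otimes>\<^sub>M M) (A \<times> B) h"
  using assms unfolding set_integrable_def by (intro integrable_mult_indicator) auto

lemma set_integral_rect_const:
  assumes "prob_space M" "A \<in> sets M" "B \<in> sets M"
  shows "(LINT z:A \<times> B|M \<Otimes>\<^sub>M M. c) = c * (measure M A * measure M B)"
proof -
  have "A \<times> B \<inter> space (M \<Otimes>\<^sub>M M) = A \<times> B"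
    using assms(2,3) sets.sets_into_space by (auto simp: space_pair_measure)
  then show ?thesis unfolding set_lebesgue_integral_def by (simp add: measure_rect[OF assms])
qed

lemma integrable_graphon_diff:
  assumes "prob_space M" "graphon M U" "graphon M W"
  shows "integrable (M \<Otimes>\<^sub>M M) (\<lambda>z. U (fst z) (snd z) - W (fst z) (snd z))"
  using assms by (intro Bochner_Integration.integrable_diff integrable_graphon)

lemma set_integral_abs_le:
  assumes "set_integrable M A (f :: _ \<Rightarrow> real)"
  shows "\<bar>LINT z:A|M. f z\<bar> \<le> (LINT z:A|M. \<bar>f z\<bar>)"
  using set_integral_norm_bound[OF assms] by simp

text \<open>Averaging over a rectangle is a contraction: the absolute value of an integral is at
  most the integral of the absolute value.\<close>

lemma graphon_dist_stepping:
  assumes M: "prob_space M" and P: "finite_measurable_partition M P" and U: "graphon M U" and W: "graphon M W"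
  shows "graphon_dist M (stepping M P U) (stepping M P W) \<le> graphon_dist M U W"
proof -
  note PD = finite_measurable_partitionD[OF P]
  note int = integrable_abs[OF integrable_graphon_diff[OF M]]
  have "(LINT z:A \<times> B|M \<Otimes>\<^sub>M M. \<bar>stepping M P U (fst z) (snd z) - stepping M P W (fst z) (snd z)\<bar>) \<le>
      (LINT z:A \<times> B|M \<Otimes>\<^sub>M M. \<bar>U (fst z) (snd z) - W (fst z) (snd z)\<bar>)"
    if AB: "A \<in> P" "B \<in> P" for A B
  proof -
    have s: "A \<in> sets M" "B \<in> sets M" using AB PD by auto
    note si = set_integrable_rect[OF _ s]
    let ?m = "measure M A * measure M B"
    have "(LINT z:A \<times> B|M \<Otimes>\<^sub>M M. \<bar>stepping M P U (fst z) (snd z) - stepping M P W (fst z) (snd z)\<bar>) =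
        (LINT z:A \<times> B|M \<Otimes>\<^sub>M M. \<bar>rect_integral M U A B / ?m - rect_integral M W A B / ?m\<bar>)"
      by (rule set_lebesgue_integral_cong) (use s AB in \<open>auto simp: stepping_eq[OF P]\<close>)
    also have "\<dots> = \<bar>rect_integral M U A B / ?m - rect_integral M W A B / ?m\<bar> * ?m"
      by (rule set_integral_rect_const[OF M s])
    \<comment> \<open>On a rectangle of positive measure this is an equality; on a null one the left
      side is 0.\<close>
    also have "\<dots> \<le> \<bar>rect_integral M U A B - rect_integral M W A B\<bar>"
      by (cases "?m = 0") (simp_all add: diff_divide_distrib[symmetric] abs_mult)
    also have "\<dots> = \<bar>LINT z:A \<times> B|M \<Otimes>\<^sub>M M. U (fst z) (snd z) - W (fst z) (snd z)\<bar>"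
      unfolding rect_integral_def
      by (subst set_integral_diff(2)[OF si si]) (use integrable_graphon[OF M] U W in auto)
    also have "\<dots> \<le> (LINT z:A \<times> B|M \<Otimes>\<^sub>M M. \<bar>U (fst z) (snd z) - W (fst z) (snd z)\<bar>)"
      by (rule set_integral_abs_le[OF si[OF integrable_graphon_diff[OF M U W]]])
    finally show ?thesis .
  qed
  then show ?thesis
    unfolding graphon_dist_def
      integral_partition_pair[OF P int[OF graphon_stepping[OF M P U] graphon_stepping[OF M P W]]]
      integral_partition_pair[OF P int[OF U W]]
    by (intro sum_mono)
qed

text \<open>Dependence, in each coordinate, on the atom of the finite algebra generated by
  \<open>F\<close>. Phrasing it through indistinguishable points lets \<open>F\<close> be enlarged
  and families be united without forming common refinements of partitions.\<close>

definition step_function :: "'a measure \<Rightarrow> 'a set set \<Rightarrow> ('a \<times> 'a \<Rightarrow> real) \<Rightarrow> bool" where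
  "step_function M F g \<longleftrightarrow> (\<forall>x\<in>space M. \<forall>x'\<in>space M. \<forall>y\<in>space M. \<forall>y'\<in>space M.
     (\<forall>A\<in>F. x \<in> A \<longleftrightarrow> x' \<in> A) \<longrightarrow> (\<forall>A\<in>F. y \<in> A \<longleftrightarrow> y' \<in> A) \<longrightarrow> g (x, y) = g (x', y'))"

definition step_approximable :: "'a measure \<Rightarrow> ('a \<times> 'a \<Rightarrow> real) \<Rightarrow> bool" where
  "step_approximable M h \<longleftrightarrow> (\<forall>\<epsilon>>0. \<exists>F g. finite F \<and> F \<subseteq> sets M \<and> integrable (M \<Otimes>\<^sub>M M) g \<and>
     step_function M F g \<and> (LINT z|(M \<Otimes>\<^sub>M M). \<bar>h z - g z\<bar>) < \<epsilon>)"

lemma step_functionD: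
  assumes "step_function M F g" "x \<in> space M" "x' \<in> space M" "y \<in> space M" "y' \<in> space M"
    and "\<And>A. A \<in> F \<Longrightarrow> x \<in> A \<longleftrightarrow> x' \<in> A" "\<And>A. A \<in> F \<Longrightarrow> y \<in> A \<longleftrightarrow> y' \<in> A"
  shows "g (x, y) = g (x', y')"
  using assms(1)[unfolded step_function_def, THEN bspec, THEN bspec, THEN bspec, THEN bspec, THEN mp, THEN mp,
      OF assms(2-5)] assms(6,7) by simp

lemma step_function_mono:
  assumes "step_function M F g" "F \<subseteq> F'"
  shows "step_function M F' g"
  unfolding step_function_def
  by (intro ballI impI, rule step_functionD[OF assms(1)]) (use assms(2) in blast)+

lemma integral_abs_triangle:
  assumes "integrable N f" "integrable N g" "integrable N (h :: _ \<Rightarrow> real)"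
  shows "(LINT z|N. \<bar>f z - h z\<bar>) \<le> (LINT z|N. \<bar>f z - g z\<bar>) + (LINT z|N. \<bar>g z - h z\<bar>)"
proof -
  have "(LINT z|N. \<bar>f z - h z\<bar>) \<le> (LINT z|N. \<bar>f z - g z\<bar> + \<bar>g z - h z\<bar>)"
    using assms by (intro integral_mono) auto
  then show ?thesis using assms by simp
qed

lemma step_approximable_limit:
  assumes h: "integrable (M \<Otimes>\<^sub>M M) h"
    and lim: "\<And>\<epsilon>. \<epsilon> > 0 \<Longrightarrow> \<exists>h'. integrable (M \<Otimes>\<^sub>M M) h' \<and> step_approximable M h' \<and> (LINT z|(M \<Otimes>\<^sub>M M). \<bar>h z - h' z\<bar>) < \<epsilon>"
  shows "step_approximable M h"
  unfolding step_approximable_def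
proof (intro allI impI)
  fix \<epsilon> :: real assume \<epsilon>: "\<epsilon> > 0"
  obtain h' where h': "integrable (M \<Otimes>\<^sub>M M) h'" "step_approximable M h'" "(LINT z|(M \<Otimes>\<^sub>M M). \<bar>h z - h' z\<bar>) < \<epsilon> / 2"
    using lim[of "\<epsilon> / 2"] \<epsilon> by auto
  obtain F g where g: "finite F" "F \<subseteq> sets M" "integrable (M \<Otimes>\<^sub>M M) g" "step_function M F g"
    "(LINT z|(M \<Otimes>\<^sub>M M). \<bar>h' z - g z\<bar>) < \<epsilon> / 2"
    using h'(2) \<epsilon> unfolding step_approximable_def by (meson half_gt_zero)
  have "(LINT z|(M \<Otimes>\<^sub>M M). \<bar>h z - g z\<bar>) < \<epsilon>"
    using integral_abs_triangle[OF h h'(1) g(3)] h'(3) g(5) by linarith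
  then show "\<exists>F g. finite F \<and> F \<subseteq> sets M \<and> integrable (M \<Otimes>\<^sub>M M) g \<and> step_function M F g \<and>
      (LINT z|(M \<Otimes>\<^sub>M M). \<bar>h z - g z\<bar>) < \<epsilon>"
    using g by blast
qed

lemma step_approximable_step:
  assumes "finite F" "F \<subseteq> sets M" "integrable (M \<Otimes>\<^sub>M M) g" "step_function M F g"
  shows "step_approximable M g"
  unfolding step_approximable_def using assms by (intro allI impI exI[of _ F] exI[of _ g]) simp

lemma step_approximable_add:
  assumes f: "integrable (M \<Otimes>\<^sub>M M) f" "step_approximable M f" and h: "integrable (M \<Otimes>\<^sub>M M) h" "step_approximable M h"
  shows "step_approximable M (\<lambda>z. f z + h z)"
  unfolding step_approximable_def
proof (intro allI impI)
  fix \<epsilon> :: real assume \<epsilon>: "\<epsilon> > 0"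
  obtain F1 g1 where g1: "finite F1" "F1 \<subseteq> sets M" "integrable (M \<Otimes>\<^sub>M M) g1" "step_function M F1 g1"
    "(LINT z|(M \<Otimes>\<^sub>M M). \<bar>f z - g1 z\<bar>) < \<epsilon> / 2"
    using f(2) \<epsilon> unfolding step_approximable_def by (meson half_gt_zero)
  obtain F2 g2 where g2: "finite F2" "F2 \<subseteq> sets M" "integrable (M \<Otimes>\<^sub>M M) g2" "step_function M F2 g2"
    "(LINT z|(M \<Otimes>\<^sub>M M). \<bar>h z - g2 z\<bar>) < \<epsilon> / 2"
    using h(2) \<epsilon> unfolding step_approximable_def by (meson half_gt_zero)
  have "step_function M (F1 \<union> F2) (\<lambda>z. g1 z + g2 z)"
    unfolding step_function_def
    by (intro ballI impI arg_cong2[where f = "(+)"]; rule step_functionD[OF g1(4)] step_functionD[OF g2(4)]; blast)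
  moreover have "(LINT z|(M \<Otimes>\<^sub>M M). \<bar>(f z + h z) - (g1 z + g2 z)\<bar>) < \<epsilon>"
  proof -
    have "(LINT z|(M \<Otimes>\<^sub>M M). \<bar>(f z + h z) - (g1 z + g2 z)\<bar>) \<le> (LINT z|(M \<Otimes>\<^sub>M M). \<bar>f z - g1 z\<bar> + \<bar>h z - g2 z\<bar>)"
      using f h g1 g2 by (intro integral_mono) auto
    also have "\<dots> = (LINT z|(M \<Otimes>\<^sub>M M). \<bar>f z - g1 z\<bar>) + (LINT z|(M \<Otimes>\<^sub>M M). \<bar>h z - g2 z\<bar>)"
      using f h g1 g2 by simp
    finally show ?thesis using g1(5) g2(5) by linarith
  qed
  ultimately show "\<exists>F g. finite F \<and> F \<subseteq> sets M \<and> integrable (M \<Otimes>\<^sub>M M) g \<and> step_function M F g \<and>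
      (LINT z|(M \<Otimes>\<^sub>M M). \<bar>f z + h z - g z\<bar>) < \<epsilon>"
    using g1 g2 by (intro exI[of _ "F1 \<union> F2"] exI[of _ "\<lambda>z. g1 z + g2 z"]) auto
qed

lemma step_approximable_scale:
  assumes "integrable (M \<Otimes>\<^sub>M M) h" "step_approximable M h"
  shows "step_approximable M (\<lambda>z. h z * c)"
proof (rule step_approximable_limit)
  fix \<epsilon> :: real assume \<epsilon>: "\<epsilon> > 0"
  then obtain F g where g: "finite F" "F \<subseteq> sets M" "integrable (M \<Otimes>\<^sub>M M) g" "step_function M F g"
    "(LINT z|(M \<Otimes>\<^sub>M M). \<bar>h z - g z\<bar>) < \<epsilon> / (\<bar>c\<bar> + 1)"
    using assms(2)[unfolded step_approximable_def, rule_format, of "\<epsilon> / (\<bar>c\<bar> + 1)"] by auto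
  have sf: "step_function M F (\<lambda>z. g z * c)"
    unfolding step_function_def
    by (intro ballI impI arg_cong[where f = "\<lambda>t. t * c"]) (rule step_functionD[OF g(4)]; blast)
  have i: "integrable (M \<Otimes>\<^sub>M M) (\<lambda>z. g z * c)" by (intro integrable_mult_left g(3))
  have "\<bar>h z * c - g z * c\<bar> = \<bar>h z - g z\<bar> * \<bar>c\<bar>" for z
    by (simp add: left_diff_distrib[symmetric] abs_mult)
  then have "(LINT z|(M \<Otimes>\<^sub>M M). \<bar>h z * c - g z * c\<bar>) = (LINT z|(M \<Otimes>\<^sub>M M). \<bar>h z - g z\<bar>) * \<bar>c\<bar>"
    by (simp only: integral_mult_left_zero)
  also have "\<dots> \<le> (LINT z|(M \<Otimes>\<^sub>M M). \<bar>h z - g z\<bar>) * (\<bar>c\<bar> + 1)"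
    by (intro mult_left_mono) auto
  also have "\<dots> < \<epsilon>" using g(5) by (simp add: pos_less_divide_eq)
  finally show "\<exists>h'. integrable (M \<Otimes>\<^sub>M M) h' \<and> step_approximable M h' \<and> (LINT z|(M \<Otimes>\<^sub>M M). \<bar>h z * c - h' z\<bar>) < \<epsilon>"
    using i step_approximable_step[OF g(1,2) i sf] by blast
qed (intro integrable_mult_left assms(1))

text \<open>The indicator of a rectangle is a step function for its two sides, and Dynkin's theorem
  carries approximability to all measurable sets. A countable disjoint union is reached in
  \<open>L\<^sup>1\<close> by its finite partial unions.\<close>

lemma step_approximable_indicator:
  assumes "prob_space M" "D \<in> sets (M \<Otimes>\<^sub>M M)"
  shows "step_approximable M (indicat_real D)"
proof -
  interpret prob_space "M \<Otimes>\<^sub>M M" using assms(1) by (rule prob_space_pair_self)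
  have ii: "integrable (M \<Otimes>\<^sub>M M) (indicat_real D)" if "D \<in> sets (M \<Otimes>\<^sub>M M)" for D
    using that by (intro integrable_real_indicator) (auto simp: less_top[symmetric])
  let ?G = "{A \<times> B |A B. A \<in> sets M \<and> B \<in> sets M}"
  have gen: "sets (M \<Otimes>\<^sub>M M) = sigma_sets (space M \<times> space M) ?G" by (rule sets_pair_measure)
  have D: "D \<in> sigma_sets (space M \<times> space M) ?G" using assms(2) gen by simp
  have G: "?G \<subseteq> Pow (space M \<times> space M)" by (rule pair_measure_closed)
  show ?thesis
    using Int_stable_pair_measure_generator G D
  proof (induction rule: sigma_sets_induct_disjoint)
    case (basic D)
    then obtain A B where D: "D = A \<times> B" "A \<in> sets M" "B \<in> sets M" by blast
    have "step_function M {A, B} (indicat_real D)"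
      unfolding step_function_def D(1) by (auto simp: indicator_def)
    then show ?case using D ii by (intro step_approximable_step[of "{A, B}"]) auto
  next
    case empty
    then show ?case by (intro step_approximable_step[of "{}"]) (auto simp: step_function_def)
  next
    case (compl D)
    have D: "D \<in> sets (M \<Otimes>\<^sub>M M)" using compl gen by simp
    have "step_approximable M (\<lambda>z. 1 + indicat_real D z * (- 1))"
      using compl ii[OF D] by (intro step_approximable_add step_approximable_scale
          step_approximable_step[of "{}" M "\<lambda>_. 1"]) (auto simp: step_function_def)
    then have *: "step_approximable M (\<lambda>z. 1 - indicat_real D z)" by simp
    \<comment> \<open>The indicator of the complement and 1 minus the indicator of \<open>D\<close>
      can differ only outside the space. They are at distance 0, and the limit lemma absorbs
      this.\<close>
    show ?case
    proof (rule step_approximable_limit)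
      show "integrable (M \<Otimes>\<^sub>M M) (indicat_real (space M \<times> space M - D))"
        using D by (intro ii) (auto simp: space_pair_measure[symmetric])
      fix \<epsilon> :: real assume "\<epsilon> > 0"
      have "(LINT z|(M \<Otimes>\<^sub>M M). \<bar>indicat_real (space M \<times> space M - D) z - (1 - indicat_real D z)\<bar>) = (LINT z|(M \<Otimes>\<^sub>M M). 0)"
        by (intro Bochner_Integration.integral_cong) (auto simp: space_pair_measure indicator_def)
      then show "\<exists>h'. integrable (M \<Otimes>\<^sub>M M) h' \<and> step_approximable M h' \<and>
          (LINT z|(M \<Otimes>\<^sub>M M). \<bar>indicat_real (space M \<times> space M - D) z - h' z\<bar>) < \<epsilon>"
        using * \<open>\<epsilon> > 0\<close> ii[OF D] by (intro exI[of _ "\<lambda>z. 1 - indicat_real D z"]) auto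
    qed
  next
    case (union D)
    have D: "range D \<subseteq> sets (M \<Otimes>\<^sub>M M)" using union gen by simp
    then have U: "(\<Union>i. D i) \<in> sets (M \<Otimes>\<^sub>M M)" by blast
    have fin: "step_approximable M (\<lambda>z. \<Sum>i<n. indicat_real (D i) z) \<and> integrable (M \<Otimes>\<^sub>M M) (\<lambda>z. \<Sum>i<n. indicat_real (D i) z)" for n :: nat
    proof (induction n)
      case 0
      then show ?case using step_approximable_step[of "{}" M "\<lambda>_. 0"] by (auto simp: step_function_def)
    next
      case (Suc n)
      then show ?case using union(3)[of n] ii[of "D n"] D by (auto intro!: step_approximable_add)
    qed
    have lim: "(\<lambda>n. LINT z|(M \<Otimes>\<^sub>M M). \<bar>indicat_real (\<Union>i. D i) z - (\<Sum>i<n. indicat_real (D i) z)\<bar>) \<longlonglongrightarrow> 0"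
    proof -
      have eq: "(\<Sum>i<n. indicat_real (D i) z) = indicat_real (\<Union>i<n. D i) z" for n z
        using union(1) by (subst indicator_UN_disjoint) (auto simp: disjoint_family_on_def)
      have "(LINT z|(M \<Otimes>\<^sub>M M). \<bar>indicat_real (\<Union>i. D i) z - (\<Sum>i<n. indicat_real (D i) z)\<bar>) =
          prob (\<Union>i. D i) - (\<Sum>i<n. prob (D i))" for n
      proof -
        have "(LINT z|(M \<Otimes>\<^sub>M M). \<bar>indicat_real (\<Union>i. D i) z - (\<Sum>i<n. indicat_real (D i) z)\<bar>) =
            (LINT z|(M \<Otimes>\<^sub>M M). indicat_real (\<Union>i. D i) z - (\<Sum>i<n. indicat_real (D i) z))"
          unfolding eq by (intro Bochner_Integration.integral_cong) (auto simp: indicator_def)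
        also have "\<dots> = (LINT z|(M \<Otimes>\<^sub>M M). indicat_real (\<Union>i. D i) z) - (\<Sum>i<n. LINT z|(M \<Otimes>\<^sub>M M). indicat_real (D i) z)"
          using ii U D by (subst Bochner_Integration.integral_diff) (auto intro!: Bochner_Integration.integral_sum)
        finally show ?thesis using U D by (simp add: Int_absorb2 sets.sets_into_space subset_iff)
      qed
      moreover have "(\<lambda>n. prob (\<Union>i. D i) - (\<Sum>i<n. prob (D i))) \<longlonglongrightarrow> prob (\<Union>i. D i) - prob (\<Union>i. D i)"
        using finite_measure_UNION[OF D union(1)] unfolding sums_def by (intro tendsto_diff tendsto_const)
      ultimately show ?thesis by simp
    qed
    show ?case
    proof (rule step_approximable_limit[OF ii[OF U]])
      fix \<epsilon> :: real assume "\<epsilon> > 0"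
      then obtain n where "(LINT z|(M \<Otimes>\<^sub>M M). \<bar>indicat_real (\<Union>i. D i) z - (\<Sum>i<n. indicat_real (D i) z)\<bar>) < \<epsilon>"
        using order_tendstoD(2)[OF lim] by (auto simp: eventually_sequentially)
      then show "\<exists>h'. integrable (M \<Otimes>\<^sub>M M) h' \<and> step_approximable M h' \<and>
          (LINT z|(M \<Otimes>\<^sub>M M). \<bar>indicat_real (\<Union>i. D i) z - h' z\<bar>) < \<epsilon>"
        using fin by blast
    qed
  qed
qed

lemma integrable_step_approximable:
  assumes "prob_space M" "integrable (M \<Otimes>\<^sub>M M) (h :: _ \<Rightarrow> real)"
  shows "step_approximable M h"
  using assms(2)
proof (induction rule: integrable_induct)
  case (base A c)
  then show ?case
    using step_approximable_scale[OF _ step_approximable_indicator[OF assms(1) base(1)], of c]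
    by (simp add: integrable_real_indicator)
next
  case (add f g)
  then show ?case by (intro step_approximable_add)
next
  case (lim f s)
  have "(\<lambda>i. LINT z|(M \<Otimes>\<^sub>M M). \<bar>f z - s i z\<bar>) \<longlonglongrightarrow> (LINT z|(M \<Otimes>\<^sub>M M). 0)"
  \<comment> \<open>The simple functions of the induction rule are bounded by
    \<open>2 * \<bar>f z\<bar>\<close>, so the difference is bounded by three times
    \<open>\<bar>f z\<bar>\<close>.\<close>
  proof (rule integral_dominated_convergence[where w = "\<lambda>z. 3 * \<bar>f z\<bar>"])
    show "AE z in M \<Otimes>\<^sub>M M. (\<lambda>i. \<bar>f z - s i z\<bar>) \<longlonglongrightarrow> 0"
    proof (rule AE_I2)
      fix z assume "z \<in> space (M \<Otimes>\<^sub>M M)"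
      from tendsto_rabs[OF tendsto_diff[OF tendsto_const lim(2)[OF this], of "f z"]]
      show "(\<lambda>i. \<bar>f z - s i z\<bar>) \<longlonglongrightarrow> 0" by simp
    qed
    show "AE z in M \<Otimes>\<^sub>M M. norm \<bar>f z - s i z\<bar> \<le> 3 * \<bar>f z\<bar>" for i
    proof (rule AE_I2)
      fix z assume "z \<in> space (M \<Otimes>\<^sub>M M)"
      from lim(3)[OF this, of i] show "norm \<bar>f z - s i z\<bar> \<le> 3 * \<bar>f z\<bar>" by simp
    qed
  qed (use lim in \<open>auto intro!: borel_measurable_diff borel_measurable_abs dest: borel_measurable_integrable\<close>)
  then have lim0: "(\<lambda>i. LINT z|(M \<Otimes>\<^sub>M M). \<bar>f z - s i z\<bar>) \<longlonglongrightarrow> 0" by simp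
  show ?case
  proof (rule step_approximable_limit[OF lim(4)])
    fix \<epsilon> :: real assume "\<epsilon> > 0"
    then obtain n where "(LINT z|(M \<Otimes>\<^sub>M M). \<bar>f z - s n z\<bar>) < \<epsilon>"
      using order_tendstoD(2)[OF lim0] by (auto simp: eventually_sequentially)
    then show "\<exists>h'. integrable (M \<Otimes>\<^sub>M M) h' \<and> step_approximable M h' \<and> (LINT z|(M \<Otimes>\<^sub>M M). \<bar>f z - h' z\<bar>) < \<epsilon>"
      using lim by blast
  qed
qed

text \<open>The atoms of the algebra generated by \<open>F\<close>. Indexing them by points of the
  space makes every one of them nonempty, as \<open>partition_on\<close> demands.\<close>

definition generated_partition :: "'a measure \<Rightarrow> 'a set set \<Rightarrow> 'a set set" where
  "generated_partition M F = (\<lambda>x. {y \<in> space M. \<forall>A\<in>F. x \<in> A \<longleftrightarrow> y \<in> A}) ` space M"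

lemma finite_measurable_generated_partition:
  assumes "finite F" "F \<subseteq> sets M"
  shows "finite_measurable_partition M (generated_partition M F)"
proof -
  have "generated_partition M F \<subseteq> (\<lambda>G. {y \<in> space M. \<forall>A\<in>F. A \<in> G \<longleftrightarrow> y \<in> A}) ` Pow F"
  proof
    fix C assume "C \<in> generated_partition M F"
    then obtain x where "C = {y \<in> space M. \<forall>A\<in>F. x \<in> A \<longleftrightarrow> y \<in> A}"
      unfolding generated_partition_def by blast
    then have "C = {y \<in> space M. \<forall>A\<in>F. A \<in> {A \<in> F. x \<in> A} \<longleftrightarrow> y \<in> A}" by auto
    then show "C \<in> (\<lambda>G. {y \<in> space M. \<forall>A\<in>F. A \<in> G \<longleftrightarrow> y \<in> A}) ` Pow F" by blast
  qed
  then have "finite (generated_partition M F)" using assms(1) finite_subset by blast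
  moreover have "generated_partition M F \<subseteq> sets M"
  proof
    fix C assume "C \<in> generated_partition M F"
    then obtain x where "C = {y \<in> space M. \<forall>A\<in>F. x \<in> A \<longleftrightarrow> y \<in> A}"
      unfolding generated_partition_def by blast
    also have "\<dots> \<in> sets M"
    proof (rule sets.sets_Collect_finite_All[OF _ assms(1)])
      fix A assume "A \<in> F"
      then have "A \<in> sets M" using assms by blast
      then show "{y \<in> space M. (x \<in> A) = (y \<in> A)} \<in> sets M" by measurable
    qed
    finally show "C \<in> sets M" .
  qed
  moreover have "partition_on (space M) (generated_partition M F)"
    unfolding partition_on_def disjoint_def generated_partition_def by auto
  ultimately show ?thesis by (simp add: finite_measurable_partition_def)
qed

text \<open>On a cell \<open>g\<close> is a constant \<open>c\<close>, and the distance from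
  \<open>W\<close> to its own average is at most the distance from \<open>W\<close> to
  \<open>c\<close> plus that from \<open>c\<close> to the average. The second is bounded by the
  integral of the first, hence the factor 2. So averages do nearly as well as the best step
  function.\<close>

lemma graphon_dist_generated_partition:
  assumes M: "prob_space M" and W: "graphon M W" and F: "finite F" "F \<subseteq> sets M"
    and g: "integrable (M \<Otimes>\<^sub>M M) g" "step_function M F g"
  shows "graphon_dist M W (stepping M (generated_partition M F) W) \<le> 2 * (LINT z|(M \<Otimes>\<^sub>M M). \<bar>W (fst z) (snd z) - g z\<bar>)"
proof -
  let ?Q = "generated_partition M F"
  note Q = finite_measurable_generated_partition[OF F]
  note QD = finite_measurable_partitionD[OF Q]
  note iW = integrable_graphon[OF M W]
  have iWg: "integrable (M \<Otimes>\<^sub>M M) (\<lambda>z. \<bar>W (fst z) (snd z) - g z\<bar>)" using iW g(1) by simp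
  note iWS = integrable_abs[OF integrable_graphon_diff[OF M W graphon_stepping[OF M Q W]]]
  have "(LINT z:A \<times> B|M \<Otimes>\<^sub>M M. \<bar>W (fst z) (snd z) - stepping M ?Q W (fst z) (snd z)\<bar>) \<le>
      2 * (LINT z:A \<times> B|M \<Otimes>\<^sub>M M. \<bar>W (fst z) (snd z) - g z\<bar>)" if AB: "A \<in> ?Q" "B \<in> ?Q" for A B
  proof -
    have s: "A \<in> sets M" "B \<in> sets M" using AB QD by auto
    note si = set_integrable_rect[OF _ s]
    obtain x y where xy: "x \<in> space M" "y \<in> space M" "A = {x' \<in> space M. \<forall>C\<in>F. x \<in> C \<longleftrightarrow> x' \<in> C}"
      "B = {y' \<in> space M. \<forall>C\<in>F. y \<in> C \<longleftrightarrow> y' \<in> C}"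
      using AB unfolding generated_partition_def by blast
    define c where "c = g (x, y)"
    have gc: "g z = c" if "z \<in> A \<times> B" for z
    proof -
      obtain a b where ab: "z = (a, b)" "a \<in> A" "b \<in> B" using \<open>z \<in> A \<times> B\<close> by blast
      then show ?thesis
        using step_functionD[OF g(2), of x a y b] xy unfolding c_def by simp
    qed
    let ?m = "measure M A * measure M B"
    define r where "r = rect_integral M W A B / ?m"
    have ci: "integrable (M \<Otimes>\<^sub>M M) (\<lambda>_. k :: real)" for k
    proof -
      interpret prob_space "M \<Otimes>\<^sub>M M" using M by (rule prob_space_pair_self)
      show ?thesis by simp
    qed
    have "(LINT z:A \<times> B|M \<Otimes>\<^sub>M M. \<bar>W (fst z) (snd z) - stepping M ?Q W (fst z) (snd z)\<bar>) =
        (LINT z:A \<times> B|M \<Otimes>\<^sub>M M. \<bar>W (fst z) (snd z) - r\<bar>)"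
      by (rule set_lebesgue_integral_cong) (use s AB in \<open>auto simp: stepping_eq[OF Q] r_def\<close>)
    also have "\<dots> \<le> (LINT z:A \<times> B|M \<Otimes>\<^sub>M M. \<bar>W (fst z) (snd z) - g z\<bar> + \<bar>c - r\<bar>)"
    proof (rule set_integral_mono)
      show "\<bar>W (fst z) (snd z) - r\<bar> \<le> \<bar>W (fst z) (snd z) - g z\<bar> + \<bar>c - r\<bar>" if "z \<in> A \<times> B" for z
        using gc[OF that] by linarith
    qed (use iW iWg ci in \<open>auto intro!: si\<close>)
    also have "\<dots> = (LINT z:A \<times> B|M \<Otimes>\<^sub>M M. \<bar>W (fst z) (snd z) - g z\<bar>) + \<bar>c - r\<bar> * ?m"
      using si[OF iWg] si[OF ci] by (subst set_integral_add(2)) (auto simp: set_integral_rect_const[OF M s])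
    \<comment> \<open>\<open>(c - r) * ?m\<close> is the integral of \<open>g\<close> minus that of
      \<open>W\<close> over the cell.\<close>
    also have "\<bar>c - r\<bar> * ?m \<le> (LINT z:A \<times> B|M \<Otimes>\<^sub>M M. \<bar>W (fst z) (snd z) - g z\<bar>)"
    proof (cases "?m = 0")
      case True
      have "0 \<le> (LINT z|(M \<Otimes>\<^sub>M M). indicat_real (A \<times> B) z *\<^sub>R \<bar>W (fst z) (snd z) - g z\<bar>)"
        by (intro integral_nonneg_AE) auto
      then show ?thesis unfolding True set_lebesgue_integral_def by simp
    next
      case False
      have "\<bar>c - r\<bar> * ?m = \<bar>(c - r) * ?m\<bar>" by (simp add: abs_mult)
      also have "(c - r) * ?m = c * ?m - rect_integral M W A B"
        using False unfolding r_def by (simp add: left_diff_distrib)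
      also have "\<bar>\<dots>\<bar> = \<bar>rect_integral M W A B - c * ?m\<bar>" by (rule abs_minus_commute)
      also have "c * ?m = (LINT z:A \<times> B|M \<Otimes>\<^sub>M M. g z)"
        unfolding set_integral_rect_const[OF M s, symmetric]
        by (rule set_lebesgue_integral_cong) (use s gc in auto)
      also have "rect_integral M W A B - (LINT z:A \<times> B|M \<Otimes>\<^sub>M M. g z) = (LINT z:A \<times> B|M \<Otimes>\<^sub>M M. W (fst z) (snd z) - g z)"
        unfolding rect_integral_def by (rule set_integral_diff(2)[OF si[OF iW] si[OF g(1)], symmetric])
      also have "\<bar>\<dots>\<bar> \<le> (LINT z:A \<times> B|M \<Otimes>\<^sub>M M. \<bar>W (fst z) (snd z) - g z\<bar>)"
        using iW g(1) by (intro set_integral_abs_le si) simp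
      finally show ?thesis .
    qed
    finally show ?thesis by simp
  qed
  then have "graphon_dist M W (stepping M ?Q W) \<le> (\<Sum>A\<in>?Q. \<Sum>B\<in>?Q. 2 * (LINT z:A \<times> B|M \<Otimes>\<^sub>M M. \<bar>W (fst z) (snd z) - g z\<bar>))"
    unfolding graphon_dist_def integral_partition_pair[OF Q iWS] by (intro sum_mono)
  also have "\<dots> = 2 * (LINT z|(M \<Otimes>\<^sub>M M). \<bar>W (fst z) (snd z) - g z\<bar>)"
    unfolding integral_partition_pair[OF Q iWg] by (simp add: sum_distrib_left)
  finally show ?thesis .
qed

text \<open>The union of the families found for the single edges generates one partition that serves
  the whole decoration.\<close>

lemma stepping_approximation:
  assumes M: "prob_space M" and "finite E" and w: "\<And>e. e \<in> E \<Longrightarrow> graphon M (w e)" and \<epsilon>: "\<epsilon> > 0"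
  shows "\<exists>Q. finite_measurable_partition M Q \<and> (\<forall>e\<in>E. graphon_dist M (w e) (stepping M Q (w e)) < \<epsilon>)"
proof -
  have "\<forall>e\<in>E. \<exists>F g. finite F \<and> F \<subseteq> sets M \<and> integrable (M \<Otimes>\<^sub>M M) g \<and> step_function M F g \<and>
      (LINT z|(M \<Otimes>\<^sub>M M). \<bar>w e (fst z) (snd z) - g z\<bar>) < \<epsilon> / 2"
    using integrable_step_approximable[OF M integrable_graphon[OF M w]] \<epsilon>
    unfolding step_approximable_def by (meson half_gt_zero)
  from bchoice[OF this] obtain F where "\<forall>e\<in>E. \<exists>g. finite (F e) \<and> F e \<subseteq> sets M \<and> integrable (M \<Otimes>\<^sub>M M) g \<and>
      step_function M (F e) g \<and> (LINT z|(M \<Otimes>\<^sub>M M). \<bar>w e (fst z) (snd z) - g z\<bar>) < \<epsilon> / 2"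
    by blast
  from bchoice[OF this] obtain g where Fg: "\<And>e. e \<in> E \<Longrightarrow> finite (F e) \<and> F e \<subseteq> sets M \<and> integrable (M \<Otimes>\<^sub>M M) (g e) \<and>
      step_function M (F e) (g e) \<and> (LINT z|(M \<Otimes>\<^sub>M M). \<bar>w e (fst z) (snd z) - g e z\<bar>) < \<epsilon> / 2"
    by blast
  let ?F = "\<Union>e\<in>E. F e"
  have F: "finite ?F" "?F \<subseteq> sets M" using Fg \<open>finite E\<close> by auto
  have "graphon_dist M (w e) (stepping M (generated_partition M ?F) (w e)) < \<epsilon>" if e: "e \<in> E" for e
  proof -
    have "step_function M ?F (g e)" using Fg[OF e] step_function_mono[of M "F e" "g e" ?F] e by blast
    then show ?thesis
      using graphon_dist_generated_partition[OF M w[OF e] F, of "g e"] Fg[OF e] by simp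
  qed
  then show ?thesis using finite_measurable_generated_partition[OF F] by blast
qed

section \<open>Finite-valued graphons\<close>

text \<open>The decorated homomorphism density of a finite weighted graph with vertex weights
  \<open>p\<close> and one edge-weight matrix for each edge of H. It frees the second half of the
  proof from the ground space: tensor powers are formed on the index set \<open>I\<close> instead of
  on \<open>\<Omega>\<close>.\<close>

definition weighted_hom ::
  "'v set \<Rightarrow> 'v set set \<Rightarrow> 'i set \<Rightarrow> ('i \<Rightarrow> real) \<Rightarrow> ('v set \<Rightarrow> 'i \<Rightarrow> 'i \<Rightarrow> real) \<Rightarrow> real" where
  "weighted_hom V E I p a = (\<Sum>\<phi>\<in>V \<rightarrow>\<^sub>E I. (\<Prod>v\<in>V. p (\<phi> v)) * (\<Prod>e\<in>E. edge_val (a e) \<phi> e))"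

lemma vimage_count_space_sets:
  "\<kappa> \<in> measurable M (count_space I) \<Longrightarrow> i \<in> I \<Longrightarrow> \<kappa> -` {i} \<inter> space M \<in> sets M"
  by (rule measurable_sets) auto

text \<open>The boxes \<open>X \<phi>\<close> of configurations with prescribed types split the
  product space, the integrand is constant on each, and independence gives the measure of a box as a
  product.\<close>

lemma decorated_density_finite_valued:
  assumes M: "prob_space M" and G: "finite_simple_graph V E" and I: "finite I"
    and k: "\<kappa> \<in> measurable M (count_space I)"
  shows "decorated_density M V E (\<lambda>e x y. a e (\<kappa> x) (\<kappa> y)) =
    weighted_hom V E I (\<lambda>i. measure M (\<kappa> -` {i} \<inter> space M)) a"
proof -
  let ?N = "PiM V (\<lambda>_. M)"
  let ?p = "\<lambda>i. measure M (\<kappa> -` {i} \<inter> space M)"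
  interpret prob_space M by fact
  have V: "finite V" using G by (simp add: finite_simple_graph_def)
  interpret N: finite_product_prob_space "\<lambda>_. M" V by standard fact
  define g where "g \<phi> = (\<Prod>e\<in>E. edge_val (a e) \<phi> e)" for \<phi>
  define X where "X \<phi> = PiE V (\<lambda>v. \<kappa> -` {\<phi> v} \<inter> space M)" for \<phi>
  have kI: "\<kappa> x \<in> I" if "x \<in> space M" for x using measurable_space[OF k that] by simp
  have X: "X \<phi> \<in> sets ?N" "N.prob (X \<phi>) = (\<Prod>v\<in>V. ?p (\<phi> v))" if "\<phi> \<in> V \<rightarrow>\<^sub>E I" for \<phi>
  proof -
    have *: "\<kappa> -` {\<phi> v} \<inter> space M \<in> sets M" if "v \<in> V" for v
      using vimage_count_space_sets[OF k] \<open>\<phi> \<in> V \<rightarrow>\<^sub>E I\<close> that by auto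
    show "X \<phi> \<in> sets ?N" unfolding X_def using V * by (intro sets_PiM_I_finite) auto
    show "N.prob (X \<phi>) = (\<Prod>v\<in>V. ?p (\<phi> v))" unfolding X_def using * by (intro N.prob_times) auto
  qed
  have fin: "finite (V \<rightarrow>\<^sub>E I)" using V I by (intro finite_PiE) auto
  have point: "(\<Prod>e\<in>E. edge_val (\<lambda>x y. a e (\<kappa> x) (\<kappa> y)) x e) = (\<Sum>\<phi>\<in>V \<rightarrow>\<^sub>E I. indicat_real (X \<phi>) x * g \<phi>)"
    if x: "x \<in> space ?N" for x
  proof -
    define \<psi> where "\<psi> = restrict (\<lambda>v. \<kappa> (x v)) V"
    have xs: "x v \<in> space M" if "v \<in> V" for v using x that by (auto simp: space_PiM)
    have psi: "\<psi> \<in> V \<rightarrow>\<^sub>E I" unfolding \<psi>_def using kI xs by auto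
    have "x \<in> X \<phi> \<longleftrightarrow> \<phi> = \<psi>" if "\<phi> \<in> V \<rightarrow>\<^sub>E I" for \<phi>
    proof
      assume "x \<in> X \<phi>"
      then show "\<phi> = \<psi>" using that unfolding X_def \<psi>_def by (intro PiE_ext[OF that]) (auto simp: PiE_iff)
    next
      assume "\<phi> = \<psi>"
      then show "x \<in> X \<phi>" using x xs unfolding X_def \<psi>_def by (auto simp: PiE_iff space_PiM)
    qed
    then have "(\<Sum>\<phi>\<in>V \<rightarrow>\<^sub>E I. indicat_real (X \<phi>) x * g \<phi>) = (\<Sum>\<phi>\<in>V \<rightarrow>\<^sub>E I. if \<phi> = \<psi> then g \<psi> else 0)"
      by (intro sum.cong) (auto simp: indicator_def)
    also have "\<dots> = g \<psi>" using fin psi by simp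
    also have "\<dots> = (\<Prod>e\<in>E. edge_val (\<lambda>x y. a e (\<kappa> x) (\<kappa> y)) x e)"
      unfolding g_def
    proof (rule prod.cong)
      fix e assume "e \<in> E"
      then have "e \<subseteq> V" using G by (auto simp: finite_simple_graph_def)
      then show "edge_val (a e) \<psi> e = edge_val (\<lambda>x y. a e (\<kappa> x) (\<kappa> y)) x e"
        unfolding edge_val_map by (intro edge_val_cong) (auto simp: \<psi>_def)
    qed simp
    finally show ?thesis by simp
  qed
  have "decorated_density M V E (\<lambda>e x y. a e (\<kappa> x) (\<kappa> y)) = (LINT x|?N. (\<Sum>\<phi>\<in>V \<rightarrow>\<^sub>E I. indicat_real (X \<phi>) x * g \<phi>))"
    unfolding decorated_density_def by (rule Bochner_Integration.integral_cong) (auto simp: point)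
  also have "\<dots> = (\<Sum>\<phi>\<in>V \<rightarrow>\<^sub>E I. LINT x|?N. indicat_real (X \<phi>) x * g \<phi>)"
    using X by (intro Bochner_Integration.integral_sum integrable_mult_left integrable_real_indicator)
      (auto simp: less_top[symmetric])
  also have "\<dots> = (\<Sum>\<phi>\<in>V \<rightarrow>\<^sub>E I. N.prob (X \<phi>) * g \<phi>)"
    using X(1) by (intro sum.cong) (auto simp: Int_absorb2 sets.sets_into_space)
  also have "\<dots> = weighted_hom V E I ?p a"
    unfolding weighted_hom_def g_def using X(2) by (intro sum.cong) auto
  finally show ?thesis .
qed

lemma hom_density_finite_valued:
  assumes "prob_space M" "finite_simple_graph V E" "finite I" "\<kappa> \<in> measurable M (count_space I)"
  shows "hom_density M V E (\<lambda>x y. a (\<kappa> x) (\<kappa> y)) =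
    weighted_hom V E I (\<lambda>i. measure M (\<kappa> -` {i} \<inter> space M)) (\<lambda>_. a)"
  unfolding hom_density_decorated by (rule decorated_density_finite_valued[OF assms])

lemma graphon_finite_valued:
  assumes I: "finite I" and k: "\<kappa> \<in> measurable M (count_space I)"
    and a: "\<And>i j. i \<in> I \<Longrightarrow> j \<in> I \<Longrightarrow> a i j = a j i \<and> 0 \<le> a i j \<and> a i j \<le> 1"
  shows "graphon M (\<lambda>x y. a (\<kappa> x) (\<kappa> y))"
proof -
  have kI: "\<kappa> x \<in> I" if "x \<in> space M" for x using measurable_space[OF k that] by simp
  have "(\<lambda>z. \<Sum>i\<in>I. \<Sum>j\<in>I. a i j * (indicat_real ((\<kappa> -` {i} \<inter> space M) \<times> (\<kappa> -` {j} \<inter> space M)) z)) \<in> borel_measurable (M \<Otimes>\<^sub>M M)"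
    by (intro borel_measurable_sum borel_measurable_times borel_measurable_const borel_measurable_indicator
        pair_measureI vimage_count_space_sets[OF k])
  also have "?this \<longleftrightarrow> (\<lambda>(x, y). a (\<kappa> x) (\<kappa> y)) \<in> borel_measurable (M \<Otimes>\<^sub>M M)"
  proof (rule measurable_cong)
    fix z assume "z \<in> space (M \<Otimes>\<^sub>M M)"
    then obtain x y where z: "z = (x, y)" "x \<in> space M" "y \<in> space M" by (auto simp: space_pair_measure)
    have "(\<Sum>i\<in>I. \<Sum>j\<in>I. a i j * (indicat_real ((\<kappa> -` {i} \<inter> space M) \<times> (\<kappa> -` {j} \<inter> space M)) z)) =
        (\<Sum>i\<in>I. if i = \<kappa> x then \<Sum>j\<in>I. if j = \<kappa> y then a i j else 0 else 0)"
      using z by (intro sum.cong refl) (auto simp: indicator_def intro!: sum.neutral sum.cong)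
    also have "\<dots> = a (\<kappa> x) (\<kappa> y)" using I kI z by simp
    finally show "(\<Sum>i\<in>I. \<Sum>j\<in>I. a i j * (indicat_real ((\<kappa> -` {i} \<inter> space M) \<times> (\<kappa> -` {j} \<inter> space M)) z)) =
        (case z of (x, y) \<Rightarrow> a (\<kappa> x) (\<kappa> y))" using z by simp
  qed
  finally show ?thesis using a kI by (auto simp: graphon_def)
qed

text \<open>The sides \<open>S\<close> and \<open>T\<close> enter bilinearly, through the measures
  of their pieces of each type. This is why weak* limits of versions of a finite-valued graphon can
  be computed from limits of measures of sets.\<close>

lemma rect_integral_finite_valued:
  assumes M: "prob_space M" and I: "finite I" and k: "\<kappa> \<in> measurable M (count_space I)"
    and S: "S \<in> sets M" and T: "T \<in> sets M"
  shows "rect_integral M (\<lambda>x y. a (\<kappa> x) (\<kappa> y)) S T =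
    (\<Sum>i\<in>I. \<Sum>j\<in>I. a i j * (measure M (S \<inter> \<kappa> -` {i}) * measure M (T \<inter> \<kappa> -` {j})))"
proof -
  interpret prob_space M by fact
  interpret P: prob_space "M \<Otimes>\<^sub>M M" using M by (rule prob_space_pair_self)
  have kI: "\<kappa> x \<in> I" if "x \<in> space M" for x using measurable_space[OF k that] by simp
  have SM: "S \<subseteq> space M" "T \<subseteq> space M" using S T sets.sets_into_space by auto
  have sS: "S \<inter> \<kappa> -` {i} \<in> sets M" if "i \<in> I" "S \<in> sets M" for i S
  proof -
    have "S \<inter> \<kappa> -` {i} = S \<inter> (\<kappa> -` {i} \<inter> space M)" using sets.sets_into_space[OF that(2)] by blast
    then show ?thesis using vimage_count_space_sets[OF k that(1)] that(2) by simp
  qed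
  let ?R = "\<lambda>i j. (S \<inter> \<kappa> -` {i}) \<times> (T \<inter> \<kappa> -` {j})"
  have "rect_integral M (\<lambda>x y. a (\<kappa> x) (\<kappa> y)) S T = (LINT z|(M \<Otimes>\<^sub>M M). (\<Sum>i\<in>I. \<Sum>j\<in>I. a i j * indicat_real (?R i j) z))"
    unfolding rect_integral_def set_lebesgue_integral_def
  proof (rule Bochner_Integration.integral_cong)
    fix z assume "z \<in> space (M \<Otimes>\<^sub>M M)"
    then obtain x y where z: "z = (x, y)" "x \<in> space M" "y \<in> space M" by (auto simp: space_pair_measure)
    have "(\<Sum>i\<in>I. \<Sum>j\<in>I. a i j * indicat_real (?R i j) z) =
        (\<Sum>i\<in>I. if i = \<kappa> x then \<Sum>j\<in>I. if j = \<kappa> y then a i j * indicat_real (S \<times> T) z else 0 else 0)"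
      using z by (intro sum.cong refl) (auto simp: indicator_def intro!: sum.neutral sum.cong)
    also have "\<dots> = a (\<kappa> x) (\<kappa> y) * indicat_real (S \<times> T) z" using I kI z by simp
    finally show "indicat_real (S \<times> T) z *\<^sub>R a (\<kappa> (fst z)) (\<kappa> (snd z)) = (\<Sum>i\<in>I. \<Sum>j\<in>I. a i j * indicat_real (?R i j) z)"
      using z by simp
  qed simp
  also have "\<dots> = (\<Sum>i\<in>I. \<Sum>j\<in>I. LINT z|(M \<Otimes>\<^sub>M M). a i j * indicat_real (?R i j) z)"
    using sS S T by (subst Bochner_Integration.integral_sum; (intro sum.cong refl Bochner_Integration.integral_sum)?)
      (auto intro!: Bochner_Integration.integrable_sum integrable_mult_right integrable_real_indicator simp: less_top[symmetric])
  also have "\<dots> = (\<Sum>i\<in>I. \<Sum>j\<in>I. a i j * measure (M \<Otimes>\<^sub>M M) (?R i j))"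
  proof (intro sum.cong refl)
    fix i j assume "i \<in> I" "j \<in> I"
    have "?R i j \<inter> space (M \<Otimes>\<^sub>M M) = ?R i j" using SM by (auto simp: space_pair_measure)
    then show "(LINT z|(M \<Otimes>\<^sub>M M). a i j * indicat_real (?R i j) z) = a i j * measure (M \<Otimes>\<^sub>M M) (?R i j)" by simp
  qed
  also have "\<dots> = (\<Sum>i\<in>I. \<Sum>j\<in>I. a i j * (measure M (S \<inter> \<kappa> -` {i}) * measure M (T \<inter> \<kappa> -` {j})))"
    using sS S T by (intro sum.cong refl) (simp add: measure_rect[OF M])
  finally show ?thesis .
qed

lemma partition_index_map:
  assumes "finite_measurable_partition M P"
  shows "\<exists>(\<kappa> :: 'a \<Rightarrow> nat) k h. \<kappa> \<in> measurable M (count_space {..<k}) \<and> bij_betw h {..<k} P \<and>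
    (\<forall>x\<in>space M. x \<in> h (\<kappa> x))"
proof -
  note PD = finite_measurable_partitionD[OF assms]
  obtain h where h: "bij_betw h {..<card P} P"
    using ex_bij_betw_nat_finite[OF PD(1)] atLeast0LessThan by metis
  define \<kappa> where "\<kappa> x = (THE i. i < card P \<and> x \<in> h i)" for x
  have uniq: "i = j" if "i < card P" "j < card P" "x \<in> h i" "x \<in> h j" for i j x
  proof -
    have "h i \<in> P" "h j \<in> P" using h that unfolding bij_betw_def by auto
    then have "h i = h j" using disjointD[OF PD(3), of "h i" "h j"] that by blast
    then show ?thesis using h that unfolding bij_betw_def inj_on_def by auto
  qed
  have kap: "\<kappa> x = i" if "i < card P" "x \<in> h i" for i x
    unfolding \<kappa>_def
  proof (rule the_equality)
    show "j = i" if "j < card P \<and> x \<in> h j" for j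
      using uniq[of j i x] that \<open>i < card P\<close> \<open>x \<in> h i\<close> by blast
  qed (use that in blast)
  have ex: "\<exists>i<card P. x \<in> h i" if "x \<in> space M" for x
  proof -
    obtain A where "A \<in> P" "x \<in> A" using PD(4) \<open>x \<in> space M\<close> by blast
    then have "A \<in> h ` {..<card P}" using h unfolding bij_betw_def by simp
    then show ?thesis using \<open>x \<in> A\<close> by auto
  qed
  have sub: "h i \<subseteq> space M" "h i \<in> sets M" if "i < card P" for i
  proof -
    have "h i \<in> P" using h that unfolding bij_betw_def by auto
    then show "h i \<subseteq> space M" "h i \<in> sets M" using PD by auto
  qed
  have vim: "\<kappa> -` {i} \<inter> space M = h i" if "i < card P" for i
  proof (intro equalityI subsetI)
    fix x assume "x \<in> \<kappa> -` {i} \<inter> space M"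
    then show "x \<in> h i" using ex[of x] kap by auto
  qed (use kap[OF that] sub[OF that] in auto)
  have in_h: "x \<in> h (\<kappa> x)" if "x \<in> space M" for x
    using ex[OF that] kap by blast
  have "\<kappa> \<in> measurable M (count_space {..<card P})"
  proof (subst measurable_count_space_eq2, simp, intro conjI ballI)
    show "\<kappa> \<in> space M \<rightarrow> {..<card P}" using ex kap by (metis Pi_I lessThan_iff)
  qed (use vim sub in simp)
  then show ?thesis using h in_h by blast
qed

text \<open>The part index of a fine common partition serves as \<open>\<kappa>\<close>, and the
  averages serve as \<open>a\<close>. One \<open>\<kappa>\<close> for all edges is what makes a
  decorated density a single finite sum.\<close>

lemma finite_valued_approximation:
  assumes M: "prob_space M" and "finite E" and w: "\<And>e. e \<in> E \<Longrightarrow> graphon M (w e)" and \<epsilon>: "\<epsilon> > 0"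
  shows "\<exists>(\<kappa> :: 'a \<Rightarrow> nat) k a. \<kappa> \<in> measurable M (count_space {..<k}) \<and>
    (\<forall>e\<in>E. \<forall>i<k. \<forall>j<k. a e i j = a e j i \<and> 0 \<le> a e i j \<and> a e i j \<le> 1) \<and>
    (\<forall>e\<in>E. graphon_dist M (w e) (\<lambda>x y. a e (\<kappa> x) (\<kappa> y)) < \<epsilon>)"
proof -
  obtain Q where Q: "finite_measurable_partition M Q"
    and d: "\<forall>e\<in>E. graphon_dist M (w e) (stepping M Q (w e)) < \<epsilon>"
    using stepping_approximation[of M E w \<epsilon>, OF M \<open>finite E\<close> w \<epsilon>] by blast
  obtain \<kappa> :: "'a \<Rightarrow> nat" and k h where k: "\<kappa> \<in> measurable M (count_space {..<k})" "bij_betw h {..<k} Q"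
    "\<forall>x\<in>space M. x \<in> h (\<kappa> x)"
    using partition_index_map[OF Q] by blast
  define a where "a e i j = rect_integral M (w e) (h i) (h j) / (measure M (h i) * measure M (h j))" for e i j
  have hQ: "h i \<in> Q" if "i < k" for i using k(2) that unfolding bij_betw_def by auto
  have hM: "h i \<in> sets M" if "i < k" for i using finite_measurable_partitionD(2)[OF Q] hQ[OF that] by blast
  have q: "0 \<le> r / p \<and> r / p \<le> 1" if "0 \<le> r" "r \<le> p" for r p :: real
    using that by (cases "p = 0") (auto simp: divide_le_eq_1)
  have a: "a e i j = a e j i \<and> 0 \<le> a e i j \<and> a e i j \<le> 1" if "e \<in> E" "i < k" "j < k" for e i j
    using q[OF rect_integral_bounds[OF M w[OF that(1)] hM[OF that(2)] hM[OF that(3)]]]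
      rect_integral_sym[OF M w[OF that(1)] hM[OF that(2)] hM[OF that(3)]]
    unfolding a_def by (simp add: mult.commute)
  have "stepping M Q (w e) x y = a e (\<kappa> x) (\<kappa> y)" if "x \<in> space M" "y \<in> space M" for e x y
    unfolding a_def using k(3) that measurable_space[OF k(1)] hQ by (intro stepping_eq[OF Q]) auto
  then have "graphon_dist M (w e) (\<lambda>x y. a e (\<kappa> x) (\<kappa> y)) = graphon_dist M (w e) (stepping M Q (w e))" for e
    unfolding graphon_dist_def by (intro Bochner_Integration.integral_cong) (auto simp: space_pair_measure)
  then show ?thesis using k(1) a d by (intro exI[of _ \<kappa>] exI[of _ k] exI[of _ a]) auto
qed

section \<open>Stepping and the envelope\<close>

lemma measure_preserving_bijD:
  assumes "measure_preserving_bij M \<pi>"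
  shows "\<pi> \<in> measurable M M" "\<And>S. S \<in> sets M \<Longrightarrow> measure M (\<pi> -` S \<inter> space M) = measure M S"
proof -
  show m: "\<pi> \<in> measurable M M" using assms by (simp add: measure_preserving_bij_def)
  fix S assume "S \<in> sets M"
  then have "measure M (\<pi> -` S \<inter> space M) = measure (distr M M \<pi>) S" using m by (simp add: measure_distr)
  then show "measure M (\<pi> -` S \<inter> space M) = measure M S" using assms by (simp add: measure_preserving_bij_def)
qed

lemma measure_preserving_bij_comp:
  assumes "measure_preserving_bij M \<pi>" "measure_preserving_bij M \<rho>"
  shows "measure_preserving_bij M (\<pi> \<circ> \<rho>)"
  using assms distr_distr[of \<pi> M M \<rho> M] bij_betw_trans[of \<rho> "space M" "space M" \<pi> "space M"]
  unfolding measure_preserving_bij_def by (auto intro: measurable_comp)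

lemma measure_preserving_bij_id: "measure_preserving_bij M id"
  unfolding measure_preserving_bij_def by (auto simp: id_def bij_betw_def)

lemma version_comp: "version (version W \<rho>) \<pi> = version W (\<rho> \<circ> \<pi>)"
  unfolding version_def by simp

lemma graphon_version:
  assumes "graphon M W" "\<pi> \<in> measurable M M"
  shows "graphon M (version W \<pi>)"
  unfolding graphon_def
proof (intro conjI ballI)
  show "(\<lambda>(x, y). version W \<pi> x y) \<in> borel_measurable (M \<Otimes>\<^sub>M M)"
    unfolding version_def case_prod_beta
    by (rule graphon_measurable2[OF assms(1)]) (use assms(2) in measurable)
qed (use assms measurable_space[OF assms(2)] in \<open>auto simp: graphon_def version_def\<close>)

lemma rect_integral_version:
  assumes M: "prob_space M" and W: "graphon M W" and p: "measure_preserving_bij M \<pi>"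
    and A: "A \<in> sets M" and B: "B \<in> sets M"
  shows "rect_integral M (version W \<pi>) (\<pi> -` A \<inter> space M) (\<pi> -` B \<inter> space M) = rect_integral M W A B"
proof -
  interpret prob_space M by fact
  have [measurable]: "\<pi> \<in> measurable M M" and d: "distr M M \<pi> = M"
    using p by (auto simp: measure_preserving_bij_def)
  have m: "(\<lambda>(x, y). (\<pi> x, \<pi> y)) \<in> measurable (M \<Otimes>\<^sub>M M) (M \<Otimes>\<^sub>M M)" by measurable
  have "distr M M \<pi> \<Otimes>\<^sub>M distr M M \<pi> = distr (M \<Otimes>\<^sub>M M) (M \<Otimes>\<^sub>M M) (\<lambda>(x, y). (\<pi> x, \<pi> y))"
    by (rule pair_measure_distr) (auto simp: d intro: sigma_finite_measure_axioms)
  then have dd: "distr (M \<Otimes>\<^sub>M M) (M \<Otimes>\<^sub>M M) (\<lambda>(x, y). (\<pi> x, \<pi> y)) = M \<Otimes>\<^sub>M M" by (simp add: d)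
  have "rect_integral M W A B = (LINT z|(distr (M \<Otimes>\<^sub>M M) (M \<Otimes>\<^sub>M M) (\<lambda>(x, y). (\<pi> x, \<pi> y))). indicator (A \<times> B) z *\<^sub>R W (fst z) (snd z))"
    unfolding dd rect_integral_def set_lebesgue_integral_def ..
  also have "\<dots> = (LINT z|(M \<Otimes>\<^sub>M M). indicator (A \<times> B) (case z of (x, y) \<Rightarrow> (\<pi> x, \<pi> y)) *\<^sub>R
      W (fst (case z of (x, y) \<Rightarrow> (\<pi> x, \<pi> y))) (snd (case z of (x, y) \<Rightarrow> (\<pi> x, \<pi> y))))"
    using graphon_measurable_pair[OF W] A B
    by (intro integral_distr[OF m] borel_measurable_scaleR borel_measurable_indicator) auto
  also have "\<dots> = rect_integral M (version W \<pi>) (\<pi> -` A \<inter> space M) (\<pi> -` B \<inter> space M)"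
    unfolding rect_integral_def set_lebesgue_integral_def
    by (intro Bochner_Integration.integral_cong refl)
      (auto simp: version_def space_pair_measure indicator_def)
  finally show ?thesis ..
qed

lemma vimage_partition:
  assumes P: "finite_measurable_partition M P" and p: "measure_preserving_bij M \<pi>"
  shows "finite_measurable_partition M ((\<lambda>A. \<pi> -` A \<inter> space M) ` P)"
proof -
  note PD = finite_measurable_partitionD[OF P]
  note m = measure_preserving_bijD(1)[OF p]
  \<comment> \<open>Surjectivity keeps the pulled back parts nonempty.\<close>
  have surj: "\<pi> ` space M = space M" using p by (simp add: measure_preserving_bij_def bij_betw_def)
  have "partition_on (space M) ((\<lambda>A. \<pi> -` A \<inter> space M) ` P)"
  proof (rule partition_onI)
    show "\<Union>((\<lambda>A. \<pi> -` A \<inter> space M) ` P) = space M" using PD(4) measurable_space[OF m] by blast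
    have "q \<noteq> {}" if "q \<in> (\<lambda>A. \<pi> -` A \<inter> space M) ` P" for q
    proof -
      obtain A where A: "A \<in> P" "q = \<pi> -` A \<inter> space M" using \<open>q \<in> _\<close> by blast
      have "A \<noteq> {}" using A P by (auto simp: finite_measurable_partition_def partition_on_def)
      then obtain y where y: "y \<in> A" by blast
      then have "y \<in> \<pi> ` space M" using A PD(4) surj by blast
      then show ?thesis using y A by blast
    qed
    then show "{} \<notin> (\<lambda>A. \<pi> -` A \<inter> space M) ` P" by blast
    show "disjnt q q'" if "q \<in> (\<lambda>A. \<pi> -` A \<inter> space M) ` P" "q' \<in> (\<lambda>A. \<pi> -` A \<inter> space M) ` P" "q \<noteq> q'" for q q'
    proof -
      obtain A A' where A: "A \<in> P" "A' \<in> P" "q = \<pi> -` A \<inter> space M" "q' = \<pi> -` A' \<inter> space M"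
        using \<open>q \<in> _\<close> \<open>q' \<in> _\<close> by blast
      then have "A \<inter> A' = {}" using \<open>q \<noteq> q'\<close> disjointD[OF PD(3)] by blast
      then show ?thesis unfolding disjnt_def A(3,4) by blast
    qed
  qed
  moreover have "(\<lambda>A. \<pi> -` A \<inter> space M) ` P \<subseteq> sets M" using measurable_sets[OF m] PD(2) by blast
  ultimately show ?thesis using PD(1) by (simp add: finite_measurable_partition_def)
qed

text \<open>Relabelling preserves rectangle integrals and measures alike, hence averages. The
  envelope argument uses this to read a version of a stepping as a stepping of a version, with the
  partition pulled back.\<close>

lemma stepping_version:
  assumes M: "prob_space M" and W: "graphon M W" and P: "finite_measurable_partition M P"
    and p: "measure_preserving_bij M \<pi>" and x: "x \<in> space M" and y: "y \<in> space M"
  shows "stepping M ((\<lambda>A. \<pi> -` A \<inter> space M) ` P) (version W \<pi>) x y = version (stepping M P W) \<pi> x y"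
proof -
  note PD = finite_measurable_partitionD[OF P]
  note m = measure_preserving_bijD[OF p]
  obtain A B where AB: "A \<in> P" "\<pi> x \<in> A" "B \<in> P" "\<pi> y \<in> B"
    using measurable_space[OF m(1)] x y PD(4) by blast
  have s: "A \<in> sets M" "B \<in> sets M" using AB PD by auto
  have "stepping M ((\<lambda>A. \<pi> -` A \<inter> space M) ` P) (version W \<pi>) x y =
      rect_integral M (version W \<pi>) (\<pi> -` A \<inter> space M) (\<pi> -` B \<inter> space M) /
      (measure M (\<pi> -` A \<inter> space M) * measure M (\<pi> -` B \<inter> space M))"
    by (rule stepping_eq[OF vimage_partition[OF P p]]) (use AB x y in auto)
  also have "\<dots> = version (stepping M P W) \<pi> x y"
    unfolding rect_integral_version[OF M W p s] m(2)[OF s(1)] m(2)[OF s(2)]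
    using stepping_eq[OF P AB, of W] by (simp add: version_def)
  finally show ?thesis .
qed

lemma rect_integral_cong:
  assumes "\<And>x y. x \<in> space M \<Longrightarrow> y \<in> space M \<Longrightarrow> U x y = W x y"
  shows "rect_integral M U S T = rect_integral M W S T"
  unfolding rect_integral_def set_lebesgue_integral_def
  by (intro Bochner_Integration.integral_cong) (auto simp: space_pair_measure assms)

lemma rect_integral_stepping:
  assumes M: "prob_space M" and P: "finite_measurable_partition M P" and S: "S \<in> sets M" and T: "T \<in> sets M"
  shows "rect_integral M (stepping M P W) S T = (\<Sum>A\<in>P. \<Sum>B\<in>P.
    rect_integral M W A B / (measure M A * measure M B) * (measure M (A \<inter> S) * measure M (B \<inter> T)))"
proof -
  interpret prob_space M by fact
  interpret P: prob_space "M \<Otimes>\<^sub>M M" using M by (rule prob_space_pair_self)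
  have PM: "A \<in> sets M" if "A \<in> P" for A using finite_measurable_partitionD(2)[OF P] that by blast
  let ?c = "\<lambda>A B. rect_integral M W A B / (measure M A * measure M B)"
  let ?R = "\<lambda>A B. (A \<inter> S) \<times> (B \<inter> T)"
  have "rect_integral M (stepping M P W) S T = (LINT z|(M \<Otimes>\<^sub>M M). (\<Sum>A\<in>P. \<Sum>B\<in>P. ?c A B * indicat_real (?R A B) z))"
    unfolding rect_integral_def set_lebesgue_integral_def
  proof (rule Bochner_Integration.integral_cong)
    fix z
    have "indicat_real (S \<times> T) z *\<^sub>R stepping M P W (fst z) (snd z) = (\<Sum>A\<in>P. \<Sum>B\<in>P.
        indicat_real (S \<times> T) z * (indicator A (fst z) * indicator B (snd z) * ?c A B))"
      unfolding stepping_def rect_integral_def set_lebesgue_integral_def by (simp add: sum_distrib_left)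
    also have "\<dots> = (\<Sum>A\<in>P. \<Sum>B\<in>P. ?c A B * indicat_real (?R A B) z)"
      by (intro sum.cong refl) (cases z, auto simp: indicator_def)
    finally show "indicat_real (S \<times> T) z *\<^sub>R stepping M P W (fst z) (snd z) = (\<Sum>A\<in>P. \<Sum>B\<in>P.
        (\<integral>x. indicat_real (A \<times> B) x *\<^sub>R W (fst x) (snd x) \<partial>(M \<Otimes>\<^sub>M M)) / (measure M A * measure M B) * indicat_real (?R A B) z)"
      unfolding rect_integral_def set_lebesgue_integral_def .
  qed simp
  also have "\<dots> = (\<Sum>A\<in>P. \<Sum>B\<in>P. LINT z|(M \<Otimes>\<^sub>M M). ?c A B * indicat_real (?R A B) z)"
    using PM S T by (subst Bochner_Integration.integral_sum; (intro sum.cong refl Bochner_Integration.integral_sum)?)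
      (auto intro!: Bochner_Integration.integrable_sum integrable_mult_right integrable_real_indicator simp: less_top[symmetric])
  also have "\<dots> = (\<Sum>A\<in>P. \<Sum>B\<in>P. ?c A B * measure (M \<Otimes>\<^sub>M M) (?R A B))"
  proof (intro sum.cong refl)
    fix A B assume "A \<in> P" "B \<in> P"
    have "?R A B \<inter> space (M \<Otimes>\<^sub>M M) = ?R A B"
      using sets.sets_into_space[OF S] sets.sets_into_space[OF T] by (auto simp: space_pair_measure)
    then show "(LINT z|(M \<Otimes>\<^sub>M M). ?c A B * indicat_real (?R A B) z) = ?c A B * measure (M \<Otimes>\<^sub>M M) (?R A B)" by simp
  qed
  also have "\<dots> = (\<Sum>A\<in>P. \<Sum>B\<in>P. ?c A B * (measure M (A \<inter> S) * measure M (B \<inter> T)))"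
    using PM S T by (intro sum.cong refl) (simp add: measure_rect[OF M])
  finally show ?thesis .
qed

lemma sum_bilinear_swap:
  fixes a :: "'i \<Rightarrow> 'i \<Rightarrow> real"
  shows "(\<Sum>i\<in>I. \<Sum>j\<in>I. a i j * ((\<Sum>A\<in>P. f A i) * (\<Sum>B\<in>P. g B j))) =
    (\<Sum>A\<in>P. \<Sum>B\<in>P. \<Sum>i\<in>I. \<Sum>j\<in>I. a i j * (f A i * g B j))"
proof -
  have "(\<Sum>i\<in>I. \<Sum>j\<in>I. a i j * ((\<Sum>A\<in>P. f A i) * (\<Sum>B\<in>P. g B j))) =
      (\<Sum>i\<in>I. \<Sum>j\<in>I. \<Sum>A\<in>P. \<Sum>B\<in>P. a i j * (f A i * g B j))"
    by (simp only: sum_product) (simp only: sum_distrib_left)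
  also have "\<dots> = (\<Sum>i\<in>I. \<Sum>A\<in>P. \<Sum>j\<in>I. \<Sum>B\<in>P. a i j * (f A i * g B j))"
    by (intro sum.cong refl) (rule sum.swap)
  also have "\<dots> = (\<Sum>i\<in>I. \<Sum>A\<in>P. \<Sum>B\<in>P. \<Sum>j\<in>I. a i j * (f A i * g B j))"
    by (intro sum.cong refl) (rule sum.swap)
  also have "\<dots> = (\<Sum>A\<in>P. \<Sum>i\<in>I. \<Sum>B\<in>P. \<Sum>j\<in>I. a i j * (f A i * g B j))" by (rule sum.swap)
  also have "\<dots> = (\<Sum>A\<in>P. \<Sum>B\<in>P. \<Sum>i\<in>I. \<Sum>j\<in>I. a i j * (f A i * g B j))"
    by (intro sum.cong refl) (rule sum.swap)
  finally show ?thesis .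
qed

text \<open>Both factors in the bilinear formula for rectangle integrals converge by mixing to sums
  over the parts. Regrouping the product of the two limits by pairs of parts produces the averages
  of the graphon over the rectangles \<open>A \<times> B\<close>.\<close>

lemma stepping_weak_limit:
  assumes M: "prob_space M" "standard_borel M" "atomless M" and P: "finite_measurable_partition M P"
    and I: "finite I" and k: "\<kappa> \<in> measurable M (count_space I)"
  shows "\<exists>\<pi> :: nat \<Rightarrow> 'a \<Rightarrow> 'a. (\<forall>n. measure_preserving_bij M (\<pi> n)) \<and>
    weak_star_conv M (\<lambda>n. version (\<lambda>x y. a (\<kappa> x) (\<kappa> y)) (\<pi> n)) (stepping M P (\<lambda>x y. a (\<kappa> x) (\<kappa> y)))"
proof -
  obtain \<pi> :: "nat \<Rightarrow> 'a \<Rightarrow> 'a" where p: "\<And>n. measure_preserving_bij M (\<pi> n)"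
    and mix: "\<And>S T. S \<in> sets M \<Longrightarrow> T \<in> sets M \<Longrightarrow> (\<lambda>n. measure M (S \<inter> \<pi> n -` T)) \<longlonglongrightarrow>
      (\<Sum>A\<in>P. measure M (A \<inter> S) * measure M (A \<inter> T) / measure M A)"
    using exists_mixing_bijections[OF M P] by blast
  have PM: "A \<in> sets M" if "A \<in> P" for A using finite_measurable_partitionD(2)[OF P] that by blast
  let ?K = "\<lambda>i. \<kappa> -` {i} \<inter> space M"
  let ?W = "\<lambda>x y. a (\<kappa> x) (\<kappa> y)"
  have K: "?K i \<in> sets M" if "i \<in> I" for i using vimage_count_space_sets[OF k that] .
  have "(\<lambda>n. rect_integral M (version ?W (\<pi> n)) S T) \<longlonglongrightarrow> rect_integral M (stepping M P ?W) S T"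
    if S: "S \<in> sets M" and T: "T \<in> sets M" for S T
  proof -
    have SP: "S \<inter> (\<lambda>x. \<kappa> (\<pi> n x)) -` {i} = S \<inter> \<pi> n -` ?K i" if "S \<in> sets M" for S n i
      using sets.sets_into_space[OF that] measurable_space[OF measure_preserving_bijD(1)[OF p]] by auto
    have "rect_integral M (version ?W (\<pi> n)) S T =
        (\<Sum>i\<in>I. \<Sum>j\<in>I. a i j * (measure M (S \<inter> \<pi> n -` ?K i) * measure M (T \<inter> \<pi> n -` ?K j)))" for n
    proof -
      have "(\<lambda>x. \<kappa> (\<pi> n x)) \<in> measurable M (count_space I)"
        by (rule measurable_compose[OF measure_preserving_bijD(1)[OF p] k])
      from rect_integral_finite_valued[OF M(1) I this S T, of a] show ?thesis
        unfolding version_def SP[OF S] SP[OF T] .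
    qed
    moreover have "(\<lambda>n. \<Sum>i\<in>I. \<Sum>j\<in>I. a i j * (measure M (S \<inter> \<pi> n -` ?K i) * measure M (T \<inter> \<pi> n -` ?K j))) \<longlonglongrightarrow>
        (\<Sum>i\<in>I. \<Sum>j\<in>I. a i j * ((\<Sum>A\<in>P. measure M (A \<inter> S) * measure M (A \<inter> ?K i) / measure M A) *
           (\<Sum>B\<in>P. measure M (B \<inter> T) * measure M (B \<inter> ?K j) / measure M B)))"
      by (intro tendsto_sum tendsto_mult tendsto_const mix S T K)
    moreover have "(\<Sum>i\<in>I. \<Sum>j\<in>I. a i j * ((\<Sum>A\<in>P. measure M (A \<inter> S) * measure M (A \<inter> ?K i) / measure M A) *
           (\<Sum>B\<in>P. measure M (B \<inter> T) * measure M (B \<inter> ?K j) / measure M B))) = rect_integral M (stepping M P ?W) S T"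
      unfolding sum_bilinear_swap rect_integral_stepping[OF M(1) P S T]
    proof (intro sum.cong refl)
      fix A B assume AB: "A \<in> P" "B \<in> P"
      have AK: "A \<inter> ?K i = A \<inter> \<kappa> -` {i}" if "A \<in> P" for A i using sets.sets_into_space[OF PM[OF that]] by blast
      show "(\<Sum>i\<in>I. \<Sum>j\<in>I. a i j * (measure M (A \<inter> S) * measure M (A \<inter> ?K i) / measure M A *
            (measure M (B \<inter> T) * measure M (B \<inter> ?K j) / measure M B))) =
          rect_integral M ?W A B / (measure M A * measure M B) * (measure M (A \<inter> S) * measure M (B \<inter> T))"
        unfolding rect_integral_finite_valued[OF M(1) I k PM[OF AB(1)] PM[OF AB(2)]] AK[OF AB(1)] AK[OF AB(2)]
        by (simp add: sum_divide_distrib sum_distrib_right sum_distrib_left mult_ac)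
    qed
    ultimately show ?thesis by simp
  qed
  then show ?thesis using p unfolding weak_star_conv_def by blast
qed

section \<open>Weak* convergence tested on a countable generator\<close>

lemma rect_integral_sums:
  assumes M: "prob_space M" and W: "graphon M W" and T: "T \<in> sets M"
    and A: "disjoint_family A" "range A \<subseteq> sets M"
  shows "(\<lambda>i. rect_integral M W (A i) T) sums rect_integral M W (\<Union>i. A i) T"
proof -
  interpret prob_space M by fact
  have AM: "A i \<in> sets M" for i using A by auto
  then have U: "(\<Union>i. A i) \<in> sets M" by blast
  have eq: "(\<Union>i. A i) \<times> T = (\<Union>i. A i \<times> T)" by blast
  have "rect_integral M W (\<Union>i. A i) T = (\<Sum>i. rect_integral M W (A i) T)"
    unfolding rect_integral_def eq
  proof (rule lebesgue_integral_countable_add)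
    show "set_integrable (M \<Otimes>\<^sub>M M) (\<Union>i. A i \<times> T) (\<lambda>z. W (fst z) (snd z))"
      unfolding eq[symmetric] by (rule set_integrable_rect[OF integrable_graphon[OF M W] U T])
    show "A i \<times> T \<inter> A j \<times> T = {}" if "i \<noteq> j" for i j
      using A(1) that by (auto simp: disjoint_family_on_def)
  qed (use AM T in auto)
  moreover have "summable (\<lambda>i. rect_integral M W (A i) T)"
  proof (rule summable_comparison_test'[where N = 0])
    show "summable (\<lambda>i. measure M (A i))"
      using finite_measure_UNION[OF A(2,1)] by (rule sums_summable)
    fix i
    have "rect_integral M W (A i) T \<le> measure M (A i) * measure M T"
      by (rule rect_integral_bounds(2)[OF M W AM T])
    also have "\<dots> \<le> measure M (A i)" by (simp add: mult_left_le)
    finally show "norm (rect_integral M W (A i) T) \<le> measure M (A i)"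
      using rect_integral_bounds(1)[OF M W AM[of i] T] by simp
  qed
  ultimately show ?thesis by (simp add: summable_sums)
qed

lemma rect_integral_le_measure:
  assumes M: "prob_space M" and W: "graphon M W" and S: "S \<in> sets M" and T: "T \<in> sets M"
  shows "\<bar>rect_integral M W S T\<bar> \<le> measure M S"
proof -
  interpret prob_space M by fact
  have "rect_integral M W S T \<le> measure M S * measure M T" by (rule rect_integral_bounds(2)[OF M W S T])
  also have "\<dots> \<le> measure M S" by (simp add: mult_left_le)
  finally show ?thesis using rect_integral_bounds(1)[OF M W S T] by simp
qed

text \<open>The passage from the generator to all measurable sets is made for one side of the
  rectangle at a time; symmetry of graphons exchanges the sides between the two passes.\<close>

lemma weak_star_conv_generator:
  assumes M: "prob_space M" and G: "\<And>n. graphon M (\<Gamma> n)" and U: "graphon M U"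
    and D: "Int_stable D" "D \<subseteq> Pow (space M)" "sets M = sigma_sets (space M) D" "space M \<in> D"
    and conv: "\<And>S T. S \<in> D \<Longrightarrow> T \<in> D \<Longrightarrow> (\<lambda>n. rect_integral M (\<Gamma> n) S T) \<longlonglongrightarrow> rect_integral M U S T"
  shows "weak_star_conv M \<Gamma> U"
proof -
  interpret prob_space M by fact
  have DM: "T \<in> sets M" if "T \<in> D" for T using D(3) that by auto
  have 1: "(\<lambda>n. rect_integral M (\<Gamma> n) S T) \<longlonglongrightarrow> rect_integral M U S T" if "S \<in> sets M" "T \<in> D" for S T
    by (rule tendsto_on_sigma_sets[where m = "\<lambda>n S. rect_integral M (\<Gamma> n) S T" and l = "\<lambda>S. rect_integral M U S T",
          OF finite_measure_axioms D(1-3)])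
      (use that D(4) conv rect_integral_sums[OF M G DM] rect_integral_sums[OF M U DM] rect_integral_le_measure[OF M G _ DM] in auto)
  have sw: "rect_integral M W S T = rect_integral M W T S" if "graphon M W" "S \<in> sets M" "T \<in> sets M" for W S T
    by (rule rect_integral_sym[OF M that])
  have "(\<lambda>n. rect_integral M (\<Gamma> n) T S) \<longlonglongrightarrow> rect_integral M U T S" if S: "S \<in> sets M" and T: "T \<in> sets M" for S T
  proof (rule tendsto_on_sigma_sets[where m = "\<lambda>n T. rect_integral M (\<Gamma> n) T S" and l = "\<lambda>T. rect_integral M U T S",
          OF finite_measure_axioms D(1-3)])
    show "(\<lambda>n. rect_integral M (\<Gamma> n) T S) \<longlonglongrightarrow> rect_integral M U T S" if "T \<in> D" for T
      using 1[OF S that] sw[OF G S DM[OF that]] sw[OF U S DM[OF that]] by simp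
    then show "(\<lambda>n. rect_integral M (\<Gamma> n) (space M) S) \<longlonglongrightarrow> rect_integral M U (space M) S" using D(4) .
  qed (use S T rect_integral_sums[OF M G S] rect_integral_sums[OF M U S] rect_integral_le_measure[OF M G _ S] in auto)
  then show ?thesis unfolding weak_star_conv_def by blast
qed

text \<open>A diagonal argument can meet only countably many conditions. The generators are the
  preimages of rational half-lines under the Borel code; they suffice because the decoding map
  \<open>g\<close> shows every measurable set to be pulled back from a Borel set.\<close>

lemma standard_borel_countable_generator:
  assumes "standard_borel M" "space M \<noteq> {}"
  shows "\<exists>D :: nat \<Rightarrow> 'a set. Int_stable (range D) \<and> range D \<subseteq> Pow (space M) \<and>
    sets M = sigma_sets (space M) (range D) \<and> space M \<in> range D"
proof -
  obtain f :: "'a \<Rightarrow> real" and g where f: "f \<in> borel_measurable M" and g: "g \<in> measurable borel M"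
    and gf: "\<And>x. x \<in> space M \<Longrightarrow> g (f x) = x"
    using standard_borel_embedding[OF assms] by metis
  define C where "C a = {x \<in> space M. f x \<le> a}" for a
  let ?D = "insert (space M) (C ` \<rat>)"
  have "countable ?D" by (simp add: countable_rat)
  then obtain D :: "nat \<Rightarrow> 'a set" where D: "range D = ?D"
    using uncountable_def by (metis insert_not_empty)
  have stable: "Int_stable ?D"
  proof (rule Int_stableI)
    fix X Y assume XY: "X \<in> ?D" "Y \<in> ?D"
    have "C a \<inter> C b = C (min a b)" for a b unfolding C_def by auto
    moreover have "C a \<inter> space M = C a" "space M \<inter> C a = C a" for a unfolding C_def by auto
    moreover have "min a b \<in> \<rat>" if "a \<in> \<rat>" "b \<in> \<rat>" for a b :: real using that by (simp add: min_def)
    ultimately show "X \<inter> Y \<in> ?D" using XY by auto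
  qed
  have pow: "?D \<subseteq> Pow (space M)" unfolding C_def by auto
  have "sets M \<subseteq> sigma_sets (space M) ?D"
  proof
    let ?N = "sigma (space M) ?D"
    have sN: "sets ?N = sigma_sets (space M) ?D" "space ?N = space M" using pow by (simp_all add: sets_measure_of space_measure_of)
    have "{x \<in> space ?N. f x \<le> a} \<in> sets ?N" for a
    proof -
      have "{x \<in> space ?N. f x \<le> a} = space M \<inter> (\<Inter>q\<in>{q\<in>\<rat>. a < q}. C q)"
      proof (intro equalityI subsetI)
        fix x assume x: "x \<in> space M \<inter> (\<Inter>q\<in>{q\<in>\<rat>. a < q}. C q)"
        have "f x \<le> a"
        proof (rule ccontr)
          assume "\<not> f x \<le> a"
          then obtain q where "q \<in> \<rat>" "a < q" "q < f x" using Rats_dense_in_real[of a "f x"] by auto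
          then show False using x unfolding C_def by auto
        qed
        then show "x \<in> {x \<in> space ?N. f x \<le> a}" using x sN by simp
      next
        fix x assume "x \<in> {x \<in> space ?N. f x \<le> a}"
        then show "x \<in> space M \<inter> (\<Inter>q\<in>{q\<in>\<rat>. a < q}. C q)" using sN unfolding C_def by auto
      qed
      also have "\<dots> \<in> sets ?N"
      proof -
        obtain q :: real where "q \<in> \<rat>" "a < q" using Rats_dense_in_real[of a "a + 1"] by auto
        then have ne: "{q\<in>\<rat>. a < q} \<noteq> {}" by blast
        have cnt: "countable {q\<in>\<rat>. a < q}" by (rule countable_subset[OF _ countable_rat]) auto
        have "C q \<in> sets ?N" if "q \<in> {q\<in>\<rat>. a < q}" for q using that unfolding sN by (intro sigma_sets.Basic) auto
        then have "(\<Inter>q\<in>{q\<in>\<rat>. a < q}. C q) \<in> sets ?N" by (intro sets.countable_INT'[OF cnt ne]) blast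
        then show ?thesis using sets.top[of ?N] sN(2) by (metis sets.Int)
      qed
      finally show ?thesis .
    qed
    then have fN: "f \<in> borel_measurable ?N" by (subst borel_measurable_iff_le) simp
    fix S assume S: "S \<in> sets M"
    have "g -` S \<in> sets borel" using measurable_sets[OF g S] by simp
    then have "f -` (g -` S) \<inter> space ?N \<in> sets ?N" by (rule measurable_sets[OF fN])
    moreover have "f -` (g -` S) \<inter> space ?N = S" using gf sets.sets_into_space[OF S] sN(2) by auto
    ultimately show "S \<in> sigma_sets (space M) ?D" using sN by simp
  qed
  moreover have "sigma_sets (space M) ?D \<subseteq> sets M"
    using f unfolding C_def by (intro sets.sigma_sets_subset) auto
  ultimately show ?thesis using D stable pow by (intro exI[of _ D]) auto
qed

text \<open>Let \<open>U\<close> be a weak* limit of versions of the stepping along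
  \<open>\<rho> m\<close>. Each of these is itself a weak* limit of versions of \<open>?W\<close>; a
  version \<open>\<tau> m\<close> is picked that agrees with it up to 1 / Suc m on the rectangles
  from the first m + 1 generators. Any fixed pair of generators is eventually among these, so the
  versions along \<open>\<tau> m\<close> converge to \<open>U\<close>.\<close>

lemma env_le_stepping:
  assumes M: "prob_space M" "standard_borel M" "atomless M" and P: "finite_measurable_partition M P"
    and I: "finite I" and k: "\<kappa> \<in> measurable M (count_space I)"
    and W: "graphon M (\<lambda>x y. a (\<kappa> x) (\<kappa> y))"
  shows "env_le M (stepping M P (\<lambda>x y. a (\<kappa> x) (\<kappa> y))) (\<lambda>x y. a (\<kappa> x) (\<kappa> y))"
  unfolding env_le_def
proof
  interpret prob_space M by fact
  let ?W = "\<lambda>x y. a (\<kappa> x) (\<kappa> y)"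
  fix U assume "U \<in> envelope M (stepping M P ?W)"
  then obtain \<rho> where U: "graphon M U" and rho: "\<And>m. measure_preserving_bij M (\<rho> m)"
    and conv: "weak_star_conv M (\<lambda>m. version (stepping M P ?W) (\<rho> m)) U"
    unfolding envelope_def by auto
  obtain D :: "nat \<Rightarrow> 'a set" where D: "Int_stable (range D)" "range D \<subseteq> Pow (space M)"
    "sets M = sigma_sets (space M) (range D)" "space M \<in> range D"
    using standard_borel_countable_generator[OF M(2) not_empty] by blast
  have DM: "D i \<in> sets M" for i using D(3) by auto
  have "\<exists>\<tau>. measure_preserving_bij M \<tau> \<and> (\<forall>i\<le>m. \<forall>j\<le>m.
      \<bar>rect_integral M (version ?W \<tau>) (D i) (D j) - rect_integral M (version (stepping M P ?W) (\<rho> m)) (D i) (D j)\<bar> < 1 / Suc m)" for m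
  proof -
    \<comment> \<open>Pulling the parts back along \<open>\<rho> m\<close> makes the stepping of the
      relabelled graphon equal to the relabelled stepping.\<close>
    let ?P = "(\<lambda>A. \<rho> m -` A \<inter> space M) ` P"
    have km: "(\<lambda>x. \<kappa> (\<rho> m x)) \<in> measurable M (count_space I)"
      by (rule measurable_compose[OF measure_preserving_bijD(1)[OF rho] k])
    obtain \<pi> :: "nat \<Rightarrow> 'a \<Rightarrow> 'a" where pi: "\<And>n. measure_preserving_bij M (\<pi> n)"
      and wc: "weak_star_conv M (\<lambda>n. version (version ?W (\<rho> m)) (\<pi> n)) (stepping M ?P (version ?W (\<rho> m)))"
      using stepping_weak_limit[OF M vimage_partition[OF P rho] I km, of a m] unfolding version_def by blast
    have "\<forall>\<^sub>F n in sequentially. \<forall>i\<in>{..m}. \<forall>j\<in>{..m}.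
        \<bar>rect_integral M (version ?W (\<rho> m \<circ> \<pi> n)) (D i) (D j) - rect_integral M (version (stepping M P ?W) (\<rho> m)) (D i) (D j)\<bar> < 1 / Suc m"
    proof (intro eventually_ball_finite ballI finite_atMost)
      fix i j
      have "rect_integral M (stepping M ?P (version ?W (\<rho> m))) (D i) (D j) = rect_integral M (version (stepping M P ?W) (\<rho> m)) (D i) (D j)"
        by (rule rect_integral_cong) (rule stepping_version[OF M(1) W P rho])
      then have "(\<lambda>n. rect_integral M (version ?W (\<rho> m \<circ> \<pi> n)) (D i) (D j)) \<longlonglongrightarrow> rect_integral M (version (stepping M P ?W) (\<rho> m)) (D i) (D j)"
        using wc DM unfolding weak_star_conv_def version_comp by metis
      from tendstoD[OF this, of "1 / Suc m"]
      show "\<forall>\<^sub>F n in sequentially. \<bar>rect_integral M (version ?W (\<rho> m \<circ> \<pi> n)) (D i) (D j) -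
          rect_integral M (version (stepping M P ?W) (\<rho> m)) (D i) (D j)\<bar> < 1 / Suc m"
        by (simp add: dist_real_def)
    qed
    then obtain n where "\<forall>i\<in>{..m}. \<forall>j\<in>{..m}.
        \<bar>rect_integral M (version ?W (\<rho> m \<circ> \<pi> n)) (D i) (D j) - rect_integral M (version (stepping M P ?W) (\<rho> m)) (D i) (D j)\<bar> < 1 / Suc m"
      using eventually_happens'[OF sequentially_bot] by blast
    then show ?thesis using measure_preserving_bij_comp[OF rho pi] by (intro exI[of _ "\<rho> m \<circ> \<pi> n"]) auto
  qed
  then obtain \<tau> where tau: "\<And>m. measure_preserving_bij M (\<tau> m)"
    and close: "\<And>m i j. i \<le> m \<Longrightarrow> j \<le> m \<Longrightarrow>
      \<bar>rect_integral M (version ?W (\<tau> m)) (D i) (D j) - rect_integral M (version (stepping M P ?W) (\<rho> m)) (D i) (D j)\<bar> < 1 / Suc m"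
    by metis
  have "weak_star_conv M (\<lambda>m. version ?W (\<tau> m)) U"
  proof (rule weak_star_conv_generator[OF M(1) _ U D])
    show "graphon M (version ?W (\<tau> n))" for n
      by (rule graphon_version[OF W measure_preserving_bijD(1)[OF tau]])
    fix S T assume "S \<in> range D" "T \<in> range D"
    then obtain i j where ij: "S = D i" "T = D j" by blast
    let ?r = "\<lambda>m. rect_integral M (version (stepping M P ?W) (\<rho> m)) S T"
    have "(\<lambda>m. rect_integral M (version ?W (\<tau> m)) S T - ?r m) \<longlonglongrightarrow> 0"
    proof (rule Lim_null_comparison)
      show "(\<lambda>m. 1 / real (Suc m)) \<longlonglongrightarrow> 0" by (rule LIMSEQ_Suc[OF lim_1_over_n])
      show "\<forall>\<^sub>F m in sequentially. norm (rect_integral M (version ?W (\<tau> m)) S T - ?r m) \<le> 1 / real (Suc m)"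
        using eventually_ge_at_top[of "max i j"]
      proof eventually_elim
        case (elim m)
        then show ?case using close[of i m j] ij by simp
      qed
    qed
    moreover have "?r \<longlonglongrightarrow> rect_integral M U S T"
      using conv DM ij unfolding weak_star_conv_def by simp
    ultimately have "(\<lambda>m. (rect_integral M (version ?W (\<tau> m)) S T - ?r m) + ?r m) \<longlonglongrightarrow> 0 + rect_integral M U S T"
      by (rule tendsto_add)
    then show "(\<lambda>m. rect_integral M (version ?W (\<tau> m)) S T) \<longlonglongrightarrow> rect_integral M U S T" by simp
  qed
  then show "U \<in> envelope M ?W" using U tau unfolding envelope_def by auto
qed

section \<open>Cut distance compatibility and the step Sidorenko property\<close>

lemma hom_density_version:
  assumes M: "prob_space M" and G: "finite_simple_graph V E" and W: "graphon M W" and p: "measure_preserving_bij M \<pi>"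
  shows "hom_density M V E (version W \<pi>) = hom_density M V E W"
proof -
  interpret prob_space M by fact
  have V: "finite V" using G by (simp add: finite_simple_graph_def)
  have [measurable]: "\<pi> \<in> measurable M M" and d: "distr M M \<pi> = M"
    using p by (auto simp: measure_preserving_bij_def)
  have pp: "product_prob_space (\<lambda>_. M)" by standard
  have D: "distr (PiM V (\<lambda>_. M)) (PiM V (\<lambda>_. M)) (compose V \<pi>) = PiM V (\<lambda>_. M)"
    using distr_PiM_finite_prob_space[OF V pp pp, of \<pi>] d by simp
  have m: "compose V \<pi> \<in> measurable (PiM V (\<lambda>_. M)) (PiM V (\<lambda>_. M))"
    unfolding compose_def by measurable
  have "hom_density M V E W = (LINT x|(distr (PiM V (\<lambda>_. M)) (PiM V (\<lambda>_. M)) (compose V \<pi>)). (\<Prod>e\<in>E. edge_val W x e))"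
    unfolding D hom_density_def ..
  also have "\<dots> = (LINT x|PiM V (\<lambda>_. M). (\<Prod>e\<in>E. edge_val W (compose V \<pi> x) e))"
    using measurable_edge_val[OF G _ W] by (intro integral_distr[OF m] borel_measurable_prod) auto
  also have "\<dots> = hom_density M V E (version W \<pi>)"
    unfolding hom_density_def
  proof (intro Bochner_Integration.integral_cong refl prod.cong)
    fix x e assume "e \<in> E"
    then have "e \<subseteq> V" using G by (auto simp: finite_simple_graph_def)
    then show "edge_val W (compose V \<pi> x) e = edge_val (version W \<pi>) x e"
      unfolding version_def edge_val_map by (intro edge_val_cong) (auto simp: compose_def)
  qed
  finally show ?thesis ..
qed

text \<open>The envelope comparison is available for finite-valued graphons. Both sides of the
  inequality are continuous in \<open>L\<^sup>1\<close>, stepping being a contraction, so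
  approximation extends it to all graphons.\<close>

lemma cut_distance_compatible_imp_step_sidorenko:
  assumes M: "prob_space M" "standard_borel M" "atomless M" and G: "finite_simple_graph V E"
    and cdc: "cut_distance_compatible M (hom_density M V E)"
  shows "step_sidorenko M V E"
  unfolding step_sidorenko_def
proof (intro allI impI)
  fix W P assume W: "graphon M W" and P: "finite_measurable_partition M P"
  show "hom_density M V E (stepping M P W) \<le> hom_density M V E W"
  proof (rule field_le_epsilon)
    fix \<epsilon> :: real assume "\<epsilon> > 0"
    \<comment> \<open>Two comparisons of densities cost \<open>card E * \<delta>\<close> each; the
      added 1 covers \<open>card E = 0\<close>.\<close>
    define \<delta> where "\<delta> = \<epsilon> / (2 * (real (card E) + 1))"
    have d: "\<delta> > 0" using \<open>\<epsilon> > 0\<close> by (simp add: \<delta>_def)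
    \<comment> \<open>A single graphon is treated as a decoration with the one index
      \<open>()\<close>.\<close>
    obtain \<kappa> :: "'a \<Rightarrow> nat" and k a where k: "\<kappa> \<in> measurable M (count_space {..<k})"
      and a: "\<forall>e\<in>{()}. \<forall>i<k. \<forall>j<k. a e i j = a e j i \<and> 0 \<le> a e i j \<and> a e i j \<le> 1"
      and dist: "\<forall>e\<in>{()}. graphon_dist M W (\<lambda>x y. a e (\<kappa> x) (\<kappa> y)) < \<delta>"
      using finite_valued_approximation[of M "{()}" "\<lambda>_. W" \<delta>, OF M(1) finite.insertI[OF finite.emptyI] W d] by blast
    define U where "U = (\<lambda>x y. a () (\<kappa> x) (\<kappa> y))"
    have U: "graphon M U"
      unfolding U_def by (rule graphon_finite_valued[OF _ k]) (use a in auto)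
    have WU: "graphon_dist M W U < \<delta>" using dist unfolding U_def by simp
    note WP = graphon_stepping[OF M(1) P W] and UP = graphon_stepping[OF M(1) P U]
    have "env_le M (stepping M P U) U"
      unfolding U_def by (rule env_le_stepping[OF M P _ k]) (use U in \<open>auto simp: U_def\<close>)
    then have "hom_density M V E (stepping M P U) \<le> hom_density M V E U"
      using cdc U UP unfolding cut_distance_compatible_def by blast
    moreover have "\<bar>hom_density M V E W - hom_density M V E U\<bar> \<le> card E * \<delta>"
      using hom_density_diff[OF M(1) G W U] WU by (smt (verit) mult_left_mono of_nat_0_le_iff)
    moreover have "\<bar>hom_density M V E (stepping M P W) - hom_density M V E (stepping M P U)\<bar> \<le> card E * \<delta>"
      using hom_density_diff[OF M(1) G WP UP] graphon_dist_stepping[OF M(1) P W U] WU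
      by (smt (verit) mult_left_mono of_nat_0_le_iff)
    moreover have "2 * (card E * \<delta>) \<le> \<epsilon>"
      using \<open>\<epsilon> > 0\<close> unfolding \<delta>_def by (simp add: field_simps)
    ultimately show "hom_density M V E (stepping M P W) \<le> hom_density M V E W + \<epsilon>" by linarith
  qed
qed

text \<open>The density is not weak* continuous, so versions of \<open>W2\<close> converging to
  \<open>W1\<close> cannot be compared with \<open>W1\<close> directly. Their steppings over a fixed
  partition do converge in \<open>L\<^sup>1\<close>, and by the step Sidorenko property their
  densities are at most that of \<open>W2\<close>. Fine partitions then recover the density of
  \<open>W1\<close>.\<close>

lemma step_sidorenko_imp_cut_distance_compatible:
  assumes M: "prob_space M" and G: "finite_simple_graph V E" and ss: "step_sidorenko M V E"
  shows "cut_distance_compatible M (hom_density M V E)"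
  unfolding cut_distance_compatible_def
proof (intro allI impI)
  interpret P2: prob_space "M \<Otimes>\<^sub>M M" using M by (rule prob_space_pair_self)
  fix W1 W2 assume W1: "graphon M W1" and W2: "graphon M W2" and le: "env_le M W1 W2"
  \<comment> \<open>Constant identity relabellings put \<open>W1\<close> into its own envelope,
    hence into that of \<open>W2\<close>.\<close>
  have "W1 \<in> envelope M W1"
    unfolding envelope_def weak_star_conv_def
    using W1 measure_preserving_bij_id by (auto intro!: exI[of _ "\<lambda>_. id"] simp: version_def)
  then obtain \<pi> where p: "\<And>n. measure_preserving_bij M (\<pi> n)"
    and conv: "weak_star_conv M (\<lambda>n. version W2 (\<pi> n)) W1"
    using le unfolding env_le_def envelope_def by blast
  define \<Gamma> where "\<Gamma> n = version W2 (\<pi> n)" for n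
  have \<Gamma>: "graphon M (\<Gamma> n)" for n
    unfolding \<Gamma>_def by (rule graphon_version[OF W2 measure_preserving_bijD(1)[OF p]])
  have step: "hom_density M V E (stepping M P W1) \<le> hom_density M V E W2" if P: "finite_measurable_partition M P" for P
  proof (rule LIMSEQ_le_const2)
    have PM: "A \<in> sets M" if "A \<in> P" for A using finite_measurable_partitionD(2)[OF P] that by blast
    note sW = graphon_stepping[OF M P W1] and sG = graphon_stepping[OF M P \<Gamma>]
    \<comment> \<open>A stepping is built from finitely many rectangle integrals, so weak*
      convergence gives pointwise convergence.\<close>
    have pt: "(\<lambda>n. stepping M P (\<Gamma> n) x y) \<longlonglongrightarrow> stepping M P W1 x y" for x y
    proof -
      have "(\<lambda>n. rect_integral M (\<Gamma> n) A B) \<longlonglongrightarrow> rect_integral M W1 A B" if "A \<in> P" "B \<in> P" for A B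
        using conv PM that unfolding weak_star_conv_def \<Gamma>_def by blast
      then show ?thesis unfolding stepping_def divide_inverse
        by (intro tendsto_sum tendsto_mult tendsto_const)
    qed
    have "(\<lambda>n. graphon_dist M (stepping M P (\<Gamma> n)) (stepping M P W1)) \<longlonglongrightarrow> (LINT z|(M \<Otimes>\<^sub>M M). 0)"
      unfolding graphon_dist_def
    proof (rule integral_dominated_convergence[where w = "\<lambda>_. 1"])
      show "AE z in M \<Otimes>\<^sub>M M. (\<lambda>n. \<bar>stepping M P (\<Gamma> n) (fst z) (snd z) - stepping M P W1 (fst z) (snd z)\<bar>) \<longlonglongrightarrow> 0"
      proof (rule AE_I2)
        fix z
        from tendsto_rabs[OF tendsto_diff[OF pt[of "fst z" "snd z"] tendsto_const[of "stepping M P W1 (fst z) (snd z)"]]]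
        show "(\<lambda>n. \<bar>stepping M P (\<Gamma> n) (fst z) (snd z) - stepping M P W1 (fst z) (snd z)\<bar>) \<longlonglongrightarrow> 0" by simp
      qed
      show "AE z in M \<Otimes>\<^sub>M M. norm \<bar>stepping M P (\<Gamma> n) (fst z) (snd z) - stepping M P W1 (fst z) (snd z)\<bar> \<le> 1" for n
      proof (rule AE_I2)
        fix z assume z: "z \<in> space (M \<Otimes>\<^sub>M M)"
        show "norm \<bar>stepping M P (\<Gamma> n) (fst z) (snd z) - stepping M P W1 (fst z) (snd z)\<bar> \<le> 1"
          using graphon_pair_bounds[OF sW z] graphon_pair_bounds[OF sG[of n] z] by simp
      qed
    qed (use graphon_measurable_pair[OF sW] graphon_measurable_pair[OF sG] in \<open>auto intro!: borel_measurable_abs borel_measurable_diff\<close>)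
    then have lim: "(\<lambda>n. card E * graphon_dist M (stepping M P (\<Gamma> n)) (stepping M P W1)) \<longlonglongrightarrow> 0"
      using tendsto_mult_right_zero by fastforce
    have "(\<lambda>n. hom_density M V E (stepping M P (\<Gamma> n)) - hom_density M V E (stepping M P W1)) \<longlonglongrightarrow> 0"
      by (rule Lim_null_comparison[OF _ lim]) (use hom_density_diff[OF M G sG sW] in auto)
    then show "(\<lambda>n. hom_density M V E (stepping M P (\<Gamma> n))) \<longlonglongrightarrow> hom_density M V E (stepping M P W1)"
      by (rule LIM_zero_cancel)
    have "hom_density M V E (stepping M P (\<Gamma> n)) \<le> hom_density M V E W2" for n
      using ss \<Gamma>[of n] P hom_density_version[OF M G W2 p] unfolding step_sidorenko_def \<Gamma>_def by metis
    then show "\<exists>N. \<forall>n\<ge>N. hom_density M V E (stepping M P (\<Gamma> n)) \<le> hom_density M V E W2" by blast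
  qed
  show "hom_density M V E W1 \<le> hom_density M V E W2"
  proof (rule field_le_epsilon)
    fix \<epsilon> :: real assume "\<epsilon> > 0"
    define \<delta> where "\<delta> = \<epsilon> / (real (card E) + 1)"
    have d: "\<delta> > 0" using \<open>\<epsilon> > 0\<close> by (simp add: \<delta>_def)
    obtain Q where Q: "finite_measurable_partition M Q" and dist: "\<forall>e\<in>{()}. graphon_dist M W1 (stepping M Q W1) < \<delta>"
      using stepping_approximation[of M "{()}" "\<lambda>_. W1" \<delta>, OF M finite.insertI[OF finite.emptyI] W1 d] by blast
    have "\<bar>hom_density M V E W1 - hom_density M V E (stepping M Q W1)\<bar> \<le> card E * \<delta>"
      using hom_density_diff[OF M G W1 graphon_stepping[OF M Q W1]] dist
      by (smt (verit) mult_left_mono of_nat_0_le_iff singletonI)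
    moreover have "card E * \<delta> \<le> \<epsilon>" using \<open>\<epsilon> > 0\<close> unfolding \<delta>_def by (simp add: field_simps)
    ultimately show "hom_density M V E W1 \<le> hom_density M V E W2 + \<epsilon>" using step[OF Q] by linarith
  qed
qed

section \<open>The weak Hoelder property\<close>

lemma edge_val_sym:
  assumes "\<And>i j. i \<in> I \<Longrightarrow> j \<in> I \<Longrightarrow> a i j = a j i" "\<phi> u \<in> I" "\<phi> v \<in> I"
  shows "edge_val a \<phi> {u, v} = a (\<phi> u) (\<phi> v)"
  using assms by (intro edge_val_eq) auto

lemma edge_val_weighted_bounds:
  assumes "finite_simple_graph V E" "e \<in> E" "\<phi> \<in> V \<rightarrow>\<^sub>E I"
    and "\<And>i j. i \<in> I \<Longrightarrow> j \<in> I \<Longrightarrow> a i j = a j i \<and> 0 \<le> a i j \<and> a i j \<le> (1 :: real)"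
  shows "0 \<le> edge_val a \<phi> e" "edge_val a \<phi> e \<le> 1"
proof -
  obtain u v where uv: "u \<in> V" "v \<in> V" "e = {u, v}" using graph_edgeE[OF assms(1,2)] .
  then have "\<phi> u \<in> I" "\<phi> v \<in> I" using assms(3) by auto
  then show "0 \<le> edge_val a \<phi> e" "edge_val a \<phi> e \<le> 1"
    using edge_val_sym[of I a \<phi> u v] assms(4) uv by auto
qed

lemma weighted_hom_cong:
  assumes "\<And>i. i \<in> I \<Longrightarrow> p i = p' i"
  shows "weighted_hom V E I p a = weighted_hom V E I p' a"
  unfolding weighted_hom_def
  by (intro sum.cong refl arg_cong2[where f = "(*)"] prod.cong) (auto intro!: assms)

lemma hom_density_cong:
  assumes G: "finite_simple_graph V E" and U: "graphon M U"
    and eq: "\<And>x y. x \<in> space M \<Longrightarrow> y \<in> space M \<Longrightarrow> U x y = W x y"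
  shows "hom_density M V E U = hom_density M V E W"
  unfolding hom_density_def
proof (intro Bochner_Integration.integral_cong refl prod.cong)
  fix x e assume x: "x \<in> space (PiM V (\<lambda>_. M))" and e: "e \<in> E"
  obtain u v where uv: "u \<in> V" "v \<in> V" "e = {u, v}" using graph_edgeE[OF G e] .
  then have xs: "x u \<in> space M" "x v \<in> space M" using x by (auto simp: space_PiM)
  have "edge_val U x e = U (x u) (x v)" unfolding uv(3) by (rule graphon_edge_val[of M U x u v, OF U xs])
  moreover have "edge_val W x e = W (x u) (x v)"
    unfolding uv(3) using U xs eq[OF xs] eq[OF xs(2,1)] by (intro edge_val_eq) (auto simp: graphon_def)
  ultimately show "edge_val U x e = edge_val W x e" using eq[OF xs] by simp
qed

lemma weighted_hom_nonneg:
  assumes "finite_simple_graph V E" "\<And>i. i \<in> I \<Longrightarrow> 0 \<le> p i"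
    and "\<And>e i j. e \<in> E \<Longrightarrow> i \<in> I \<Longrightarrow> j \<in> I \<Longrightarrow> a e i j = a e j i \<and> 0 \<le> a e i j \<and> a e i j \<le> (1 :: real)"
  shows "0 \<le> weighted_hom V E I p a"
  unfolding weighted_hom_def
proof (intro sum_nonneg mult_nonneg_nonneg prod_nonneg ballI)
  fix \<phi> e assume "\<phi> \<in> V \<rightarrow>\<^sub>E I" "e \<in> E"
  then show "0 \<le> edge_val (a e) \<phi> e" using edge_val_weighted_bounds(1)[OF assms(1), of e \<phi> I "a e"] assms(3) by blast
qed (use assms(2) in auto)

text \<open>The block graphon: \<open>c e * a e\<close> on the diagonal block of the edge \<open>e\<close>, and \<open>0\<close> off the diagonal
  blocks. A homomorphism of positive weight stays within one block, by connectedness.\<close>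

definition block_matrix :: "('e \<Rightarrow> real) \<Rightarrow> ('e \<Rightarrow> 'i \<Rightarrow> 'i \<Rightarrow> real) \<Rightarrow> 'i \<times> 'e \<Rightarrow> 'i \<times> 'e \<Rightarrow> real" where
  "block_matrix c a s t = (if snd s = snd t then c (snd s) * a (snd s) (fst s) (fst t) else 0)"

text \<open>A surviving map amounts to a map into \<open>I\<close> together with the block of one
  edge \<open>e\<close>. Every edge of H then contributes a factor \<open>c e\<close>, whence
  \<open>c e ^ card E\<close>. The divisors \<open>m\<close> in the vertex weights are estimated
  away by 1; a constant is harmless, since tensoring removes it later.\<close>

lemma weighted_hom_block_le:
  fixes a :: "'v set \<Rightarrow> 'i \<Rightarrow> 'i \<Rightarrow> real"
  assumes G: "finite_simple_graph V E" and conn: "connected_graph V E" and I: "finite I"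
    and p: "\<And>i. i \<in> I \<Longrightarrow> 0 \<le> p i"
    and a: "\<And>e i j. e \<in> E \<Longrightarrow> i \<in> I \<Longrightarrow> j \<in> I \<Longrightarrow> a e i j = a e j i \<and> 0 \<le> a e i j \<and> a e i j \<le> 1"
    and c: "\<And>e. e \<in> E \<Longrightarrow> 0 \<le> c e" and m: "real m \<ge> 1"
  shows "weighted_hom V E (I \<times> E) (\<lambda>s. p (fst s) / real m) (\<lambda>_. block_matrix c a) \<le>
    (\<Sum>e\<in>E. c e ^ card E * weighted_hom V E I p (\<lambda>_. a e))"
proof -
  let ?b = "block_matrix c a"
  define T where "T \<Phi> = (\<Prod>v\<in>V. p (fst (\<Phi> v)) / real m) * (\<Prod>e\<in>E. edge_val ?b \<Phi> e)" for \<Phi>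
  define emb where "emb r = restrict (\<lambda>v. (snd r v, fst r)) V" for r :: "'v set \<times> ('v \<Rightarrow> 'i)"
  have V: "finite V" and E: "finite E" using G finite_edges[OF G] by (auto simp: finite_simple_graph_def)
  have bsym: "?b s t = ?b t s" if "s \<in> I \<times> E" "t \<in> I \<times> E" for s t
    using that a unfolding block_matrix_def by auto
  have ev: "edge_val ?b \<Phi> {u, v} = ?b (\<Phi> u) (\<Phi> v)" if "\<Phi> \<in> V \<rightarrow>\<^sub>E I \<times> E" "u \<in> V" "v \<in> V" for \<Phi> u v
    by (rule edge_val_sym[of "I \<times> E", OF bsym]) (use that in auto)
  have fin: "finite (V \<rightarrow>\<^sub>E I \<times> E)" using V I E by (intro finite_PiE) auto
  have sub: "emb ` (E \<times> (V \<rightarrow>\<^sub>E I)) \<subseteq> V \<rightarrow>\<^sub>E I \<times> E" unfolding emb_def by auto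
  have zero: "T \<Phi> = 0" if \<Phi>: "\<Phi> \<in> (V \<rightarrow>\<^sub>E I \<times> E) - emb ` (E \<times> (V \<rightarrow>\<^sub>E I))" for \<Phi>
  proof (rule ccontr)
    assume "T \<Phi> \<noteq> 0"
    then have nz: "edge_val ?b \<Phi> e \<noteq> 0" if "e \<in> E" for e using that E unfolding T_def by auto
    have edge: "snd (\<Phi> u) = snd (\<Phi> v)" if "{u, v} \<in> E" for u v
    proof -
      have "u \<in> V" "v \<in> V" using that G by (auto simp: finite_simple_graph_def)
      then show ?thesis using nz[OF that] ev[of \<Phi> u v] \<Phi> unfolding block_matrix_def by (auto split: if_splits)
    qed
    have path: "snd (\<Phi> u) = snd (\<Phi> v)" if "(u, v) \<in> {(a, b). {a, b} \<in> E}\<^sup>*" for u v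
      using that by (induction rule: rtrancl_induct) (auto simp: edge)
    obtain v0 where v0: "v0 \<in> V" using conn by (auto simp: connected_graph_def)
    have const: "snd (\<Phi> v) = snd (\<Phi> v0)" if "v \<in> V" for v
      using path[of v v0] conn that v0 by (auto simp: connected_graph_def)
    have "\<Phi> = emb (snd (\<Phi> v0), restrict (\<lambda>v. fst (\<Phi> v)) V)"
    proof
      fix v show "\<Phi> v = emb (snd (\<Phi> v0), restrict (\<lambda>v. fst (\<Phi> v)) V) v"
        using const[of v] \<Phi> by (cases "v \<in> V") (auto simp: emb_def prod_eq_iff PiE_def extensional_def)
    qed
    moreover have "(snd (\<Phi> v0), restrict (\<lambda>v. fst (\<Phi> v)) V) \<in> E \<times> (V \<rightarrow>\<^sub>E I)"
      using \<Phi> v0 by (auto simp: PiE_iff mem_Times_iff)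
    ultimately show False using \<Phi> by blast
  qed
  \<comment> \<open>The block can be read off at any vertex, and \<open>connected_graph\<close>
    provides one.\<close>
  have inj: "inj_on emb (E \<times> (V \<rightarrow>\<^sub>E I))"
  proof (rule inj_onI)
    fix r r' assume r: "r \<in> E \<times> (V \<rightarrow>\<^sub>E I)" "r' \<in> E \<times> (V \<rightarrow>\<^sub>E I)" "emb r = emb r'"
    obtain v0 where v0: "v0 \<in> V" using conn by (auto simp: connected_graph_def)
    have *: "snd r v = snd r' v \<and> fst r = fst r'" if "v \<in> V" for v
      using fun_cong[OF r(3), of v] that by (simp add: emb_def)
    have "snd r = snd r'" by (rule PiE_ext[of _ V "\<lambda>_. I"]) (use r * in auto)
    then show "r = r'" using * v0 by (auto simp: prod_eq_iff)
  qed
  have le: "T (emb (e0, \<phi>)) \<le> c e0 ^ card E * ((\<Prod>v\<in>V. p (\<phi> v)) * (\<Prod>e\<in>E. edge_val (a e0) \<phi> e))"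
    if e0: "e0 \<in> E" and phi: "\<phi> \<in> V \<rightarrow>\<^sub>E I" for e0 \<phi>
  proof -
    have 1: "edge_val ?b (emb (e0, \<phi>)) e = c e0 * edge_val (a e0) \<phi> e" if e: "e \<in> E" for e
    proof -
      obtain u v where uv: "u \<in> V" "v \<in> V" "e = {u, v}" using graph_edgeE[OF G e] .
      have "edge_val ?b (emb (e0, \<phi>)) e = ?b (emb (e0, \<phi>) u) (emb (e0, \<phi>) v)"
        unfolding uv(3) by (rule ev[OF _ uv(1,2)]) (use sub e0 phi in blast)
      also have "\<dots> = c e0 * a e0 (\<phi> u) (\<phi> v)" using uv by (simp add: emb_def block_matrix_def)
      also have "a e0 (\<phi> u) (\<phi> v) = edge_val (a e0) \<phi> e"
        unfolding uv(3) by (rule edge_val_sym[of I, symmetric]) (use a e0 phi uv in auto)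
      finally show ?thesis .
    qed
    have nn: "0 \<le> (\<Prod>e\<in>E. edge_val ?b (emb (e0, \<phi>)) e)"
      using edge_val_weighted_bounds(1)[OF G _ phi, of _ "a e0"] a e0 c
      by (intro prod_nonneg ballI) (simp add: 1)
    have "(\<Prod>v\<in>V. p (fst (emb (e0, \<phi>) v)) / real m) \<le> (\<Prod>v\<in>V. p (\<phi> v))"
    proof (rule prod_mono)
      fix v assume v: "v \<in> V"
      then have "0 \<le> p (\<phi> v)" using p phi by auto
      then have "p (\<phi> v) / real m \<le> p (\<phi> v) / 1" using m by (intro divide_left_mono) auto
      then show "0 \<le> p (fst (emb (e0, \<phi>) v)) / real m \<and> p (fst (emb (e0, \<phi>) v)) / real m \<le> p (\<phi> v)"
        using \<open>0 \<le> p (\<phi> v)\<close> v by (simp add: emb_def)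
    qed
    then have "T (emb (e0, \<phi>)) \<le> (\<Prod>v\<in>V. p (\<phi> v)) * (\<Prod>e\<in>E. edge_val ?b (emb (e0, \<phi>)) e)"
      unfolding T_def using nn by (rule mult_right_mono)
    also have "(\<Prod>e\<in>E. edge_val ?b (emb (e0, \<phi>)) e) = c e0 ^ card E * (\<Prod>e\<in>E. edge_val (a e0) \<phi> e)"
      by (simp add: 1 prod.distrib)
    finally show ?thesis by (simp add: mult_ac)
  qed
  have "weighted_hom V E (I \<times> E) (\<lambda>s. p (fst s) / real m) (\<lambda>_. ?b) = (\<Sum>\<Phi>\<in>V \<rightarrow>\<^sub>E I \<times> E. T \<Phi>)"
    unfolding weighted_hom_def T_def ..
  also have "\<dots> = (\<Sum>\<Phi>\<in>emb ` (E \<times> (V \<rightarrow>\<^sub>E I)). T \<Phi>)"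
    by (rule sum.mono_neutral_right[OF fin sub]) (use zero in blast)
  also have "\<dots> = (\<Sum>r\<in>E \<times> (V \<rightarrow>\<^sub>E I). T (emb r))" by (simp add: sum.reindex[OF inj])
  also have "\<dots> = (\<Sum>e\<in>E. \<Sum>\<phi>\<in>V \<rightarrow>\<^sub>E I. T (emb (e, \<phi>)))" by (simp add: sum.cartesian_product)
  also have "\<dots> \<le> (\<Sum>e\<in>E. \<Sum>\<phi>\<in>V \<rightarrow>\<^sub>E I. c e ^ card E * ((\<Prod>v\<in>V. p (\<phi> v)) * (\<Prod>e'\<in>E. edge_val (a e) \<phi> e')))"
    by (intro sum_mono le)
  also have "\<dots> = (\<Sum>e\<in>E. c e ^ card E * weighted_hom V E I p (\<lambda>_. a e))"
    unfolding weighted_hom_def by (simp add: sum_distrib_left)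
  finally show ?thesis .
qed

text \<open>Stepping merges the blocks: the averaged graphon is \<open>(\<Sum>e\<in>E. c e * a e) / m\<^sup>2\<close>, and the choice
  of the summand \<open>e\<close> at every edge \<open>e\<close> is one of the terms of its density.\<close>

lemma block_inequality_bounded:
  fixes a :: "'v set \<Rightarrow> 'i \<Rightarrow> 'i \<Rightarrow> real"
  assumes M: "prob_space M" "standard_borel M" "atomless M"
    and G: "finite_simple_graph V E" and conn: "connected_graph V E" and ss: "step_sidorenko M V E"
    and E0: "E \<noteq> {}" and I: "finite I"
    and p: "\<And>i. i \<in> I \<Longrightarrow> 0 \<le> p i" "sum p I = 1"
    and a: "\<And>e i j. e \<in> E \<Longrightarrow> i \<in> I \<Longrightarrow> j \<in> I \<Longrightarrow> a e i j = a e j i \<and> 0 \<le> a e i j \<and> a e i j \<le> 1"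
    and c: "\<And>e. e \<in> E \<Longrightarrow> 0 \<le> c e \<and> c e \<le> 1"
  shows "weighted_hom V E I p a * (\<Prod>e\<in>E. c e) \<le>
    (real (card E))\<^sup>2 ^ card E * (\<Sum>e\<in>E. c e ^ card E * weighted_hom V E I p (\<lambda>_. a e))"
proof -
  interpret prob_space M by fact
  have V: "finite V" and E: "finite E" using G finite_edges[OF G] by (auto simp: finite_simple_graph_def)
  define m where "m = card E"
  have m: "real m \<ge> 1" using E E0 unfolding m_def by (simp add: Suc_le_eq card_gt_0_iff)
  let ?J = "I \<times> E" and ?b = "block_matrix c a"
  \<comment> \<open>Each weight \<open>p i\<close> is shared equally by the \<open>card E\<close>
    copies of \<open>i\<close>, one in every block.\<close>
  let ?q = "\<lambda>s. p (fst s) / real m"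
  have J: "finite ?J" using I E by simp
  have "sum ?q ?J = (\<Sum>i\<in>I. \<Sum>e\<in>E. p i / real m)"
    unfolding sum.cartesian_product by (simp add: case_prod_beta)
  also have "\<dots> = (\<Sum>i\<in>I. p i)" using m by (simp add: m_def)
  finally have sq: "sum ?q ?J = 1" using p(2) by simp
  have "0 \<le> ?q s" if "s \<in> ?J" for s using p(1) that by auto
  from exists_finite_valued_map[OF M J this sq] obtain \<kappa> where k: "\<kappa> \<in> measurable M (count_space ?J)"
    and mk: "\<And>s. s \<in> ?J \<Longrightarrow> measure M (\<kappa> -` {s} \<inter> space M) = ?q s"
    by blast
  have kJ: "\<kappa> x \<in> ?J" if "x \<in> space M" for x using measurable_space[OF k that] by simp
  have b: "?b s t = ?b t s \<and> 0 \<le> ?b s t \<and> ?b s t \<le> 1" if "s \<in> ?J" "t \<in> ?J" for s t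
    using that a c unfolding block_matrix_def by (auto intro!: mult_le_one)
  define W where "W x y = ?b (\<kappa> x) (\<kappa> y)" for x y
  have W: "graphon M W" unfolding W_def by (rule graphon_finite_valued[OF J k b])
  have tW: "hom_density M V E W = weighted_hom V E ?J ?q (\<lambda>_. ?b)"
    unfolding W_def hom_density_finite_valued[OF M(1) G J k] by (rule weighted_hom_cong) (rule mk)
  \<comment> \<open>All copies of \<open>i\<close> together; stepping over these sets is what merges
    the blocks.\<close>
  define K where "K i = {x \<in> space M. fst (\<kappa> x) = i}" for i
  have K_eq: "K i = (\<Union>e\<in>E. \<kappa> -` {(i, e)} \<inter> space M)" for i
    unfolding K_def using kJ by (auto simp: mem_Times_iff prod_eq_iff)
  have KM: "K i \<in> sets M" if "i \<in> I" for i
    unfolding K_eq using that by (intro sets.finite_UN E vimage_count_space_sets[OF k]) auto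
  have mK: "measure M (K i) = p i" if "i \<in> I" for i
  proof -
    have "measure M (K i) = (\<Sum>e\<in>E. measure M (\<kappa> -` {(i, e)} \<inter> space M))"
      unfolding K_eq using that vimage_count_space_sets[OF k]
      by (intro finite_measure_finite_Union E) (auto simp: disjoint_family_on_def)
    also have "\<dots> = p i" using that m by (simp add: mk m_def)
    finally show ?thesis .
  qed
  have k1: "(\<lambda>x. fst (\<kappa> x)) \<in> measurable M (count_space I)"
  proof (subst measurable_count_space_eq2[OF I], intro conjI ballI)
    show "(\<lambda>x. fst (\<kappa> x)) \<in> space M \<rightarrow> I" using kJ by (auto simp: mem_Times_iff)
    fix i assume "i \<in> I"
    moreover have "(\<lambda>x. fst (\<kappa> x)) -` {i} \<inter> space M = K i" unfolding K_def by auto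
    ultimately show "(\<lambda>x. fst (\<kappa> x)) -` {i} \<inter> space M \<in> sets M" using KM by simp
  qed
  \<comment> \<open>A type of weight 0 may be taken by no point at all, and partitions have no empty
    parts.\<close>
  define P where "P = K ` I - {{}}"
  have P: "finite_measurable_partition M P"
    unfolding finite_measurable_partition_def
  proof (intro conjI)
    show "partition_on (space M) P"
      unfolding P_def using kJ by (intro partition_onI) (auto simp: K_def disjnt_def mem_Times_iff)
  qed (use I KM in \<open>auto simp: P_def\<close>)
  \<comment> \<open>If \<open>p i\<close> or \<open>p j\<close> is 0, this value is 0 by division by
    zero; maps through such types are treated separately below.\<close>
  define s where "s i j = rect_integral M W (K i) (K j) / (p i * p j)" for i j
  have s_sym: "s i j = s j i" if "i \<in> I" "j \<in> I" for i j
    unfolding s_def using rect_integral_sym[OF M(1) W KM[OF that(1)] KM[OF that(2)]] by (simp add: mult.commute)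
  have st: "stepping M P W x y = s (fst (\<kappa> x)) (fst (\<kappa> y))" if "x \<in> space M" "y \<in> space M" for x y
  proof -
    have i: "fst (\<kappa> x) \<in> I" "fst (\<kappa> y) \<in> I" using kJ that by (auto simp: mem_Times_iff)
    have x: "x \<in> K (fst (\<kappa> x))" "y \<in> K (fst (\<kappa> y))" using that unfolding K_def by auto
    then have "K (fst (\<kappa> x)) \<in> P" "K (fst (\<kappa> y)) \<in> P" unfolding P_def using i by auto
    then show ?thesis using stepping_eq[OF P _ x(1) _ x(2)] by (simp add: s_def mK i)
  qed
  have tS: "hom_density M V E (stepping M P W) = weighted_hom V E I p (\<lambda>_. s)"
  proof -
    have "hom_density M V E (stepping M P W) = hom_density M V E (\<lambda>x y. s (fst (\<kappa> x)) (fst (\<kappa> y)))"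
      by (rule hom_density_cong[OF G graphon_stepping[OF M(1) P W] st])
    also have "\<dots> = weighted_hom V E I (\<lambda>i. measure M ((\<lambda>x. fst (\<kappa> x)) -` {i} \<inter> space M)) (\<lambda>_. s)"
      by (rule hom_density_finite_valued[OF M(1) G I k1])
    also have "\<dots> = weighted_hom V E I p (\<lambda>_. s)"
    proof (rule weighted_hom_cong)
      fix i assume "i \<in> I"
      moreover have "(\<lambda>x. fst (\<kappa> x)) -` {i} \<inter> space M = K i" unfolding K_def by auto
      ultimately show "measure M ((\<lambda>x. fst (\<kappa> x)) -` {i} \<inter> space M) = p i" using mK by simp
    qed
    finally show ?thesis .
  qed
  \<comment> \<open>The \<open>m^2\<close> pairs of blocks inside \<open>K i \<times> K j\<close>
    have equal weight \<open>p i * p j / m^2\<close>, and only the diagonal ones carry a nonzero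
    value.\<close>
  have s_eq: "s i j = (\<Sum>e\<in>E. c e * a e i j) / (real m)\<^sup>2" if i: "i \<in> I" "j \<in> I" and pos: "p i \<noteq> 0" "p j \<noteq> 0" for i j
  proof -
    have SJ: "(\<Sum>s\<in>?J. f s) = (\<Sum>i\<in>I. \<Sum>e\<in>E. f (i, e))" for f :: "'i \<times> 'v set \<Rightarrow> real"
      by (simp add: sum.cartesian_product)
    have mKs: "measure M (K i \<inter> \<kappa> -` {s}) = (if fst s = i then p i / real m else 0)" if "s \<in> ?J" for i s
    proof (cases "fst s = i")
      case True
      then have "K i \<inter> \<kappa> -` {s} = \<kappa> -` {s} \<inter> space M" unfolding K_def by auto
      then show ?thesis using mk[OF that] True by simp
    next
      case False
      then have "K i \<inter> \<kappa> -` {s} = {}" unfolding K_def by auto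
      then show ?thesis using False by simp
    qed
    have "rect_integral M W (K i) (K j) = (\<Sum>s\<in>?J. \<Sum>t\<in>?J. ?b s t * (measure M (K i \<inter> \<kappa> -` {s}) * measure M (K j \<inter> \<kappa> -` {t})))"
      unfolding W_def by (rule rect_integral_finite_valued[OF M(1) J k KM[OF i(1)] KM[OF i(2)]])
    also have "\<dots> = (\<Sum>s\<in>?J. \<Sum>t\<in>?J. if fst s = i then if fst t = j then ?b s t * (p i / real m * (p j / real m)) else 0 else 0)"
      by (intro sum.cong refl) (simp add: mKs)
    also have "\<dots> = (\<Sum>i'\<in>I. \<Sum>e\<in>E. \<Sum>j'\<in>I. \<Sum>e'\<in>E. if i' = i then if j' = j then ?b (i', e) (j', e') * (p i / real m * (p j / real m)) else 0 else 0)"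
      unfolding SJ fst_conv ..
    also have "\<dots> = (\<Sum>i'\<in>I. if i' = i then (\<Sum>e\<in>E. \<Sum>j'\<in>I. if j' = j then (\<Sum>e'\<in>E. ?b (i', e) (j', e') * (p i / real m * (p j / real m))) else 0) else 0)"
      by (intro sum.cong refl) (auto intro!: sum.cong)
    also have "\<dots> = (\<Sum>e\<in>E. \<Sum>e'\<in>E. ?b (i, e) (j, e') * (p i / real m * (p j / real m)))"
      using i I by simp
    also have "\<dots> = (\<Sum>e\<in>E. \<Sum>e'\<in>E. if e' = e then c e * a e i j * (p i / real m * (p j / real m)) else 0)"
      by (intro sum.cong refl) (auto simp: block_matrix_def)
    also have "\<dots> = (\<Sum>e\<in>E. c e * a e i j) * (p i / real m * (p j / real m))"
      unfolding sum_distrib_right by (intro sum.cong refl) (use E in simp)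
    finally show ?thesis unfolding s_def using pos m by (simp add: power2_eq_square)
  qed
  have lower: "weighted_hom V E I p a * (\<Prod>e\<in>E. c e) / (real m)\<^sup>2 ^ m \<le> weighted_hom V E I p (\<lambda>_. s)"
  proof -
    have "weighted_hom V E I p a * (\<Prod>e\<in>E. c e) / (real m)\<^sup>2 ^ m =
        (\<Sum>\<phi>\<in>V \<rightarrow>\<^sub>E I. (\<Prod>v\<in>V. p (\<phi> v)) * (\<Prod>e\<in>E. c e * edge_val (a e) \<phi> e / (real m)\<^sup>2))"
      unfolding weighted_hom_def sum_distrib_right sum_divide_distrib
      by (intro sum.cong refl) (simp add: prod_dividef prod.distrib m_def mult_ac)
    also have "\<dots> \<le> (\<Sum>\<phi>\<in>V \<rightarrow>\<^sub>E I. (\<Prod>v\<in>V. p (\<phi> v)) * (\<Prod>e\<in>E. edge_val s \<phi> e))"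
    proof (rule sum_mono)
      fix \<phi> assume phi: "\<phi> \<in> V \<rightarrow>\<^sub>E I"
      have pn: "0 \<le> (\<Prod>v\<in>V. p (\<phi> v))" using p(1) phi by (intro prod_nonneg) auto
      show "(\<Prod>v\<in>V. p (\<phi> v)) * (\<Prod>e\<in>E. c e * edge_val (a e) \<phi> e / (real m)\<^sup>2) \<le> (\<Prod>v\<in>V. p (\<phi> v)) * (\<Prod>e\<in>E. edge_val s \<phi> e)"
      \<comment> \<open>A map through a type of weight 0 contributes nothing to either side; for all
        other maps the formula for \<open>s\<close> applies at every edge.\<close>
      proof (cases "\<exists>v\<in>V. p (\<phi> v) = 0")
        case True
        then have "(\<Prod>v\<in>V. p (\<phi> v)) = 0" using V by auto
        then show ?thesis by simp
      next
        case False
        show ?thesis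
        proof (intro mult_left_mono[OF _ pn] prod_mono conjI)
          fix e assume e: "e \<in> E"
          obtain u v where uv: "u \<in> V" "v \<in> V" "e = {u, v}" using graph_edgeE[OF G e] .
          have I': "\<phi> u \<in> I" "\<phi> v \<in> I" using phi uv by auto
          have ae: "edge_val (a e) \<phi> e = a e (\<phi> u) (\<phi> v)"
            unfolding uv(3) by (rule edge_val_sym[of I]) (use a e I' uv(3) in auto)
          have "edge_val s \<phi> e = s (\<phi> u) (\<phi> v)"
            unfolding uv(3) by (rule edge_val_sym[of I s \<phi> u v, OF s_sym I'])
          also have "\<dots> = (\<Sum>e'\<in>E. c e' * a e' (\<phi> u) (\<phi> v)) / (real m)\<^sup>2"
            by (rule s_eq[OF I']) (use False uv in auto)
          finally have se: "edge_val s \<phi> e = (\<Sum>e'\<in>E. c e' * a e' (\<phi> u) (\<phi> v)) / (real m)\<^sup>2" .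
          have "c e * a e (\<phi> u) (\<phi> v) \<le> (\<Sum>e'\<in>E. c e' * a e' (\<phi> u) (\<phi> v))"
            by (rule member_le_sum[OF e _ E, where f = "\<lambda>e'. c e' * a e' (\<phi> u) (\<phi> v)"]) (use a c I' in auto)
          then show "c e * edge_val (a e) \<phi> e / (real m)\<^sup>2 \<le> edge_val s \<phi> e"
            unfolding ae se by (rule divide_right_mono) simp
          show "0 \<le> c e * edge_val (a e) \<phi> e / (real m)\<^sup>2"
            unfolding ae using a c I' e by simp
        qed
      qed
    qed
    finally show ?thesis unfolding weighted_hom_def .
  qed
  have "weighted_hom V E I p (\<lambda>_. s) \<le> weighted_hom V E ?J ?q (\<lambda>_. ?b)"
    using ss W P unfolding step_sidorenko_def tW[symmetric] tS[symmetric] by blast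
  also have "\<dots> \<le> (\<Sum>e\<in>E. c e ^ card E * weighted_hom V E I p (\<lambda>_. a e))"
    by (rule weighted_hom_block_le[OF G conn I p(1) a _ m]) (use c in auto)
  finally have "weighted_hom V E I p a * (\<Prod>e\<in>E. c e) / (real m)\<^sup>2 ^ m \<le> (\<Sum>e\<in>E. c e ^ card E * weighted_hom V E I p (\<lambda>_. a e))"
    using lower by linarith
  then show ?thesis using m by (simp add: divide_le_eq m_def mult.commute)
qed

text \<open>Both sides are homogeneous of degree \<open>card E\<close> in \<open>c\<close>. Dividing
  all coefficients by a common bound makes the block matrix [0,1]-valued, so that it defines a
  graphon, and the scale cancels.\<close>

lemma block_inequality:
  fixes a :: "'v set \<Rightarrow> 'i \<Rightarrow> 'i \<Rightarrow> real"
  assumes M: "prob_space M" "standard_borel M" "atomless M"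
    and G: "finite_simple_graph V E" and conn: "connected_graph V E" and ss: "step_sidorenko M V E"
    and E0: "E \<noteq> {}" and I: "finite I"
    and p: "\<And>i. i \<in> I \<Longrightarrow> 0 \<le> p i" "sum p I = 1"
    and a: "\<And>e i j. e \<in> E \<Longrightarrow> i \<in> I \<Longrightarrow> j \<in> I \<Longrightarrow> a e i j = a e j i \<and> 0 \<le> a e i j \<and> a e i j \<le> 1"
    and c: "\<And>e. e \<in> E \<Longrightarrow> 0 \<le> c e"
  shows "weighted_hom V E I p a * (\<Prod>e\<in>E. c e) \<le>
    (real (card E))\<^sup>2 ^ card E * (\<Sum>e\<in>E. c e ^ card E * weighted_hom V E I p (\<lambda>_. a e))"
proof -
  have E: "finite E" by (rule finite_edges[OF G])
  define C where "C = 1 + sum c E"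
  have C: "C > 0" "\<And>e. e \<in> E \<Longrightarrow> c e \<le> C"
    using sum_nonneg[of E c] c member_le_sum[of _ E c] E unfolding C_def by (auto intro: add_increasing add_pos_nonneg)
  have "weighted_hom V E I p a * (\<Prod>e\<in>E. c e / C) \<le>
    (real (card E))\<^sup>2 ^ card E * (\<Sum>e\<in>E. (c e / C) ^ card E * weighted_hom V E I p (\<lambda>_. a e))"
    by (rule block_inequality_bounded[OF M G conn ss E0 I p a]) (use c C in \<open>auto simp: divide_le_eq_1\<close>)
  also have "(\<Prod>e\<in>E. c e / C) = (\<Prod>e\<in>E. c e) / C ^ card E" by (simp add: prod_dividef)
  also have "(\<Sum>e\<in>E. (c e / C) ^ card E * weighted_hom V E I p (\<lambda>_. a e)) =
      (\<Sum>e\<in>E. c e ^ card E * weighted_hom V E I p (\<lambda>_. a e)) / C ^ card E"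
    by (simp add: power_divide sum_divide_distrib)
  finally have "(weighted_hom V E I p a * (\<Prod>e\<in>E. c e)) / C ^ card E \<le>
      ((real (card E))\<^sup>2 ^ card E * (\<Sum>e\<in>E. c e ^ card E * weighted_hom V E I p (\<lambda>_. a e))) / C ^ card E"
    by simp
  then show ?thesis using C(1) by (simp add: divide_le_cancel zero_less_power not_less)
qed

text \<open>The weights \<open>c e = (t\<^sub>e + \<delta>) powr (-1/m)\<close> balance the terms on the right of the block
  inequality.\<close>

lemma weak_hoelder_up_to_constant:
  fixes a :: "'v set \<Rightarrow> 'i \<Rightarrow> 'i \<Rightarrow> real"
  assumes M: "prob_space M" "standard_borel M" "atomless M"
    and G: "finite_simple_graph V E" and conn: "connected_graph V E" and ss: "step_sidorenko M V E"
    and E0: "E \<noteq> {}" and I: "finite I"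
    and p: "\<And>i. i \<in> I \<Longrightarrow> 0 \<le> p i" "sum p I = 1"
    and a: "\<And>e i j. e \<in> E \<Longrightarrow> i \<in> I \<Longrightarrow> j \<in> I \<Longrightarrow> a e i j = a e j i \<and> 0 \<le> a e i j \<and> a e i j \<le> 1"
  shows "weighted_hom V E I p a ^ card E \<le>
    ((real (card E))\<^sup>2 ^ card E * card E) ^ card E * (\<Prod>e\<in>E. weighted_hom V E I p (\<lambda>_. a e))"
proof -
  have E: "finite E" by (rule finite_edges[OF G])
  define m where "m = card E"
  have m: "m > 0" using E E0 unfolding m_def by (simp add: card_gt_0_iff)
  define B where "B = (real m)\<^sup>2 ^ m"
  have B: "B \<ge> 0" unfolding B_def by simp
  define t where "t e = weighted_hom V E I p (\<lambda>_. a e)" for e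
  have t: "t e \<ge> 0" if "e \<in> E" for e
    unfolding t_def by (rule weighted_hom_nonneg[OF G p(1)]) (use a that in auto)
  have a0: "0 \<le> weighted_hom V E I p a" by (rule weighted_hom_nonneg[OF G p(1) a])
  \<comment> \<open>The shift \<open>\<delta>\<close> keeps the weights defined when some
    \<open>t e\<close> is 0. Each term on the right becomes at most 1, so the sum is at most
    \<open>m\<close>; at the end \<open>\<delta>\<close> tends to 0.\<close>
  have main: "weighted_hom V E I p a ^ m \<le> (B * m) ^ m * (\<Prod>e\<in>E. t e + \<delta>)" if d: "\<delta> > 0" for \<delta>
  proof -
    define c where "c e = root m (1 / (t e + \<delta>))" for e
    have c: "c e ^ m = 1 / (t e + \<delta>)" "0 \<le> c e" if "e \<in> E" for e
      unfolding c_def using t[OF that] d m by (auto intro!: real_root_pow_pos2)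
    have "weighted_hom V E I p a * (\<Prod>e\<in>E. c e) \<le> B * (\<Sum>e\<in>E. c e ^ m * t e)"
      unfolding B_def m_def t_def by (rule block_inequality[OF M G conn ss E0 I p a]) (use c in auto)
    also have "(\<Sum>e\<in>E. c e ^ m * t e) \<le> (\<Sum>e\<in>E. 1)"
    proof (rule sum_mono)
      fix e assume e: "e \<in> E"
      show "c e ^ m * t e \<le> 1" unfolding c(1)[OF e] using t[OF e] d by (simp add: divide_le_eq_1)
    qed
    finally have "weighted_hom V E I p a * (\<Prod>e\<in>E. c e) \<le> B * m"
      using B by (simp add: m_def mult_left_mono)
    then have "(weighted_hom V E I p a * (\<Prod>e\<in>E. c e)) ^ m \<le> (B * m) ^ m"
      using a0 c(2) by (intro power_mono mult_nonneg_nonneg prod_nonneg) auto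
    moreover have "(\<Prod>e\<in>E. c e) ^ m = 1 / (\<Prod>e\<in>E. t e + \<delta>)"
      by (simp add: prod_power_distrib c(1) prod_dividef)
    ultimately have "weighted_hom V E I p a ^ m / (\<Prod>e\<in>E. t e + \<delta>) \<le> (B * m) ^ m"
      by (simp add: power_mult_distrib)
    moreover have "0 < (\<Prod>e\<in>E. t e + \<delta>)" using t d by (intro prod_pos) (auto intro: add_nonneg_pos)
    ultimately show ?thesis by (simp add: pos_divide_le_eq)
  qed
  have "(\<lambda>n. (B * m) ^ m * (\<Prod>e\<in>E. t e + 1 / Suc n)) \<longlonglongrightarrow> (B * m) ^ m * (\<Prod>e\<in>E. t e + 0)"
    by (intro tendsto_mult tendsto_const tendsto_prod tendsto_add LIMSEQ_Suc[OF lim_1_over_n])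
  then have "weighted_hom V E I p a ^ m \<le> (B * m) ^ m * (\<Prod>e\<in>E. t e + 0)"
    by (rule LIMSEQ_le_const) (use main in auto)
  then show ?thesis unfolding B_def t_def m_def by simp
qed

section \<open>Tensor squares and removal of the constant\<close>

definition tensor_matrix :: "(nat \<Rightarrow> nat \<Rightarrow> real) \<Rightarrow> nat \<Rightarrow> nat \<Rightarrow> real" where
  "tensor_matrix a s t = a (fst (prod_decode s)) (fst (prod_decode t)) * a (snd (prod_decode s)) (snd (prod_decode t))"

definition tensor_weight :: "(nat \<Rightarrow> real) \<Rightarrow> nat \<Rightarrow> real" where
  "tensor_weight p s = p (fst (prod_decode s)) * p (snd (prod_decode s))"

text \<open>Pairs of indices are coded as natural numbers, so that tensor squaring stays within one
  type and can be iterated by induction.\<close>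

definition tensor_index :: "nat set \<Rightarrow> nat set" where
  "tensor_index I = prod_encode ` (I \<times> I)"

lemma tensor_index_D:
  assumes "s \<in> tensor_index I"
  shows "fst (prod_decode s) \<in> I" "snd (prod_decode s) \<in> I"
  using assms by (auto simp: tensor_index_def)

lemma sum_tensor_weight: "sum (tensor_weight p) (tensor_index I) = sum p I * sum p I"
proof -
  have "sum (tensor_weight p) (tensor_index I) = (\<Sum>r\<in>I \<times> I. p (fst r) * p (snd r))"
    unfolding tensor_index_def by (subst sum.reindex) (auto simp: tensor_weight_def inj_prod_encode)
  then show ?thesis by (simp add: sum_product sum.cartesian_product case_prod_beta)
qed

text \<open>A map into pairs is a pair of maps, and vertex weights and edge values multiply, so the
  sum factors. Since the matrix may vary with the edge, this covers both the decorated density and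
  the densities of the single matrices.\<close>

lemma weighted_hom_tensor:
  fixes a :: "'v set \<Rightarrow> nat \<Rightarrow> nat \<Rightarrow> real"
  assumes G: "finite_simple_graph V E"
    and a: "\<And>e i j. e \<in> E \<Longrightarrow> i \<in> I \<Longrightarrow> j \<in> I \<Longrightarrow> a e i j = a e j i"
  shows "weighted_hom V E (tensor_index I) (tensor_weight p) (\<lambda>e. tensor_matrix (a e)) = (weighted_hom V E I p a)\<^sup>2"
proof -
  define T where "T \<phi> = (\<Prod>v\<in>V. p (\<phi> v)) * (\<Prod>e\<in>E. edge_val (a e) \<phi> e)" for \<phi>
  have tensor_term: "(\<Prod>v\<in>V. tensor_weight p (\<Psi> v)) * (\<Prod>e\<in>E. edge_val (tensor_matrix (a e)) \<Psi> e) =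
      T (restrict (\<lambda>v. fst (prod_decode (\<Psi> v))) V) * T (restrict (\<lambda>v. snd (prod_decode (\<Psi> v))) V)"
    if Psi: "\<Psi> \<in> V \<rightarrow>\<^sub>E tensor_index I" for \<Psi>
  proof -
    let ?f = "restrict (\<lambda>v. fst (prod_decode (\<Psi> v))) V" and ?g = "restrict (\<lambda>v. snd (prod_decode (\<Psi> v))) V"
    have "edge_val (tensor_matrix (a e)) \<Psi> e = edge_val (a e) ?f e * edge_val (a e) ?g e" if e: "e \<in> E" for e
    proof -
      obtain u v where uv: "u \<in> V" "v \<in> V" "e = {u, v}" using graph_edgeE[OF G e] .
      have PI: "\<Psi> u \<in> tensor_index I" "\<Psi> v \<in> tensor_index I" using Psi uv by auto
      note D = tensor_index_D[OF PI(1)] tensor_index_D[OF PI(2)]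
      have "edge_val (tensor_matrix (a e)) \<Psi> {u, v} = tensor_matrix (a e) (\<Psi> u) (\<Psi> v)"
        by (rule edge_val_sym[of "tensor_index I" "tensor_matrix (a e)" \<Psi> u v, OF _ PI])
          (use a[OF e] tensor_index_D in \<open>simp add: tensor_matrix_def\<close>)
      moreover have "edge_val (a e) ?f {u, v} = a e (?f u) (?f v)"
        by (rule edge_val_sym[of I "a e" ?f u v, OF a[OF e]]) (use D uv in auto)
      moreover have "edge_val (a e) ?g {u, v} = a e (?g u) (?g v)"
        by (rule edge_val_sym[of I "a e" ?g u v, OF a[OF e]]) (use D uv in auto)
      ultimately show ?thesis using uv by (simp add: tensor_matrix_def)
    qed
    then show ?thesis unfolding T_def by (simp add: tensor_weight_def prod.distrib)
  qed
  have "weighted_hom V E (tensor_index I) (tensor_weight p) (\<lambda>e. tensor_matrix (a e)) =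
      (\<Sum>\<Psi>\<in>V \<rightarrow>\<^sub>E tensor_index I. T (restrict (\<lambda>v. fst (prod_decode (\<Psi> v))) V) * T (restrict (\<lambda>v. snd (prod_decode (\<Psi> v))) V))"
    unfolding weighted_hom_def by (intro sum.cong refl tensor_term)
  also have "\<dots> = (\<Sum>r\<in>(V \<rightarrow>\<^sub>E I) \<times> (V \<rightarrow>\<^sub>E I). T (fst r) * T (snd r))"
  proof (rule sum.reindex_bij_witness[where
        j = "\<lambda>\<Psi>. (restrict (\<lambda>v. fst (prod_decode (\<Psi> v))) V, restrict (\<lambda>v. snd (prod_decode (\<Psi> v))) V)" and
        i = "\<lambda>r. restrict (\<lambda>v. prod_encode (fst r v, snd r v)) V"])
    fix \<Psi> assume Psi: "\<Psi> \<in> V \<rightarrow>\<^sub>E tensor_index I"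
    show "restrict (\<lambda>v. prod_encode (fst (restrict (\<lambda>v. fst (prod_decode (\<Psi> v))) V, restrict (\<lambda>v. snd (prod_decode (\<Psi> v))) V) v,
        snd (restrict (\<lambda>v. fst (prod_decode (\<Psi> v))) V, restrict (\<lambda>v. snd (prod_decode (\<Psi> v))) V) v)) V = \<Psi>"
      using Psi by (intro ext) (auto simp: PiE_def extensional_def)
    show "(restrict (\<lambda>v. fst (prod_decode (\<Psi> v))) V, restrict (\<lambda>v. snd (prod_decode (\<Psi> v))) V) \<in> (V \<rightarrow>\<^sub>E I) \<times> (V \<rightarrow>\<^sub>E I)"
      using Psi tensor_index_D by (auto simp: PiE_iff)
  next
    fix r assume r: "r \<in> (V \<rightarrow>\<^sub>E I) \<times> (V \<rightarrow>\<^sub>E I)"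
    then obtain f g where fg: "r = (f, g)" "f \<in> V \<rightarrow>\<^sub>E I" "g \<in> V \<rightarrow>\<^sub>E I" by blast
    show "restrict (\<lambda>v. prod_encode (fst r v, snd r v)) V \<in> V \<rightarrow>\<^sub>E tensor_index I"
      using fg by (auto simp: tensor_index_def)
    have "restrict (\<lambda>v. fst (prod_decode (restrict (\<lambda>v. prod_encode (fst r v, snd r v)) V v))) V = f"
      "restrict (\<lambda>v. snd (prod_decode (restrict (\<lambda>v. prod_encode (fst r v, snd r v)) V v))) V = g"
      using fg by (auto simp: fun_eq_iff PiE_def extensional_def)
    then show "(restrict (\<lambda>v. fst (prod_decode (restrict (\<lambda>v. prod_encode (fst r v, snd r v)) V v))) V,
        restrict (\<lambda>v. snd (prod_decode (restrict (\<lambda>v. prod_encode (fst r v, snd r v)) V v))) V) = r"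
      using fg by simp
  qed simp
  also have "\<dots> = (weighted_hom V E I p a)\<^sup>2"
    unfolding weighted_hom_def T_def[symmetric]
    by (simp add: power2_eq_square sum_product sum.cartesian_product case_prod_beta)
  finally show ?thesis .
qed

text \<open>If \<open>y < x\<close>, the powers of \<open>x / y\<close> are unbounded and eventually
  exceed \<open>K\<close>. Exponents \<open>2 ^ n\<close> are what repeated squaring
  supplies.\<close>

lemma le_of_power_le_const:
  fixes x y K :: real
  assumes "\<And>n. x ^ (2 ^ n) \<le> K * y ^ (2 ^ n)" "0 \<le> x" "0 \<le> y"
  shows "x \<le> y"
proof (rule ccontr)
  assume "\<not> x \<le> y"
  then have xy: "y < x" by simp
  have "y \<noteq> 0"
  proof
    assume "y = 0"
    then show False using assms(1)[of 0] xy by simp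
  qed
  then have y: "y > 0" using assms by simp
  then obtain n where n: "K < (x / y) ^ n" using real_arch_pow[of "x / y" K] xy by auto
  have "(x / y) ^ n \<le> (x / y) ^ (2 ^ n)"
    using xy y by (intro power_increasing) (auto simp: less_imp_le)
  also have "\<dots> \<le> K" using assms(1)[of n] y by (simp add: power_divide pos_divide_le_eq)
  finally show False using n by simp
qed

text \<open>Tensor power trick: the constant \<open>?K\<close> depends on \<open>card E\<close>
  only. Applying the inequality to the n-fold tensor square raises both densities to the power
  \<open>2 ^ n\<close> and leaves \<open>?K\<close> as it is.\<close>

lemma weak_hoelder_weighted:
  fixes a :: "'v set \<Rightarrow> nat \<Rightarrow> nat \<Rightarrow> real"
  assumes M: "prob_space M" "standard_borel M" "atomless M"
    and G: "finite_simple_graph V E" and conn: "connected_graph V E" and ss: "step_sidorenko M V E"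
    and E0: "E \<noteq> {}" and I: "finite I"
    and p: "\<And>i. i \<in> I \<Longrightarrow> 0 \<le> p i" "sum p I = 1"
    and a: "\<And>e i j. e \<in> E \<Longrightarrow> i \<in> I \<Longrightarrow> j \<in> I \<Longrightarrow> a e i j = a e j i \<and> 0 \<le> a e i j \<and> a e i j \<le> 1"
  shows "weighted_hom V E I p a ^ card E \<le> (\<Prod>e\<in>E. weighted_hom V E I p (\<lambda>_. a e))"
proof -
  let ?K = "((real (card E))\<^sup>2 ^ card E * card E) ^ card E"
  \<comment> \<open>Stated for arbitrary \<open>I\<close>, \<open>p\<close> and \<open>a\<close>,
    because the induction step is applied to the tensor square of the data.\<close>
  have pow: "(weighted_hom V E I p a ^ card E) ^ (2 ^ n) \<le> ?K * (\<Prod>e\<in>E. weighted_hom V E I p (\<lambda>_. a e)) ^ (2 ^ n)"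
    if I: "finite I" and p: "\<And>i. i \<in> I \<Longrightarrow> 0 \<le> p i" "sum p I = 1"
      and a: "\<And>e i j. e \<in> E \<Longrightarrow> i \<in> I \<Longrightarrow> j \<in> I \<Longrightarrow> a e i j = a e j i \<and> 0 \<le> a e i j \<and> a e i j \<le> 1"
    for n I p and a :: "'v set \<Rightarrow> nat \<Rightarrow> nat \<Rightarrow> real"
    using that
  proof (induction n arbitrary: I p a)
    case 0
    then show ?case using weak_hoelder_up_to_constant[OF M G conn ss E0, of I p a] by simp
  next
    case (Suc n)
    let ?a = "\<lambda>e. tensor_matrix (a e)"
    have "(weighted_hom V E (tensor_index I) (tensor_weight p) ?a ^ card E) ^ (2 ^ n) \<le>
        ?K * (\<Prod>e\<in>E. weighted_hom V E (tensor_index I) (tensor_weight p) (\<lambda>_. ?a e)) ^ (2 ^ n)"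
    proof (rule Suc.IH)
      show "finite (tensor_index I)" using Suc.prems(1) by (simp add: tensor_index_def)
      show "sum (tensor_weight p) (tensor_index I) = 1" using Suc.prems(3) by (simp add: sum_tensor_weight)
      show "0 \<le> tensor_weight p i" if "i \<in> tensor_index I" for i
        using tensor_index_D[OF that] Suc.prems(2) by (simp add: tensor_weight_def)
      show "?a e i j = ?a e j i \<and> 0 \<le> ?a e i j \<and> ?a e i j \<le> 1"
        if "e \<in> E" "i \<in> tensor_index I" "j \<in> tensor_index I" for e i j
        using tensor_index_D[OF that(2)] tensor_index_D[OF that(3)] Suc.prems(4)[OF that(1)]
        unfolding tensor_matrix_def by (auto intro!: mult_le_one)
    qed
    moreover have "weighted_hom V E (tensor_index I) (tensor_weight p) ?a = (weighted_hom V E I p a)\<^sup>2"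
      by (rule weighted_hom_tensor[OF G]) (use Suc.prems(4) in blast)
    moreover have "weighted_hom V E (tensor_index I) (tensor_weight p) (\<lambda>_. ?a e) = (weighted_hom V E I p (\<lambda>_. a e))\<^sup>2" if "e \<in> E" for e
      by (rule weighted_hom_tensor[OF G]) (use Suc.prems(4) that in blast)
    ultimately have "(((weighted_hom V E I p a)\<^sup>2) ^ card E) ^ (2 ^ n) \<le> ?K * (\<Prod>e\<in>E. (weighted_hom V E I p (\<lambda>_. a e))\<^sup>2) ^ (2 ^ n)"
      by simp
    then show ?case by (simp add: prod_power_distrib[symmetric] power_mult[symmetric] mult_ac)
  qed
  show ?thesis
  proof (rule le_of_power_le_const)
    show "(weighted_hom V E I p a ^ card E) ^ (2 ^ n) \<le> ?K * (\<Prod>e\<in>E. weighted_hom V E I p (\<lambda>_. a e)) ^ (2 ^ n)" for n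
      by (rule pow[OF I p a])
    show "0 \<le> weighted_hom V E I p a ^ card E" by (intro zero_le_power weighted_hom_nonneg[OF G p(1) a])
    show "0 \<le> (\<Prod>e\<in>E. weighted_hom V E I p (\<lambda>_. a e))"
      by (intro prod_nonneg ballI weighted_hom_nonneg[OF G p(1)]) (use a in auto)
  qed
qed

text \<open>Finite-valued decorations satisfy the inequality and are dense in
  \<open>L\<^sup>1\<close>; both sides are continuous in that distance, so the inequality passes to
  the limit.\<close>

lemma step_sidorenko_imp_weakly_hoelder:
  assumes M: "prob_space M" "standard_borel M" "atomless M"
    and G: "finite_simple_graph V E" and conn: "connected_graph V E" and ss: "step_sidorenko M V E"
  shows "weakly_hoelder M V E"
  unfolding weakly_hoelder_def
proof (intro allI impI)
  interpret prob_space M by fact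
  have E: "finite E" by (rule finite_edges[OF G])
  fix w assume w: "\<forall>e\<in>E. graphon M (w e)"
  then have w': "\<And>e. e \<in> E \<Longrightarrow> graphon M (w e)" by blast
  show "decorated_density M V E w ^ card E \<le> (\<Prod>e\<in>E. hom_density M V E (w e))"
  \<comment> \<open>Without edges both sides are 1: a zeroth power and an empty product.\<close>
  proof (cases "E = {}")
    case False
    have "\<exists>u. (\<forall>e\<in>E. graphon M (u e) \<and> graphon_dist M (w e) (u e) < 1 / Suc n) \<and>
        decorated_density M V E u ^ card E \<le> (\<Prod>e\<in>E. hom_density M V E (u e))" for n
    proof -
      have n: "1 / real (Suc n) > 0" by simp
      obtain \<kappa> :: "'a \<Rightarrow> nat" and k a where k: "\<kappa> \<in> measurable M (count_space {..<k})"
        and a: "\<forall>e\<in>E. \<forall>i<k. \<forall>j<k. a e i j = a e j i \<and> 0 \<le> a e i j \<and> a e i j \<le> 1"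
        and dist: "\<forall>e\<in>E. graphon_dist M (w e) (\<lambda>x y. a e (\<kappa> x) (\<kappa> y)) < 1 / real (Suc n)"
        using finite_valued_approximation[of M E w "1 / real (Suc n)", OF M(1) E w' n] by blast
      define u where "u e x y = a e (\<kappa> x) (\<kappa> y)" for e x y
      let ?p = "\<lambda>i. measure M (\<kappa> -` {i} \<inter> space M)"
      have kk: "\<kappa> x < k" if "x \<in> space M" for x using measurable_space[OF k that] by simp
      have "sum ?p {..<k} = measure M (\<Union>i<k. \<kappa> -` {i} \<inter> space M)"
        using vimage_count_space_sets[OF k]
        by (intro finite_measure_finite_Union[symmetric]) (auto simp: disjoint_family_on_def)
      also have "(\<Union>i<k. \<kappa> -` {i} \<inter> space M) = space M" using kk by auto
      finally have p1: "sum ?p {..<k} = 1" using prob_space by simp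
      have "decorated_density M V E u = weighted_hom V E {..<k} ?p a"
        unfolding u_def by (rule decorated_density_finite_valued[OF M(1) G finite_lessThan k])
      moreover have "hom_density M V E (u e) = weighted_hom V E {..<k} ?p (\<lambda>_. a e)" for e
        unfolding u_def by (rule hom_density_finite_valued[OF M(1) G finite_lessThan k])
      moreover have "weighted_hom V E {..<k} ?p a ^ card E \<le> (\<Prod>e\<in>E. weighted_hom V E {..<k} ?p (\<lambda>_. a e))"
        by (rule weak_hoelder_weighted[OF M G conn ss False finite_lessThan _ p1]) (use a in auto)
      moreover have "graphon M (u e)" if "e \<in> E" for e
        unfolding u_def by (rule graphon_finite_valued[OF finite_lessThan k]) (use a that in auto)
      moreover have "graphon_dist M (w e) (u e) < 1 / Suc n" if "e \<in> E" for e
        using dist that unfolding u_def by blast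
      ultimately show ?thesis by (intro exI[of _ u]) simp
    qed
    then obtain u where u: "\<forall>n. (\<forall>e\<in>E. graphon M (u n e) \<and> graphon_dist M (w e) (u n e) < 1 / real (Suc n)) \<and>
        decorated_density M V E (u n) ^ card E \<le> (\<Prod>e\<in>E. hom_density M V E (u n e))"
      using choice[of "\<lambda>n u. (\<forall>e\<in>E. graphon M (u e) \<and> graphon_dist M (w e) (u e) < 1 / real (Suc n)) \<and>
        decorated_density M V E u ^ card E \<le> (\<Prod>e\<in>E. hom_density M V E (u e))"] by blast
    have ug: "\<And>e. e \<in> E \<Longrightarrow> graphon M (u n e)" and ud: "\<And>e. e \<in> E \<Longrightarrow> graphon_dist M (w e) (u n e) < 1 / real (Suc n)" for n
      using u by blast+
    have null: "(\<lambda>n. card E * (1 / real (Suc n))) \<longlonglongrightarrow> 0"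
      using tendsto_mult_right_zero[OF LIMSEQ_Suc[OF lim_1_over_n]] .
    have lim1: "(\<lambda>n. decorated_density M V E (u n)) \<longlonglongrightarrow> decorated_density M V E w"
    proof (rule LIM_zero_cancel, rule Lim_null_comparison[OF always_eventually null], rule allI)
      fix n
      have "\<bar>decorated_density M V E w - decorated_density M V E (u n)\<bar> \<le> (\<Sum>e\<in>E. graphon_dist M (w e) (u n e))"
        by (rule decorated_density_diff[OF M(1) G w' ug])
      also have "\<dots> \<le> (\<Sum>e\<in>E. 1 / real (Suc n))" using ud by (intro sum_mono less_imp_le)
      finally show "norm (decorated_density M V E (u n) - decorated_density M V E w) \<le> card E * (1 / real (Suc n))"
        by (simp add: abs_minus_commute)
    qed
    have lim2: "(\<lambda>n. hom_density M V E (u n e)) \<longlonglongrightarrow> hom_density M V E (w e)" if e: "e \<in> E" for e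
    proof (rule LIM_zero_cancel, rule Lim_null_comparison[OF always_eventually null], rule allI)
      fix n
      have "\<bar>hom_density M V E (w e) - hom_density M V E (u n e)\<bar> \<le> card E * graphon_dist M (w e) (u n e)"
        by (rule hom_density_diff[OF M(1) G w'[OF e] ug[OF e]])
      also have "\<dots> \<le> card E * (1 / real (Suc n))" using less_imp_le[OF ud[OF e, of n]] by (intro mult_left_mono) auto
      finally show "norm (hom_density M V E (u n e) - hom_density M V E (w e)) \<le> card E * (1 / real (Suc n))"
        by (simp add: abs_minus_commute)
    qed
    show ?thesis
      by (rule LIMSEQ_le[OF tendsto_power[OF lim1] tendsto_prod[OF lim2]]) (use u in auto)
  qed simp
qed

theorem theorem3p25:
  fixes M :: "'a measure" and V :: "'v set" and E :: "'v set set"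
  assumes "prob_space M" and "standard_borel M" and "atomless M"
    and "finite_simple_graph V E" and "connected_graph V E"
  shows "(cut_distance_compatible M (hom_density M V E) \<longleftrightarrow> step_sidorenko M V E) \<and>
         (cut_distance_compatible M (hom_density M V E) \<longrightarrow> weakly_hoelder M V E)"
  using cut_distance_compatible_imp_step_sidorenko[OF assms(1-4)]
    step_sidorenko_imp_cut_distance_compatible[OF assms(1,4)]
    step_sidorenko_imp_weakly_hoelder[OF assms(1-5)]
  by blast

end
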